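(* Let $\alpha:[0,1]\to[c,d]\subset(1,2)$ be continuously differentiable. Let $(\Gamma_i)_{i\ge1}$ be the arrival times of a Poisson process with unit rate, $(V_i)_{i\ge1}$ i.i.d. random variables uniformly distributed on $[0,1]$, and $(\gamma_i)_{i\ge1}$ i.i.d. with $P(\gamma_i=1)=P(\gamma_i=-1)=1/2$, the three sequences being independent. Define $$X(t,u)=C_{\alpha(u)}^{1/\alpha(u)}\sum_{i=1}^\infty\gamma_i\Gamma_i^{-1/\alpha(u)}\mathbf{1}_{[0,t]}(V_i)$$ and the symmetric multistable Lévy motion $Y(t)=X(t,t)$. Then for all $t\in(0,1)$ and $0<\eta<c$, as $\varepsilon\to0^+$, $$\mathsf{E}\big[|Y(t+\varepsilon)-Y(t)|^\eta\big]\sim\frac{2^{\eta-1}\,\Gamma\big(1-\frac{\eta}{\alpha(t)}\big)}{\eta\int_0^\infty u^{-\eta-1}\sin^2(u)\,du}\;\varepsilon^{\frac{\eta}{\alpha(t)}}.$$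
   Context: $C_\eta=\big(\int_0^\infty x^{-\eta}\sin x\,dx\big)^{-1}$ for $\eta\in(0,2)$. $\Gamma(\cdot)$ without index is Euler's Gamma function. $A\sim B$ means that the ratio tends to $1$. *)

theory Defs
  imports "HOL-Probability.Probability" "HOL-Library.Landau_Symbols"
begin

text \<open>The Henstock--Kurzweil integral over the half-line is also the improper one, so this is
  meaningful for every \<open>\<eta>\<close> in \<open>(0,2)\<close>, although the integrand is absolutely integrable
  only for \<open>\<eta> > 1\<close>.\<close>

definition stable_const :: "real \<Rightarrow> real" where
  "stable_const \<eta> = inverse (integral {0..} (\<lambda>x. x powr (- \<eta>) * sin x))"

definition C1_on :: "real set \<Rightarrow> (real \<Rightarrow> real) \<Rightarrow> bool" where
  "C1_on S f \<longleftrightarrow>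
    (\<exists>f'. (\<forall>x\<in>S. (f has_real_derivative f' x) (at x within S)) \<and> continuous_on S f')"

text \<open>A Poisson process is indexed by \<open>[0,\<infinity>)\<close>; the values at negative times play no role.\<close>

definition poisson_process :: "'a measure \<Rightarrow> real \<Rightarrow> (real \<Rightarrow> 'a \<Rightarrow> nat) \<Rightarrow> bool" where
  "poisson_process M rate N \<longleftrightarrow>
    (\<forall>t\<ge>0. N t \<in> measurable M (count_space UNIV)) \<and>
    (AE \<omega> in M. N 0 \<omega> = 0 \<and> mono_on {0..} (\<lambda>t. N t \<omega>) \<and>
       (\<forall>t\<ge>0. ((\<lambda>s. N s \<omega>) \<longlongrightarrow> N t \<omega>) (at_right t))) \<and>
    (\<forall>n \<tau>. 0 \<le> \<tau> 0 \<and> (\<forall>k<n. \<tau> k < \<tau> (Suc k)) \<longrightarrow>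
       prob_space.indep_vars M (\<lambda>_. count_space UNIV)
         (\<lambda>k \<omega>. N (\<tau> (Suc k)) \<omega> - N (\<tau> k) \<omega>) {..<n::nat}) \<and>
    (\<forall>s t. 0 \<le> s \<and> s < t \<longrightarrow>
       distr M (count_space UNIV) (\<lambda>\<omega>. N t \<omega> - N s \<omega>) =
         measure_pmf (poisson_pmf (rate * (t - s))))"

text \<open>Sequences are indexed from \<open>0\<close>: \<open>\<Gamma> i\<close> is the arrival time number \<open>i + 1\<close>.
  Finiteness is required because \<open>card\<close> is \<open>0\<close> on infinite sets.\<close>

definition poisson_arrival_times :: "'a measure \<Rightarrow> real \<Rightarrow> (nat \<Rightarrow> 'a \<Rightarrow> real) \<Rightarrow> bool" where
  "poisson_arrival_times M rate \<Gamma> \<longleftrightarrow>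
    (\<forall>i. \<Gamma> i \<in> borel_measurable M) \<and>
    (AE \<omega> in M. 0 < \<Gamma> 0 \<omega> \<and> mono (\<lambda>i. \<Gamma> i \<omega>) \<and> (\<forall>t. finite {i. \<Gamma> i \<omega> \<le> t})) \<and>
    poisson_process M rate (\<lambda>t \<omega>. card {i. \<Gamma> i \<omega> \<le> t})"

text \<open>The series converges almost surely, but only conditionally; \<open>suminf\<close> is the limit of the
  partial sums in the order of the arrival times.\<close>

definition multistable_field ::
  "(real \<Rightarrow> real) \<Rightarrow> (nat \<Rightarrow> 'a \<Rightarrow> real) \<Rightarrow> (nat \<Rightarrow> 'a \<Rightarrow> real) \<Rightarrow> (nat \<Rightarrow> 'a \<Rightarrow> real) \<Rightarrow>
    real \<Rightarrow> real \<Rightarrow> 'a \<Rightarrow> real" where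
  "multistable_field \<alpha> \<Gamma> V \<gamma> t u \<omega> =
    stable_const (\<alpha> u) powr (1 / \<alpha> u) *
    (\<Sum>i. \<gamma> i \<omega> * \<Gamma> i \<omega> powr (- 1 / \<alpha> u) * indicator {0..t} (V i \<omega>))"

definition multistable_levy_motion ::
  "(real \<Rightarrow> real) \<Rightarrow> (nat \<Rightarrow> 'a \<Rightarrow> real) \<Rightarrow> (nat \<Rightarrow> 'a \<Rightarrow> real) \<Rightarrow> (nat \<Rightarrow> 'a \<Rightarrow> real) \<Rightarrow>
    real \<Rightarrow> 'a \<Rightarrow> real" where
  "multistable_levy_motion \<alpha> \<Gamma> V \<gamma> t \<omega> = multistable_field \<alpha> \<Gamma> V \<gamma> t t \<omega>"

end

theory Submission
  imports Defs
begin

text \<open>The symmetric signs make the characteristic function of an increment real: integrating out the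
  signs and the positions turns it into the expectation of a product over the arrival times, which the
  exponential formula for the Poisson process evaluates as \<open>exp (- \<psi>\<^sub>\<epsilon> u)\<close>, where
  \<open>\<psi>\<^sub>\<epsilon> u = t * (\<integral> 1 - cos (u * D\<^sub>\<epsilon> x) dx) + \<epsilon> * u powr \<alpha> (t + \<epsilon>)\<close> and \<open>D\<^sub>\<epsilon>\<close> is the difference of the
  kernels \<open>x powr (- 1 / \<alpha>)\<close> (with their constants) at the indices \<open>\<alpha> (t + \<epsilon>)\<close> and \<open>\<alpha> t\<close>.
  The moment is recovered from \<open>\<bar>y\<bar> powr \<eta> = K\<inverse> * \<integral> (1 - cos (u * y)) * u powr (- \<eta> - 1) du\<close>.
  After rescaling \<open>u\<close> by \<open>\<epsilon> powr (- 1 / \<alpha> t)\<close>, the second summand of \<open>\<psi>\<^sub>\<epsilon>\<close> tends to \<open>u powr \<alpha> t\<close>,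
  while the first one vanishes because \<open>D\<^sub>\<epsilon>\<close> is of order \<open>\<epsilon>\<close> and \<open>\<alpha> t > 1\<close>. Dominated convergence
  leaves \<open>\<integral> (1 - exp (- (u powr \<alpha> t))) * u powr (- \<eta> - 1) du = Gamma (1 - \<eta> / \<alpha> t) / \<eta>\<close>.\<close>

subsection \<open>Integrals over the half-line\<close>

text \<open>The obstacle is a majorant uniform in \<epsilon> for the part of the exponent that
  vanishes. Against \<open>u powr (- \<eta> - 1)\<close> it has to behave near \<open>u = 0\<close>
  like \<open>u powr p\<close> with \<open>p > \<eta>\<close>; but bounding \<open>1 - cos\<close>
  of the kernel by its \<open>p\<close>-th power is integrable near \<open>x = 0\<close> only if
  \<open>p < \<alpha> t\<close>. The room between \<eta> and \<open>\<alpha> t\<close> supplies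
  \<open>p\<close>, and for large \<open>x\<close> the square serves because
  \<open>\<alpha> t < 2\<close>. Since the index moves, kernels with different exponents are
  compared, which costs a factor \<open>ln x\<close>; it is absorbed by widening the exponents
  slightly at both ends of the half-line, and \<open>powr_env\<close> is the function that records
  the two ends. In the other summand the moving index leaves
  \<open>\<epsilon> powr (1 - \<alpha> (t + \<epsilon>) / \<alpha> t)\<close>, harmless because
  \<open>\<epsilon> * ln \<epsilon>\<close> tends to 0. On the probabilistic side the series need
  not converge absolutely, while the exponential formula concerns finite products. The formula is
  therefore used for the arrivals up to a time \<open>T\<close>, and the convergence of the series
  as \<open>T\<close> grows is obtained separately from almost sure growth bounds for sign sums and
  arrival times.\<close>

definition powr_env :: "real \<Rightarrow> real \<Rightarrow> real \<Rightarrow> real" where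
  "powr_env a b x = (if x \<le> 1 then x powr a else x powr b)"

lemma powr_env_measurable [measurable]: "powr_env a b \<in> borel_measurable borel"
  unfolding powr_env_def[abs_def] by measurable

lemma powr_env_nonneg: "0 \<le> powr_env a b x"
  by (simp add: powr_env_def)

lemma powr_env_mult: "powr_env a b x * powr_env a' b' x = powr_env (a + a') (b + b') x"
  by (simp add: powr_env_def powr_add)

lemma powr_env_mult_powr: "powr_env a b x * x powr s = powr_env (a + s) (b + s) x"
  by (simp add: powr_env_def powr_add)

text \<open>Powers decrease in the exponent below 1 and increase above 1, so the extreme exponents
  dominate a whole range of moving ones. The two ends stay separate because integrability at 0 and
  at infinity constrains them separately.\<close>

lemma powr_le_powr_env: "0 < x \<Longrightarrow> a \<le> s \<Longrightarrow> s \<le> b \<Longrightarrow> x powr s \<le> powr_env a b x"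
  by (auto simp: powr_env_def powr_mono powr_mono')

text \<open>Nonnegativity upgrades gauge integrability to absolute integrability for the completed
  measure; Borel measurability brings the result back to \<open>lborel\<close>.\<close>

lemma integrable_lborel_of_has_integral:
  fixes f :: "real \<Rightarrow> real"
  assumes "(f has_integral I) S" and "\<And>x. x \<in> S \<Longrightarrow> 0 \<le> f x"
    and "(\<lambda>x. indicator S x * f x) \<in> borel_measurable borel"
  shows "set_integrable lborel S f"
proof -
  have "f absolutely_integrable_on S"
    using assms by (intro nonnegative_absolutely_integrable_1) (auto simp: integrable_on_def)
  then show ?thesis
    using assms(3) by (simp add: set_integrable_def integrable_completion)
qed

lemma set_integrable_powr_env:
  assumes "a > -1" "b < -1"
  shows "set_integrable lborel {0<..} (powr_env a b)"
proof -
  have 1: "set_integrable lborel {0..1} (powr_env a b)"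
  proof (rule integrable_lborel_of_has_integral)
    show "(powr_env a b has_integral (1 / (a+1))) {0..1}"
      using has_integral_powr_from_0[of a 1] assms
      by (subst has_integral_cong[of "{0..1}" "powr_env a b" "\<lambda>x. x powr a"])
         (auto simp: powr_env_def)
  qed (auto simp: powr_env_def)
  have 2: "set_integrable lborel {1..} (powr_env a b)"
  proof (rule integrable_lborel_of_has_integral)
    show "(powr_env a b has_integral (- 1 / (b+1))) {1..}"
      using has_integral_powr_to_inf[of b 1] assms
      by (subst has_integral_cong[of "{1..}" "powr_env a b" "\<lambda>x. x powr b"])
         (auto simp: powr_env_def)
  qed (auto simp: powr_env_def)
  have "set_integrable lborel ({0..1} \<union> {1..}) (powr_env a b)"
    by (intro set_integrable_Un 1 2) auto
  then show ?thesis by (rule set_integrable_subset) auto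
qed

lemma set_integrable_powr_env_bound:
  fixes f :: "real \<Rightarrow> real"
  assumes "a > -1" "b < -1" and [measurable]: "f \<in> borel_measurable borel"
    and "\<And>x. 0 < x \<Longrightarrow> \<bar>f x\<bar> \<le> C * powr_env a b x"
  shows "set_integrable lborel {0<..} f"
proof (rule set_integrable_bound[where f="\<lambda>x. C * powr_env a b x"])
  show "set_integrable lborel {0<..} (\<lambda>x. C * powr_env a b x)"
    using set_integrable_powr_env[OF assms(1,2)] by simp
  show "AE x in lborel. x \<in> {0<..} \<longrightarrow> norm (f x) \<le> norm (C * powr_env a b x)"
    using assms(4) by (force intro!: AE_I2)
qed (auto simp: set_borel_measurable_def)

text \<open>This is \<open>ln z \<le> z - 1\<close> at \<open>z = x powr (- k)\<close> or
  \<open>z = x powr k\<close>: a logarithm costs an arbitrarily small change of the exponent at each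
  end.\<close>

lemma abs_ln_le_powr_env:
  assumes "0 < x" "0 < k"
  shows "\<bar>ln x\<bar> \<le> powr_env (-k) k x / k"
proof (cases "x \<le> 1")
  case True
  have "ln (x powr (-k)) \<le> x powr (-k) - 1" by (rule ln_le_minus_one) (use assms in simp)
  then have "-k * ln x \<le> x powr (-k)" using assms by (simp add: ln_powr)
  then have "- ln x \<le> x powr (-k) / k" using assms by (simp add: field_simps)
  then show ?thesis using True assms by (simp add: powr_env_def)
next
  case False
  have "ln (x powr k) \<le> x powr k - 1" by (rule ln_le_minus_one) (use assms in simp)
  then have "k * ln x \<le> x powr k" using assms by (simp add: ln_powr)
  then have "ln x \<le> x powr k / k" using assms by (simp add: field_simps)
  then show ?thesis using False assms by (simp add: powr_env_def)
qed

lemma one_minus_cos_le_square: "1 - cos x \<le> x\<^sup>2 / 2" for x :: real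
proof -
  have "1 - cos x = 2 * (sin (x/2))\<^sup>2" using cos_double_sin[of "x/2"] by simp
  also have "(sin (x/2))\<^sup>2 \<le> (x/2)\<^sup>2"
    using abs_sin_x_le_abs_x[of "x/2"] by (metis abs_le_square_iff)
  finally show ?thesis by (simp add: power2_eq_square)
qed

text \<open>Interpolates between the bounded and the quadratic estimate, so that the exponent can be
  chosen differently for small and for large arguments of the kernel.\<close>

lemma one_minus_cos_le_powr:
  fixes x p :: real
  assumes "0 \<le> p" "p \<le> 2"
  shows "1 - cos x \<le> 2 * \<bar>x\<bar> powr p"
proof (cases "\<bar>x\<bar> \<le> 1")
  case True
  have "x\<^sup>2 \<le> \<bar>x\<bar> powr p"
  \<comment> \<open>At 0 both sides vanish, since \<open>0 powr p = 0\<close> even for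
    \<open>p = 0\<close>.\<close>
  proof (cases "x = 0")
    case False
    then have "\<bar>x\<bar> powr 2 \<le> \<bar>x\<bar> powr p" using True assms by (intro powr_mono') auto
    then show ?thesis using False by simp
  qed simp
  with one_minus_cos_le_square[of x] show ?thesis by (smt (verit) field_sum_of_halves zero_le_power2)
next
  case False
  then have "1 \<le> \<bar>x\<bar> powr p" using assms by (simp add: ge_one_powr_ge_zero)
  then show ?thesis using cos_ge_minus_one[of x] by linarith
qed

lemma one_minus_cos_le_powr_env: "0 < x \<Longrightarrow> 1 - cos x \<le> 2 * powr_env 2 0 x"
  using one_minus_cos_le_powr[of 2 x] one_minus_cos_le_powr[of 0 x]
  by (auto simp: powr_env_def)

lemma abs_sin_le_powr_env: "0 < x \<Longrightarrow> \<bar>sin x\<bar> \<le> powr_env 1 0 x"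
  using abs_sin_x_le_abs_x[of x] by (auto simp: powr_env_def)

lemma abs_exp_diff_le: "\<bar>exp p - exp q\<bar> \<le> \<bar>p - q\<bar> * max (exp p) (exp q)" for p q :: real
proof -
  have *: "exp p - exp q \<le> (p - q) * exp p" for p q :: real
  proof -
    have "1 + (q - p) \<le> exp (q - p)" by (rule exp_ge_add_one_self)
    then have "(1 + (q - p)) * exp p \<le> exp (q - p) * exp p" by (intro mult_right_mono) auto
    then show ?thesis by (simp add: exp_diff field_simps)
  qed
  show ?thesis using *[of p q] *[of q p] by (cases "p \<le> q") (auto simp: max_def)
qed

text \<open>A mean value estimate in the exponent. The factor \<open>ln x\<close> that it produces
  is paid for by the extra \<open>k\<close> at both ends of the envelope.\<close>

lemma powr_diff_le_powr_env:
  assumes "0 < x" "0 < k" "p \<in> {lo..hi}" "q \<in> {lo..hi}"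
  shows "\<bar>x powr p - x powr q\<bar> \<le> \<bar>p - q\<bar> / k * powr_env (lo - k) (hi + k) x"
proof -
  have "\<bar>x powr p - x powr q\<bar> \<le> \<bar>p * ln x - q * ln x\<bar> * max (x powr p) (x powr q)"
    using abs_exp_diff_le[of "p * ln x" "q * ln x"] assms by (simp add: powr_def)
  also have "\<dots> = \<bar>p - q\<bar> * (\<bar>ln x\<bar> * max (x powr p) (x powr q))"
    by (simp add: abs_mult flip: left_diff_distrib)
  also have "\<dots> \<le> \<bar>p - q\<bar> * ((powr_env (-k) k x / k) * powr_env lo hi x)"
    using assms abs_ln_le_powr_env[of x k]
    by (intro mult_left_mono mult_mono) (auto simp: powr_le_powr_env powr_env_nonneg le_max_iff_disj)
  also have "\<dots> = \<bar>p - q\<bar> / k * powr_env (lo - k) (hi + k) x"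
    by (simp add: powr_env_mult add.commute)
  finally show ?thesis .
qed

text \<open>Bridges the gauge integrals over \<open>{0..}\<close> of the statement and of
  \<open>stable_const\<close> to the Lebesgue integrals over \<open>{0<..}\<close> of the proof. The
  value at 0 is harmless because \<open>0 powr s = 0\<close>.\<close>

lemma integral_Ici_0_eq_LINT:
  fixes f :: "real \<Rightarrow> real"
  assumes "set_integrable lborel {0<..} f" "f 0 = 0"
  shows "integral {0..} f = (LINT x:{0<..}|lborel. f x)"
proof -
  have eq: "(\<lambda>x. indicator {0<..} x *\<^sub>R f x) = (\<lambda>x. indicator {0..} x *\<^sub>R f x)"
    using assms(2) by (auto simp: indicator_def fun_eq_iff)
  have "set_integrable lborel {0..} f"
    using assms(1)[unfolded set_integrable_def eq] unfolding set_integrable_def .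
  from set_borel_integral_eq_integral(2)[OF this] show ?thesis
    by (simp only: set_lebesgue_integral_def eq)
qed

text \<open>The constant \<open>K\<close> of the moment formula, kept in the cosine form in which
  that formula arises.\<close>

definition cos_const :: "real \<Rightarrow> real" where
  "cos_const \<eta> = (LINT u:{0<..}|lborel. (1 - cos u) * u powr (- \<eta> - 1))"

lemma set_integrable_cos_const:
  fixes \<eta> :: real
  assumes "0 < \<eta>" "\<eta> < 2"
  shows "set_integrable lborel {0<..} (\<lambda>u. (1 - cos u) * u powr (- \<eta> - 1))"
proof (rule set_integrable_powr_env_bound[where C=2 and a="1 - \<eta>" and b="- \<eta> - 1"])
  show "\<bar>(1 - cos u) * u powr (- \<eta> - 1)\<bar> \<le> 2 * powr_env (1 - \<eta>) (- \<eta> - 1) u" if "0 < u" for u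
    using mult_right_mono[OF one_minus_cos_le_powr_env[OF that], of "u powr (- \<eta> - 1)"]
      powr_env_mult_powr[of 2 0 u "- \<eta> - 1"]
    by (simp add: abs_mult)
qed (use assms in auto)

text \<open>Rescaling \<open>u\<close> by \<open>\<bar>y\<bar>\<close> pulls out the power, the
  cosine being even. The nonnegative integral is used so that Tonelli applies later without knowing
  that the moment is finite.\<close>

lemma nn_integral_one_minus_cos:
  assumes \<eta>: "0 < \<eta>" "\<eta> < 2"
  shows "(\<integral>\<^sup>+u. ennreal (indicator {0<..} u * ((1 - cos (u * y)) * u powr (- \<eta> - 1))) \<partial>lborel)
       = ennreal (\<bar>y\<bar> powr \<eta> * cos_const \<eta>)"
proof (cases "y = 0")
  case False
  define r where "r = \<bar>y\<bar>"
  have r: "r > 0" using False by (simp add: r_def)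
  have 1: "(\<integral>\<^sup>+u. ennreal (indicator {0<..} u * ((1 - cos u) * u powr (- \<eta> - 1))) \<partial>lborel) = ennreal (cos_const \<eta>)"
    unfolding cos_const_def set_lebesgue_integral_def real_scaleR_def
    using set_integrable_cos_const[OF \<eta>]
    by (intro nn_integral_eq_integral) (auto simp: set_integrable_def)
  have c: "cos (u * y) = cos (u * r)" for u
    by (cases "y \<ge> 0") (auto simp: r_def)
  have "(\<integral>\<^sup>+u. ennreal (indicator {0<..} u * ((1 - cos u) * u powr (- \<eta> - 1))) \<partial>lborel)
     = ennreal \<bar>r\<bar> * (\<integral>\<^sup>+u. ennreal (indicator {0<..} (0 + r * u) * ((1 - cos (0 + r * u)) * (0 + r * u) powr (- \<eta> - 1))) \<partial>lborel)"
    using r by (intro nn_integral_real_affine) auto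
  also have "\<dots> = (\<integral>\<^sup>+u. ennreal (r powr (-\<eta>)) * ennreal (indicator {0<..} u * ((1 - cos (u * y)) * u powr (- \<eta> - 1))) \<partial>lborel)"
    using r by (subst nn_integral_cmult[symmetric])
     (auto intro!: nn_integral_cong simp: indicator_def c zero_less_mult_iff powr_mult powr_diff powr_minus mult.commute
       ennreal_mult'[symmetric] field_simps)
  also have "\<dots> = ennreal (r powr (-\<eta>)) * (\<integral>\<^sup>+u. ennreal (indicator {0<..} u * ((1 - cos (u * y)) * u powr (- \<eta> - 1))) \<partial>lborel)"
    by (intro nn_integral_cmult) auto
  finally have "ennreal (r powr \<eta>) * ennreal (cos_const \<eta>) = ennreal (r powr \<eta>) * (ennreal (r powr (-\<eta>)) * (\<integral>\<^sup>+u. ennreal (indicator {0<..} u * ((1 - cos (u * y)) * u powr (- \<eta> - 1))) \<partial>lborel))"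
    using 1 by simp
  also have "\<dots> = (\<integral>\<^sup>+u. ennreal (indicator {0<..} u * ((1 - cos (u * y)) * u powr (- \<eta> - 1))) \<partial>lborel)"
    using r by (simp add: mult.assoc[symmetric] ennreal_mult'[symmetric] powr_add[symmetric])
  finally show ?thesis by (simp add: ennreal_mult' r_def)
qed simp

text \<open>The previous formula at \<open>y = 2\<close>, where \<open>1 - cos (2 * u)\<close> is
  twice the square of the sine. This is the origin of the factor \<open>2 powr (\<eta> - 1)\<close>
  in the theorem.\<close>

lemma cos_const_eq:
  assumes \<eta>: "0 < \<eta>" "\<eta> < 2"
  shows "cos_const \<eta> = 2 powr (1 - \<eta>) * integral {0..} (\<lambda>u. u powr (- \<eta> - 1) * (sin u)\<^sup>2)"
proof -
  have nn: "0 \<le> cos_const \<eta>"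
    unfolding cos_const_def set_lebesgue_integral_def by (rule integral_nonneg_AE) auto
  let ?g = "\<lambda>u::real. u powr (- \<eta> - 1) * (sin u)\<^sup>2"
  have int: "set_integrable lborel {0<..} ?g"
  proof (rule set_integrable_powr_env_bound[where C=1 and a="1 - \<eta>" and b="- \<eta> - 1"])
    show "\<bar>?g u\<bar> \<le> 1 * powr_env (1 - \<eta>) (- \<eta> - 1) u" if "0 < u" for u
    proof -
      have "\<bar>sin u\<bar>\<^sup>2 \<le> (powr_env 1 0 u)\<^sup>2"
        using abs_sin_le_powr_env[OF that] by (intro power_mono) auto
      then have "(sin u)\<^sup>2 \<le> powr_env 2 0 u" by (simp add: power2_eq_square powr_env_mult)
      then have "(sin u)\<^sup>2 * u powr (- \<eta> - 1) \<le> powr_env 2 0 u * u powr (- \<eta> - 1)"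
        by (intro mult_right_mono) auto
      then show ?thesis by (simp add: abs_mult powr_env_mult_powr mult.commute)
    qed
  qed (use \<eta> in auto)
  have "ennreal (2 powr \<eta> * cos_const \<eta>) =
      (\<integral>\<^sup>+u. ennreal (2 * (indicator {0<..} u * ?g u)) \<partial>lborel)"
  proof -
    have "(1 - cos (u * 2)) * u powr (- \<eta> - 1) = 2 * ?g u" for u :: real
      using cos_double_sin[of u] by (simp add: mult.commute)
    then have "indicator {0<..} u * ((1 - cos (u * 2)) * u powr (- \<eta> - 1)) = 2 * (indicator {0<..} u * ?g u)" for u :: real
      by (simp only: mult.left_commute)
    with nn_integral_one_minus_cos[OF \<eta>, of 2] show ?thesis by (simp only: abs_numeral)
  qed
  also have "\<dots> = ennreal (2 * (LINT u:{0<..}|lborel. ?g u))"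
    using int unfolding set_lebesgue_integral_def
    by (subst nn_integral_eq_integral) (auto simp: set_integrable_def)
  finally have "2 powr \<eta> * cos_const \<eta> = 2 * (LINT u:{0<..}|lborel. ?g u)"
    using nn by (subst (asm) ennreal_inj) (auto simp: set_lebesgue_integral_def intro!: integral_nonneg_AE)
  then show ?thesis
    using integral_Ici_0_eq_LINT[OF int] by (simp add: powr_diff field_simps)
qed

text \<open>A nonnegative integrand with integral 0 vanishes almost everywhere, which an interval of
  positive length rules out.\<close>

lemma LINT_pos:
  fixes f :: "real \<Rightarrow> real"
  assumes int: "set_integrable lborel {0<..} f" and nn: "\<And>x. 0 < x \<Longrightarrow> 0 \<le> f x"
    and ab: "0 \<le> a" "a < b" and pos: "\<And>x. a < x \<Longrightarrow> x < b \<Longrightarrow> 0 < f x"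
  shows "0 < (LINT x:{0<..}|lborel. f x)"
proof -
  let ?h = "\<lambda>x. indicator {0<..} x *\<^sub>R f x"
  have "0 \<le> integral\<^sup>L lborel ?h" by (rule integral_nonneg_AE) (use nn in \<open>auto simp: indicator_def\<close>)
  moreover have "integral\<^sup>L lborel ?h \<noteq> 0"
  proof
    assume "integral\<^sup>L lborel ?h = 0"
    then have "AE x in lborel. ?h x = 0"
      using int nn by (subst (asm) integral_nonneg_eq_0_iff_AE) (auto simp: set_integrable_def indicator_def)
    then have "AE x in lborel. x \<notin> {a<..<b}"
    proof eventually_elim
      case (elim x)
      then show ?case using pos[of x] ab by (auto simp: indicator_def split: if_splits)
    qed
    then have "emeasure lborel {a<..<b} = 0" by (subst (asm) AE_iff_measurable[of "{a<..<b}"]) auto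
    then show False using ab by simp
  qed
  ultimately show ?thesis by (simp add: set_lebesgue_integral_def)
qed

lemma cos_const_pos:
  assumes "0 < \<eta>" "\<eta> < 2"
  shows "0 < cos_const \<eta>"
  unfolding cos_const_def
proof (rule LINT_pos[OF set_integrable_cos_const[OF assms], where a=0 and b=1])
  fix x :: real assume "0 < x" "x < 1"
  moreover then have "cos x < cos 0" using pi_gt3 by (intro cos_monotone_0_pi) auto
  ultimately show "0 < (1 - cos x) * x powr (- \<eta> - 1)" by simp
qed auto

subsection \<open>The Gamma and sine integrals\<close>

lemma one_minus_exp_eq_nn_integral:
  assumes "0 \<le> y"
  shows "ennreal (1 - exp (- y)) = (\<integral>\<^sup>+s. ennreal (exp (- s)) * indicator {0..y} s \<partial>lborel)"
  using assms
  by (subst nn_integral_FTC_Icc[where F="\<lambda>s. - exp (- s)"])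
     (auto intro!: derivative_eq_intros)

lemma nn_integral_powr_Ici:
  assumes "0 < r" "0 < e"
  shows "(\<integral>\<^sup>+w. ennreal (w powr (- e - 1)) * indicator {r..} w \<partial>lborel) = ennreal (r powr (- e) / e)"
proof -
  have "((\<lambda>w. w powr (- e - 1)) has_integral (r powr (- e) / e)) {r..}"
    using has_integral_powr_to_inf[of "- e - 1" r] assms by simp
  from nn_integral_has_integral_lebesgue[OF _ this] show ?thesis
    by (simp add: ennreal_indicator[symmetric] ennreal_mult'[symmetric] mult.commute)
qed

text \<open>Write \<open>1 - exp (- y)\<close> as the integral of \<open>exp (- s)\<close> over
  \<open>{0..y}\<close> and exchange the integrals. For fixed \<open>s\<close> the variable
  \<open>w\<close> runs over \<open>w \<ge> s powr (1 / \<alpha>)\<close> and contributes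
  \<open>s powr (- \<eta> / \<alpha>) / \<eta>\<close>, which leaves Euler's integral.\<close>

lemma nn_integral_one_minus_exp:
  assumes "0 < \<eta>" "\<eta> < \<alpha>"
  shows "(\<integral>\<^sup>+w. ennreal (indicator {0<..} w * ((1 - exp (- (w powr \<alpha>))) * w powr (- \<eta> - 1))) \<partial>lborel)
       = ennreal (Gamma (1 - \<eta> / \<alpha>) / \<eta>)"
proof -
  have "(\<integral>\<^sup>+w. ennreal (indicator {0<..} w * ((1 - exp (- (w powr \<alpha>))) * w powr (- \<eta> - 1))) \<partial>lborel)
      = (\<integral>\<^sup>+w. \<integral>\<^sup>+s. indicator {0<..} w * ennreal (w powr (- \<eta> - 1)) *
             (ennreal (exp (- s)) * indicator {0..w powr \<alpha>} s) \<partial>lborel \<partial>lborel)"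
  proof (rule nn_integral_cong)
    fix w :: real
    show "ennreal (indicator {0<..} w * ((1 - exp (- (w powr \<alpha>))) * w powr (- \<eta> - 1)))
      = (\<integral>\<^sup>+s. indicator {0<..} w * ennreal (w powr (- \<eta> - 1)) *
             (ennreal (exp (- s)) * indicator {0..w powr \<alpha>} s) \<partial>lborel)"
      by (subst nn_integral_cmult)
         (auto simp: one_minus_exp_eq_nn_integral[symmetric] ennreal_mult'' ennreal_indicator mult_ac)
  qed
  also have "\<dots> = (\<integral>\<^sup>+w. \<integral>\<^sup>+s. (if 0 < w \<and> 0 \<le> s \<and> s \<le> w powr \<alpha> then ennreal (w powr (- \<eta> - 1)) * ennreal (exp (- s)) else 0) \<partial>lborel \<partial>lborel)"
    by (intro nn_integral_cong) (auto simp: indicator_def)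
  also have "\<dots> = (\<integral>\<^sup>+s. \<integral>\<^sup>+w. (if 0 < w \<and> 0 \<le> s \<and> s \<le> w powr \<alpha> then ennreal (w powr (- \<eta> - 1)) * ennreal (exp (- s)) else 0) \<partial>lborel \<partial>lborel)"
    by (rule lborel_pair.Fubini') measurable
  also have "\<dots> = (\<integral>\<^sup>+s. ennreal (1 / \<eta>) * ennreal (indicator {0..} s * s powr ((1 - \<eta> / \<alpha>) - 1) / exp s) \<partial>lborel)"
  proof (rule nn_integral_cong_AE)
    \<comment> \<open>At \<open>s = 0\<close> the inner integral diverges, whereas the right-hand
      side is 0 by the convention for \<open>0 powr\<close>.\<close>
    have "AE s in lborel. s \<noteq> (0::real)" by (rule AE_lborel_singleton)
    then show "AE s in lborel. (\<integral>\<^sup>+w. (if 0 < w \<and> 0 \<le> s \<and> s \<le> w powr \<alpha> then ennreal (w powr (- \<eta> - 1)) * ennreal (exp (- s)) else 0) \<partial>lborel)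
         = ennreal (1 / \<eta>) * ennreal (indicator {0..} s * s powr ((1 - \<eta> / \<alpha>) - 1) / exp s)"
    proof eventually_elim
      case (elim s)
      show ?case
      proof (cases "0 < s")
        case True
        have iff: "0 < w \<and> s \<le> w powr \<alpha> \<longleftrightarrow> w \<in> {s powr (1 / \<alpha>)..}" for w
        proof -
          have "s \<le> w powr \<alpha> \<longleftrightarrow> s powr (1/\<alpha>) \<le> (w powr \<alpha>) powr (1/\<alpha>)"
            using assms True powr_mono2[of "1/\<alpha>" s "w powr \<alpha>"] powr_less_mono2[of "1/\<alpha>" "w powr \<alpha>" s]
            by fastforce
          moreover have "(w powr \<alpha>) powr (1/\<alpha>) = w" if "0 < w" using that assms by (simp add: powr_powr)
          moreover have "s powr (1 / \<alpha>) > 0" using True by simp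
          ultimately show ?thesis by (metis atLeast_iff order.strict_trans2)
        qed
        have "(\<integral>\<^sup>+w. (if 0 < w \<and> 0 \<le> s \<and> s \<le> w powr \<alpha> then ennreal (w powr (- \<eta> - 1)) * ennreal (exp (- s)) else 0) \<partial>lborel)
          = (\<integral>\<^sup>+w. ennreal (exp (- s)) * (ennreal (w powr (- \<eta> - 1)) * indicator {s powr (1 / \<alpha>)..} w) \<partial>lborel)"
          using True iff by (intro nn_integral_cong) (auto simp: indicator_def mult.commute)
        also have "\<dots> = ennreal (exp (- s)) * ennreal ((s powr (1 / \<alpha>)) powr (- \<eta>) / \<eta>)"
          using True assms by (subst nn_integral_cmult) (auto simp: nn_integral_powr_Ici)
        also have "\<dots> = ennreal (1 / \<eta>) * ennreal (indicator {0..} s * s powr ((1 - \<eta> / \<alpha>) - 1) / exp s)"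
          using True assms by (simp add: powr_powr exp_minus ennreal_mult'[symmetric] field_simps)
        finally show ?thesis .
      qed (use elim in auto)
    qed
  qed
  also have "\<dots> = ennreal (1 / \<eta>) * ennreal (Gamma (1 - \<eta> / \<alpha>))"
    using assms by (subst nn_integral_cmult) (auto simp: Gamma_conv_nn_integral_real)
  finally show ?thesis using assms by (simp add: ennreal_mult'[symmetric])
qed

lemma LINT_one_minus_exp:
  fixes \<eta> \<alpha> :: real
  assumes "0 < \<eta>" "\<eta> < \<alpha>"
  shows "(LINT w:{0<..}|lborel. (1 - exp (- (w powr \<alpha>))) * w powr (- \<eta> - 1)) = Gamma (1 - \<eta> / \<alpha>) / \<eta>"
proof -
  have "0 < Gamma (1 - \<eta> / \<alpha>)" using assms by (intro Gamma_real_pos) auto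
  then show ?thesis
    unfolding set_lebesgue_integral_def real_scaleR_def
    using nn_integral_one_minus_exp[OF assms] assms
    by (subst integral_eq_nn_integral) auto
qed

text \<open>The reciprocal of \<open>stable_const\<close> on the interval from 1 to 2. There the
  integral converges absolutely: the zero of the sine compensates for \<open>s < 2\<close> at 0, and
  \<open>s > 1\<close> suffices at infinity.\<close>

definition sin_integral :: "real \<Rightarrow> real" where
  "sin_integral s = (LINT x:{0<..}|lborel. x powr (- s) * sin x)"

lemma abs_powr_mult_sin_le: "0 < x \<Longrightarrow> \<bar>x powr (- s) * sin x\<bar> \<le> powr_env (1 - s) (- s) x"
  using mult_left_mono[OF abs_sin_le_powr_env, of x "x powr (- s)"] powr_env_mult_powr[of 1 0 x "- s"]
  by (simp add: abs_mult mult.commute)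

lemma set_integrable_sin_integral:
  assumes "1 < s" "s < (2::real)"
  shows "set_integrable lborel {0<..} (\<lambda>x. x powr (- s) * sin x)"
  using assms abs_powr_mult_sin_le
  by (intro set_integrable_powr_env_bound[where C=1 and a="1 - s" and b="- s"]) auto

text \<open>Write \<open>1 - cos y\<close> as the integral of the sine over \<open>{0..y}\<close>
  and exchange: the condition \<open>s \<le> x powr (- 1 / \<alpha>)\<close> reads
  \<open>x \<le> s powr (- \<alpha>)\<close>, so integrating over \<open>x\<close> gives the weight
  \<open>s powr (- \<alpha>)\<close>.\<close>

lemma LINT_one_minus_cos_powr_1:
  assumes \<alpha>: "1 < \<alpha>" "\<alpha> < (2::real)"
  shows "(LINT x:{0<..}|lborel. 1 - cos (x powr (- 1 / \<alpha>))) = sin_integral \<alpha>"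
proof -
  let ?f = "\<lambda>s x. if 0 < s \<and> 0 < x \<and> s \<le> x powr (- 1 / \<alpha>) then sin s else (0::real)"
  have iff: "s \<le> x powr (- 1 / \<alpha>) \<longleftrightarrow> x \<le> s powr (- \<alpha>)" if "0 < s" "0 < x" for s x :: real
  proof -
    have "s \<le> x powr (- 1 / \<alpha>) \<longleftrightarrow> (x powr (- 1 / \<alpha>)) powr (-\<alpha>) \<le> s powr (-\<alpha>)"
    proof
      assume "s \<le> x powr (- 1 / \<alpha>)"
      then show "(x powr (- 1 / \<alpha>)) powr (-\<alpha>) \<le> s powr (-\<alpha>)"
        using that \<alpha> by (intro powr_mono2') auto
    next
      assume *: "(x powr (- 1 / \<alpha>)) powr (-\<alpha>) \<le> s powr (-\<alpha>)"
      show "s \<le> x powr (- 1 / \<alpha>)"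
      proof (rule ccontr)
        assume "\<not> s \<le> x powr (- 1 / \<alpha>)"
        then have "s powr (-\<alpha>) < (x powr (- 1 / \<alpha>)) powr (-\<alpha>)"
          using that \<alpha> by (intro powr_less_mono2_neg) auto
        with * show False by simp
      qed
    qed
    then show ?thesis using that \<alpha> by (simp add: powr_powr)
  qed
  \<comment> \<open>Stated for a general \<open>h\<close> to serve twice: \<open>h = abs\<close>
    gives the integrability that Fubini needs, the identity gives the value.\<close>
  have inner: "(\<integral>x. h (?f s x) \<partial>lborel) = indicator {0<..} s * (s powr (- \<alpha>) * h (sin s))"
    "integrable lborel (\<lambda>x. h (?f s x))" if "h 0 = 0" for s :: real and h :: "real \<Rightarrow> real"
  proof -
    have eq: "(\<lambda>x. h (?f s x)) = (\<lambda>x. indicator {0<..s powr (- \<alpha>)} x *\<^sub>R (indicator {0<..} s * h (sin s)))"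
      using iff[of s] that by (auto simp: fun_eq_iff indicator_def)
    show "(\<integral>x. h (?f s x) \<partial>lborel) = indicator {0<..} s * (s powr (- \<alpha>) * h (sin s))"
      unfolding eq by simp
    show "integrable lborel (\<lambda>x. h (?f s x))" unfolding eq by (intro integrable_scaleR_left) auto
  qed
  have int: "integrable (lborel \<Otimes>\<^sub>M lborel) (\<lambda>(s, x). ?f s x)"
  proof (rule lborel_pair.Fubini_integrable)
    show "integrable lborel (\<lambda>s. \<integral>x. norm ((\<lambda>(s, x). ?f s x) (s, x)) \<partial>lborel)"
      using set_integrable_sin_integral[OF \<alpha>, THEN set_integrable_abs] inner(1)[of abs]
      by (simp add: set_integrable_def abs_mult)
    show "AE s in lborel. integrable lborel (\<lambda>x. (\<lambda>(s, x). ?f s x) (s, x))"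
      using inner(2)[of "\<lambda>x. x"] by simp
  qed measurable
  have "(LINT x:{0<..}|lborel. 1 - cos (x powr (- 1 / \<alpha>))) = (\<integral>x. (\<integral>s. ?f s x \<partial>lborel) \<partial>lborel)"
    unfolding set_lebesgue_integral_def
  proof (rule Bochner_Integration.integral_cong[OF refl])
    fix x :: real
    have "(\<integral>s. sin s * indicator {0..y} s \<partial>lborel) = 1 - cos y" if "0 \<le> y" for y :: real
      using that by (subst integral_FTC_Icc_real[where F="\<lambda>s. - cos s"]) (auto intro!: derivative_eq_intros)
    moreover have "(\<lambda>s. ?f s x) = (\<lambda>s. indicator {0<..} x * (sin s * indicator {0..x powr (-1/\<alpha>)} s))"
      by (auto simp: indicator_def fun_eq_iff)
    ultimately show "indicator {0<..} x *\<^sub>R (1 - cos (x powr (- 1 / \<alpha>))) = (\<integral>s. ?f s x \<partial>lborel)"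
      by simp
  qed
  also have "\<dots> = (\<integral>s. (\<integral>x. ?f s x \<partial>lborel) \<partial>lborel)"
    by (rule lborel_pair.Fubini_integral[OF int])
  also have "\<dots> = sin_integral \<alpha>"
    using inner(1)[of "\<lambda>x. x"] by (simp add: sin_integral_def set_lebesgue_integral_def)
  finally show ?thesis .
qed

lemma LINT_one_minus_cos_powr:
  assumes \<alpha>: "1 < \<alpha>" "\<alpha> < 2" and y: "0 < y"
  shows "(LINT x:{0<..}|lborel. 1 - cos (y * x powr (- 1 / \<alpha>))) = y powr \<alpha> * sin_integral \<alpha>"
proof -
  have "(\<integral>x. indicator {0<..} x * (1 - cos (y * x powr (- 1 / \<alpha>))) \<partial>lborel)
     = \<bar>y powr \<alpha>\<bar> *\<^sub>R (\<integral>x. indicator {0<..} (0 + y powr \<alpha> * x) * (1 - cos (y * (0 + y powr \<alpha> * x) powr (- 1 / \<alpha>))) \<partial>lborel)"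
    using y by (intro lborel_integral_real_affine) auto
  also have "(\<lambda>x. indicator {0<..} (0 + y powr \<alpha> * x) * (1 - cos (y * (0 + y powr \<alpha> * x) powr (- 1 / \<alpha>))))
     = (\<lambda>x. indicator {0<..} x * (1 - cos (x powr (- 1 / \<alpha>))))"
    using y \<alpha> by (auto simp: fun_eq_iff indicator_def zero_less_mult_iff powr_mult powr_powr powr_minus_divide)
  finally show ?thesis
    using LINT_one_minus_cos_powr_1[OF \<alpha>] y by (simp add: set_lebesgue_integral_def)
qed

lemma set_integrable_one_minus_cos_powr:
  fixes \<alpha> y :: real
  assumes \<alpha>: "0 < \<alpha>" "\<alpha> < 2"
  shows "set_integrable lborel {0<..} (\<lambda>x. 1 - cos (y * x powr (- 1 / \<alpha>)))"
proof (rule set_integrable_powr_env_bound[where C="2 * (1 + y\<^sup>2)" and a=0 and b="- 2 / \<alpha>"])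
  fix x :: real assume x: "0 < x"
  have "1 - cos z \<le> 2 * (1 + y\<^sup>2)" for z :: real
    using cos_ge_minus_one[of z] zero_le_power2[of y] unfolding distrib_left by linarith
  moreover have "1 - cos (y * x powr (- 1 / \<alpha>)) \<le> 2 * (1 + y\<^sup>2) * x powr (- 2 / \<alpha>)"
  proof -
    have "1 - cos (y * x powr (- 1 / \<alpha>)) \<le> 2 * (y * x powr (- 1 / \<alpha>))\<^sup>2"
      using one_minus_cos_le_square[of "y * x powr (- 1 / \<alpha>)"] by (smt (verit) field_sum_of_halves zero_le_power2)
    also have "\<dots> = 2 * y\<^sup>2 * x powr (- 2 / \<alpha>)"
      by (simp add: power_mult_distrib power2_eq_square powr_add[symmetric])
    also have "\<dots> \<le> 2 * (1 + y\<^sup>2) * x powr (- 2 / \<alpha>)" by (intro mult_right_mono) auto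
    finally show ?thesis .
  qed
  ultimately show "\<bar>1 - cos (y * x powr (- 1 / \<alpha>))\<bar> \<le> 2 * (1 + y\<^sup>2) * powr_env 0 (- 2 / \<alpha>) x"
    using x by (simp add: powr_env_def)
qed (use \<alpha> in auto)

text \<open>The sine integrand oscillates, so its sign tells nothing; the representation with
  \<open>1 - cos\<close> has a nonnegative integrand.\<close>

lemma sin_integral_pos:
  assumes \<alpha>: "1 < \<alpha>" "\<alpha> < (2::real)"
  shows "0 < sin_integral \<alpha>"
proof -
  have "0 < (LINT x:{0<..}|lborel. 1 - cos (1 * x powr (- 1 / \<alpha>)))"
  proof (rule LINT_pos[where a=1 and b=2])
    fix x :: real assume x: "1 < x" "x < 2"
    have "x powr (- 1 / \<alpha>) \<le> x powr 0" using x \<alpha> by (intro powr_mono) auto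
    then have "cos (x powr (- 1 / \<alpha>)) < cos 0"
      using x pi_gt3 by (intro cos_monotone_0_pi) auto
    then show "0 < 1 - cos (1 * x powr (- 1 / \<alpha>))" by simp
  qed (use \<alpha> set_integrable_one_minus_cos_powr[of \<alpha> 1] in auto)
  then show ?thesis using LINT_one_minus_cos_powr_1[OF \<alpha>] by simp
qed

lemma stable_const_eq:
  assumes \<alpha>: "1 < \<alpha>" "\<alpha> < 2"
  shows "stable_const \<alpha> = inverse (sin_integral \<alpha>)"
  unfolding stable_const_def sin_integral_def
  by (subst integral_Ici_0_eq_LINT[OF set_integrable_sin_integral[OF \<alpha>]]) auto

text \<open>The reason for the constant in the definition of the field: it normalises the exponent
  of the stable kernel to a pure power.\<close>

lemma LINT_one_minus_cos_stable:
  assumes \<alpha>: "1 < \<alpha>" "\<alpha> < 2" and y: "0 \<le> y"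
  shows "(LINT x:{0<..}|lborel. 1 - cos (y * (stable_const \<alpha> powr (1 / \<alpha>) * x powr (- 1 / \<alpha>)))) = y powr \<alpha>"
proof (cases "y = 0")
  case False
  have "0 < stable_const \<alpha>" using sin_integral_pos[OF \<alpha>] stable_const_eq[OF \<alpha>] by simp
  then show ?thesis
    using False y LINT_one_minus_cos_powr[OF \<alpha>, of "y * stable_const \<alpha> powr (1 / \<alpha>)"] sin_integral_pos[OF \<alpha>] \<alpha>
    by (simp add: powr_mult powr_powr stable_const_eq[OF \<alpha>] mult.assoc[symmetric])
qed simp

subsection \<open>Dependence on the stability index\<close>

text \<open>Differentiation under the integral sign, by dominated convergence of the difference
  quotients along sequences.\<close>

lemma sin_integral_differentiable:
  assumes s: "1 < s" "s < 2"
  shows "\<exists>D. (sin_integral has_real_derivative D) (at s)"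
proof -
  \<comment> \<open>Two losses of \<open>k\<close> are budgeted: one for exponents within
    \<open>k\<close> of \<open>s\<close>, one for the logarithm. The envelope stays integrable at 0
    because \<open>s + 2 * k < 2\<close> and at infinity because
    \<open>s - 2 * k > 1\<close>.\<close>
  define k where "k = min (2 - s) (s - 1) / 4"
  have k: "0 < k" "s + 2 * k < 2" "1 < s - 2 * k" using s by (auto simp: k_def min_def field_simps)
  let ?f = "\<lambda>r x::real. x powr (- r) * sin x"
  let ?D = "LINT x:{0<..}|lborel. - ln x * x powr (- s) * sin x"
  have "((\<lambda>r. (sin_integral r - sin_integral s) / (r - s)) \<longlongrightarrow> ?D) (at s)"
    unfolding tendsto_at_iff_sequentially comp_def
  proof (intro allI impI)
    fix X :: "nat \<Rightarrow> real" assume X: "\<forall>i. X i \<in> UNIV - {s}" "X \<longlonglongrightarrow> s"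
    have "\<forall>\<^sub>F n in sequentially. dist (X n) s < k" using X(2) k(1) by (rule tendstoD)
    then obtain N where N: "\<And>n. n \<ge> N \<Longrightarrow> \<bar>X n - s\<bar> < k"
      unfolding eventually_sequentially by (auto simp: dist_real_def)
    \<comment> \<open>Dropping an initial segment makes the majorant valid for every index, as
      dominated convergence for sequences demands.\<close>
    define Z where "Z n = X (n + N)" for n
    have Z: "\<bar>Z n - s\<bar> < k" "Z n \<noteq> s" for n using N X(1) by (auto simp: Z_def)
    have Zlim: "Z \<longlonglongrightarrow> s" unfolding Z_def using X(2) by (rule LIMSEQ_ignore_initial_segment)
    have "(\<lambda>n. \<integral>x. indicator {0<..} x * ((?f (Z n) x - ?f s x) / (Z n - s)) \<partial>lborel) \<longlonglongrightarrow>
        (\<integral>x. indicator {0<..} x * (- ln x * x powr (- s) * sin x) \<partial>lborel)"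
    proof (rule integral_dominated_convergence[where w="\<lambda>x. indicator {0<..} x * (powr_env (1 - s - 2*k) (- s + 2*k) x / k)"])
      show "integrable lborel (\<lambda>x. indicator {0<..} x * (powr_env (1 - s - 2*k) (- s + 2*k) x / k))"
        using set_integrable_powr_env[of "1 - s - 2*k" "- s + 2*k"] k
        by (simp add: set_integrable_def)
      show "AE x in lborel. (\<lambda>n. indicator {0<..} x * ((?f (Z n) x - ?f s x) / (Z n - s))) \<longlonglongrightarrow>
          indicator {0<..} x * (- ln x * x powr (- s) * sin x)"
      proof (intro AE_I2)
        fix x :: real
        show "(\<lambda>n. indicator {0<..} x * ((?f (Z n) x - ?f s x) / (Z n - s))) \<longlonglongrightarrow>
          indicator {0<..} x * (- ln x * x powr (- s) * sin x)"
        proof (cases "0 < x")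
          case True
          have "((\<lambda>r. ?f r x) has_real_derivative (- ln x * x powr (- s) * sin x)) (at s)"
            using True by (auto intro!: derivative_eq_intros simp: powr_def)
          then have "((\<lambda>r. (?f r x - ?f s x) / (r - s)) \<longlongrightarrow> - ln x * x powr (- s) * sin x) (at s)"
            by (simp add: has_field_derivative_iff)
          then have "(\<lambda>n. (?f (Z n) x - ?f s x) / (Z n - s)) \<longlonglongrightarrow> - ln x * x powr (- s) * sin x"
            by (rule filterlim_compose) (auto simp: filterlim_at Zlim Z)
          then show ?thesis using True by simp
        qed simp
      qed
      show "AE x in lborel. norm (indicator {0<..} x * ((?f (Z n) x - ?f s x) / (Z n - s)))
          \<le> indicator {0<..} x * (powr_env (1 - s - 2*k) (- s + 2*k) x / k)" for n
      proof (intro AE_I2)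
        fix x :: real
        show "norm (indicator {0<..} x * ((?f (Z n) x - ?f s x) / (Z n - s)))
          \<le> indicator {0<..} x * (powr_env (1 - s - 2*k) (- s + 2*k) x / k)"
        proof (cases "0 < x")
          case True
          have "\<bar>?f (Z n) x - ?f s x\<bar> = \<bar>x powr (- Z n) - x powr (- s)\<bar> * \<bar>sin x\<bar>"
            by (simp add: abs_mult[symmetric] left_diff_distrib)
          also have "\<dots> \<le> (\<bar>(- Z n) - (- s)\<bar> / k * powr_env ((- s - k) - k) ((- s + k) + k) x) * powr_env 1 0 x"
            using True k Z(1)[of n]
            by (intro mult_mono powr_diff_le_powr_env abs_sin_le_powr_env) (auto simp: powr_env_nonneg)
          also have "\<dots> = \<bar>Z n - s\<bar> * (powr_env (1 - s - 2*k) (- s + 2*k) x / k)"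
            by (simp add: mult.assoc powr_env_mult abs_minus_commute algebra_simps)
          finally have "\<bar>?f (Z n) x - ?f s x\<bar> / \<bar>Z n - s\<bar> \<le> powr_env (1 - s - 2*k) (- s + 2*k) x / k"
            using Z(2)[of n] by (subst pos_divide_le_eq) (auto simp: mult.commute)
          then show ?thesis using True by (simp add: abs_mult)
        qed simp
      qed
    qed measurable
    moreover have "(\<integral>x. indicator {0<..} x * ((?f (Z n) x - ?f s x) / (Z n - s)) \<partial>lborel)
        = (sin_integral (Z n) - sin_integral s) / (Z n - s)" for n
    proof -
      have "(LINT x:{0<..}|lborel. (?f (Z n) x - ?f s x)) = sin_integral (Z n) - sin_integral s"
        unfolding sin_integral_def
        using Z(1)[of n] k s by (intro set_integral_diff set_integrable_sin_integral) auto
      then show ?thesis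
        by (simp only: set_lebesgue_integral_def real_scaleR_def times_divide_eq_right integral_divide_zero)
    qed
    ultimately have "(\<lambda>n. (sin_integral (Z n) - sin_integral s) / (Z n - s)) \<longlonglongrightarrow> ?D"
      by (simp only: set_lebesgue_integral_def real_scaleR_def)
    then show "(\<lambda>n. (sin_integral (X n) - sin_integral s) / (X n - s)) \<longlonglongrightarrow> ?D"
      unfolding Z_def by (rule LIMSEQ_offset)
  qed
  then show ?thesis by (auto simp: has_field_derivative_iff)
qed

text \<open>Positivity of the sine integral allows writing the scale as an exponential of a
  logarithm on the open interval from 1 to 2, and a derivative may be computed after replacing a
  function on an open set.\<close>

lemma stable_scale_differentiable:
  assumes s: "1 < s" "s < 2"
  shows "\<exists>D. ((\<lambda>s. stable_const s powr (1 / s)) has_real_derivative D) (at s)"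
proof -
  obtain D where D: "(sin_integral has_real_derivative D) (at s)"
    using sin_integral_differentiable[OF s] by blast
  have "\<exists>D. ((\<lambda>s. exp (- ln (sin_integral s) / s)) has_real_derivative D) (at s)"
    using sin_integral_pos[OF s] s
    by (intro exI) (rule derivative_eq_intros D refl | simp)+
  then obtain D' where "((\<lambda>s. exp (- ln (sin_integral s) / s)) has_real_derivative D') (at s)" ..
  moreover have "exp (- ln (sin_integral r) / r) = stable_const r powr (1 / r)" if "r \<in> {1<..<2}" for r
    using that sin_integral_pos[of r] by (simp add: stable_const_eq powr_def ln_inverse)
  ultimately show ?thesis
    using s by (metis (no_types, lifting) has_field_derivative_transform_within_open
        greaterThanLessThan_iff open_greaterThanLessThan)
qed

lemma derivative_imp_eventually_Lipschitz:
  fixes f :: "real \<Rightarrow> real"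
  assumes "(f has_real_derivative D) (at t)"
  shows "\<forall>\<^sub>F \<epsilon> in at_right 0. \<bar>f (t + \<epsilon>) - f t\<bar> \<le> (\<bar>D\<bar> + 1) * \<epsilon>"
proof -
  have "((\<lambda>h. (f (t + h) - f t) / h) \<longlongrightarrow> D) (at_right 0)"
    using assms tendsto_mono[OF at_le[of "{0<..}" UNIV]] by (auto simp: DERIV_def)
  then have "\<forall>\<^sub>F h in at_right 0. dist ((f (t + h) - f t) / h) D < 1" by (rule tendstoD) simp
  moreover have "\<forall>\<^sub>F h in at_right (0::real). 0 < h" by (simp add: eventually_at_right_less)
  ultimately show ?thesis
  proof eventually_elim
    case (elim h)
    then have "\<bar>(f (t + h) - f t) / h\<bar> \<le> \<bar>D\<bar> + 1" by (simp add: dist_real_def)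
    then show ?case using elim(2) by (simp add: abs_divide divide_simps mult.commute)
  qed
qed

text \<open>The kernel changes through its scale \<open>A\<close> and through its exponent. Adding
  and subtracting \<open>A t * x powr (- 1 / \<alpha> (t + \<epsilon>))\<close> separates the two
  effects, and each is of order \<epsilon>.\<close>

lemma stable_kernel_Lipschitz:
  fixes \<alpha> :: "real \<Rightarrow> real"
  assumes \<alpha>: "(\<alpha> has_real_derivative D) (at t)" and t: "1 < \<alpha> t" "\<alpha> t < 2" and k: "0 < k"
  defines "A \<equiv> \<lambda>s. stable_const (\<alpha> s) powr (1 / \<alpha> s)"
  obtains K where "0 < K" "\<forall>\<^sub>F \<epsilon> in at_right 0. \<forall>x>0.
    \<bar>A (t + \<epsilon>) * x powr (- 1 / \<alpha> (t + \<epsilon>)) - A t * x powr (- 1 / \<alpha> t)\<bar>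
      \<le> K * \<epsilon> * powr_env (- (1 / \<alpha> t + 2 * k)) (- (1 / \<alpha> t - 2 * k)) x"
proof -
  obtain D0 where D0: "((\<lambda>s. stable_const s powr (1 / s)) has_real_derivative D0) (at (\<alpha> t))"
    using stable_scale_differentiable[OF t] by blast
  have "(A has_real_derivative (D0 * D)) (at t)"
    unfolding A_def by (rule DERIV_chain2[OF D0 \<alpha>])
  note L1 = derivative_imp_eventually_Lipschitz[OF this]
  have "((\<lambda>s. - 1 / \<alpha> s) has_real_derivative (D / (\<alpha> t)\<^sup>2)) (at t)"
    using \<alpha> t by (auto intro!: derivative_eq_intros simp: power2_eq_square)
  note L2 = derivative_imp_eventually_Lipschitz[OF this]
  define K1 where "K1 = \<bar>D0 * D\<bar> + 1"
  define K2 where "K2 = \<bar>D / (\<alpha> t)\<^sup>2\<bar> + 1"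
  have pos: "0 < K1" "0 < K2" "0 \<le> A t" by (auto simp: K1_def K2_def A_def intro: add_nonneg_pos)
  \<comment> \<open>For small \<epsilon> the two exponents differ by less than \<open>k\<close>,
    which uses the first \<open>k\<close> of the envelope; the second is for the logarithm.\<close>
  have "((\<lambda>\<epsilon>. K2 * \<epsilon>) \<longlongrightarrow> K2 * 0) (at_right 0)" by (intro tendsto_intros)
  then have "\<forall>\<^sub>F \<epsilon> in at_right 0. K2 * \<epsilon> < k" using k by (intro order_tendstoD) auto
  then have "\<forall>\<^sub>F \<epsilon> in at_right 0. \<forall>x>0.
    \<bar>A (t + \<epsilon>) * x powr (- 1 / \<alpha> (t + \<epsilon>)) - A t * x powr (- 1 / \<alpha> t)\<bar>
      \<le> (K1 + A t * K2 / k) * \<epsilon> * powr_env (- (1 / \<alpha> t + 2 * k)) (- (1 / \<alpha> t - 2 * k)) x"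
    using L1 L2 eventually_at_right_less
  proof eventually_elim
    case (elim \<epsilon>)
    show ?case
    proof (intro allI impI)
      fix x :: real assume x: "0 < x"
      let ?E = "powr_env (- (1 / \<alpha> t + 2 * k)) (- (1 / \<alpha> t - 2 * k)) x"
      define p where "p = - 1 / \<alpha> (t + \<epsilon>)"
      define q where "q = - 1 / \<alpha> t"
      have pq: "\<bar>p - q\<bar> \<le> K2 * \<epsilon>" using elim by (simp add: p_def q_def K2_def)
      with elim have pk: "\<bar>p - q\<bar> \<le> k" by linarith
      have E: "?E = powr_env ((q - k) - k) ((q + k) + k) x" by (simp add: q_def algebra_simps)
      have 1: "\<bar>(A (t + \<epsilon>) - A t) * x powr p\<bar> \<le> K1 * \<epsilon> * ?E"
      proof -
        have "x powr p \<le> ?E"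
          unfolding E using pk k x by (intro powr_le_powr_env) linarith+
        then show ?thesis
          unfolding abs_mult using elim by (intro mult_mono) (auto simp: K1_def)
      qed
      have "\<bar>x powr p - x powr q\<bar> \<le> \<bar>p - q\<bar> / k * ?E"
        unfolding E using pk k x by (intro powr_diff_le_powr_env) auto
      also have "\<dots> \<le> (K2 * \<epsilon>) / k * ?E"
        using pq k by (intro mult_right_mono divide_right_mono) (auto simp: powr_env_nonneg)
      finally have 2: "\<bar>A t * (x powr p - x powr q)\<bar> \<le> A t * ((K2 * \<epsilon>) / k * ?E)"
        unfolding abs_mult using pos by (intro mult_mono) auto
      have "A (t + \<epsilon>) * x powr p - A t * x powr q = (A (t + \<epsilon>) - A t) * x powr p + A t * (x powr p - x powr q)"
        by (simp add: algebra_simps)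
      then have "\<bar>A (t + \<epsilon>) * x powr p - A t * x powr q\<bar> \<le> K1 * \<epsilon> * ?E + A t * ((K2 * \<epsilon>) / k * ?E)"
        using 1 2 by linarith
      also have "\<dots> = (K1 + A t * K2 / k) * \<epsilon> * ?E" by (simp add: algebra_simps)
      finally show "\<bar>A (t + \<epsilon>) * x powr (- 1 / \<alpha> (t + \<epsilon>)) - A t * x powr (- 1 / \<alpha> t)\<bar>
        \<le> (K1 + A t * K2 / k) * \<epsilon> * ?E"
        by (simp add: p_def q_def)
    qed
  qed
  moreover have "0 < K1 + A t * K2 / k" using pos k by (intro add_pos_nonneg) auto
  ultimately show ?thesis by (rule that[rotated])
qed

subsection \<open>Asymptotics of the characteristic exponent\<close>

text \<open>The exponent is of order \<epsilon>, so the logarithm of the power is of order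
  \<open>\<epsilon> * ln \<epsilon>\<close>.\<close>

lemma powr_perturb_tendsto_1:
  fixes \<alpha> :: "real \<Rightarrow> real"
  assumes \<alpha>: "(\<alpha> has_real_derivative D) (at t)" and t: "0 < \<alpha> t"
  shows "((\<lambda>\<epsilon>. \<epsilon> powr (1 - \<alpha> (t + \<epsilon>) / \<alpha> t)) \<longlongrightarrow> 1) (at_right 0)"
proof -
  define L where "L = (\<bar>D\<bar> + 1) / \<alpha> t"
  have "((\<lambda>\<epsilon>::real. L * \<bar>\<epsilon> * ln \<epsilon>\<bar>) \<longlongrightarrow> L * \<bar>0\<bar>) (at_right 0)"
    \<comment> \<open>Under \<open>x = inverse \<epsilon>\<close> the product
      \<open>\<epsilon> * ln \<epsilon>\<close> becomes \<open>- ln x / x\<close>.\<close>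
    unfolding filterlim_at_right_to_top
    using tendsto_minus[OF ln_x_over_x_tendsto_0]
    by (intro tendsto_intros) (simp add: ln_inverse divide_inverse mult.commute)
  then have L0: "((\<lambda>\<epsilon>::real. L * \<bar>\<epsilon> * ln \<epsilon>\<bar>) \<longlongrightarrow> 0) (at_right 0)" by simp
  have "((\<lambda>\<epsilon>. (1 - \<alpha> (t + \<epsilon>) / \<alpha> t) * ln \<epsilon>) \<longlongrightarrow> 0) (at_right 0)"
  proof (rule Lim_null_comparison[OF _ L0])
    show "\<forall>\<^sub>F \<epsilon> in at_right 0. norm ((1 - \<alpha> (t + \<epsilon>) / \<alpha> t) * ln \<epsilon>) \<le> L * \<bar>\<epsilon> * ln \<epsilon>\<bar>"
      using derivative_imp_eventually_Lipschitz[OF \<alpha>] eventually_at_right_less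
    proof eventually_elim
      case (elim \<epsilon>)
      have "\<bar>1 - \<alpha> (t + \<epsilon>) / \<alpha> t\<bar> = \<bar>\<alpha> (t + \<epsilon>) - \<alpha> t\<bar> / \<alpha> t"
        using t by (simp add: field_simps abs_if)
      also have "\<dots> \<le> L * \<epsilon>" using elim t by (simp add: L_def divide_right_mono)
      finally have "\<bar>1 - \<alpha> (t + \<epsilon>) / \<alpha> t\<bar> * \<bar>ln \<epsilon>\<bar> \<le> L * \<epsilon> * \<bar>ln \<epsilon>\<bar>" by (rule mult_right_mono) simp
      then show ?case using elim by (simp add: abs_mult mult.assoc)
    qed
  qed
  then have "((\<lambda>\<epsilon>. exp ((1 - \<alpha> (t + \<epsilon>) / \<alpha> t) * ln \<epsilon>)) \<longlongrightarrow> exp 0) (at_right 0)"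
    by (rule tendsto_exp)
  moreover have "\<forall>\<^sub>F \<epsilon> in at_right 0. exp ((1 - \<alpha> (t + \<epsilon>) / \<alpha> t) * ln \<epsilon>) = \<epsilon> powr (1 - \<alpha> (t + \<epsilon>) / \<alpha> t)"
    using eventually_at_right_less by eventually_elim (simp add: powr_def)
  ultimately show ?thesis by (simp cong: filterlim_cong add: tendsto_cong)
qed

text \<open>The exponent \<open>p\<close> is used for \<open>x \<le> 1\<close>, where
  \<open>p * a < 1\<close> gives integrability, and the exponent 2 beyond, where
  \<open>2 * b > 1\<close> does. Each region contributes its own power of the size \<open>r\<close>
  of the kernel.\<close>

lemma LINT_one_minus_cos_bound:
  fixes D :: "real \<Rightarrow> real"
  assumes [measurable]: "D \<in> borel_measurable borel"
    and D: "\<And>x. 0 < x \<Longrightarrow> \<bar>D x\<bar> \<le> r * powr_env (- a) (- b) x"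
    and "0 \<le> p" "p \<le> 2" "p * a < 1" "1 < 2 * b" "0 < r"
  shows "(LINT x:{0<..}|lborel. 1 - cos (D x)) \<le>
      2 * (LINT x:{0<..}|lborel. powr_env (- p * a) (- 2 * b) x) * (r powr p + r\<^sup>2)"
    and "0 \<le> (LINT x:{0<..}|lborel. 1 - cos (D x))"
    and "set_integrable lborel {0<..} (\<lambda>x. 1 - cos (D x))"
proof -
  have bound: "1 - cos (D x) \<le> 2 * (r powr p + r\<^sup>2) * powr_env (- p * a) (- 2 * b) x" if x: "0 < x" for x
  proof -
    have "1 - cos (D x) \<le> 2 * (if x \<le> 1 then \<bar>D x\<bar> powr p else \<bar>D x\<bar> powr 2)"
      using one_minus_cos_le_powr[of p "D x"] one_minus_cos_le_powr[of 2 "D x"] assms by simp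
    also have "\<dots> \<le> 2 * (if x \<le> 1 then (r * powr_env (- a) (- b) x) powr p else (r * powr_env (- a) (- b) x) powr 2)"
      using D[OF x] assms by (auto intro!: powr_mono2 simp del: powr_numeral)
    also have "\<dots> = 2 * (if x \<le> 1 then r powr p * x powr (- p * a) else r\<^sup>2 * x powr (- 2 * b))"
      using x assms by (auto simp: powr_env_def powr_mult powr_powr mult.commute simp del: powr_power)
    also have "\<dots> \<le> 2 * ((r powr p + r\<^sup>2) * powr_env (- p * a) (- 2 * b) x)"
      by (auto simp: powr_env_def intro!: mult_right_mono)
    finally show ?thesis by (simp only: mult.assoc)
  qed
  have int_env: "set_integrable lborel {0<..} (\<lambda>x. 2 * (r powr p + r\<^sup>2) * powr_env (- p * a) (- 2 * b) x)"
    using assms set_integrable_powr_env[of "- p * a" "- 2 * b"] by simp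
  show int: "set_integrable lborel {0<..} (\<lambda>x. 1 - cos (D x))"
    using assms bound by (intro set_integrable_powr_env_bound[where a="- p * a" and b="- 2 * b"
       and C="2 * (r powr p + r\<^sup>2)"]) auto
  have "(LINT x:{0<..}|lborel. 1 - cos (D x)) \<le> (LINT x:{0<..}|lborel. 2 * (r powr p + r\<^sup>2) * powr_env (- p * a) (- 2 * b) x)"
    using bound by (intro set_integral_mono int int_env) auto
  then show "(LINT x:{0<..}|lborel. 1 - cos (D x)) \<le>
      2 * (LINT x:{0<..}|lborel. powr_env (- p * a) (- 2 * b) x) * (r powr p + r\<^sup>2)"
    by (simp only: set_integral_mult_right) (simp only: mult_ac)
  show "0 \<le> (LINT x:{0<..}|lborel. 1 - cos (D x))"
    unfolding set_lebesgue_integral_def by (rule integral_nonneg_AE) auto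
qed

lemma LINT_powr_scale:
  fixes F :: "real \<Rightarrow> real"
  assumes [measurable]: "F \<in> borel_measurable borel" and c: "0 < c"
  shows "(LINT u:{0<..}|lborel. F u * u powr (- \<eta> - 1)) =
    c powr (- \<eta>) * (LINT w:{0<..}|lborel. F (c * w) * w powr (- \<eta> - 1))"
proof -
  have "(\<integral>u. indicator {0<..} u * (F u * u powr (- \<eta> - 1)) \<partial>lborel)
     = \<bar>c\<bar> *\<^sub>R (\<integral>w. indicator {0<..} (0 + c * w) * (F (0 + c * w) * (0 + c * w) powr (- \<eta> - 1)) \<partial>lborel)"
    using c by (intro lborel_integral_real_affine) auto
  also have "(\<lambda>w. indicator {0<..} (0 + c * w) * (F (0 + c * w) * (0 + c * w) powr (- \<eta> - 1)))
     = (\<lambda>w. c powr (- \<eta> - 1) * (indicator {0<..} w * (F (c * w) * w powr (- \<eta> - 1))))"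
    using c by (auto simp: fun_eq_iff indicator_def zero_less_mult_iff powr_mult)
  finally have "(\<integral>u. indicator {0<..} u * (F u * u powr (- \<eta> - 1)) \<partial>lborel)
     = (c * c powr (- \<eta> - 1)) * (\<integral>w. indicator {0<..} w * (F (c * w) * w powr (- \<eta> - 1)) \<partial>lborel)"
    using c by simp
  moreover have "c * c powr (- \<eta> - 1) = c powr (- \<eta>)" using c by (simp add: powr_diff)
  ultimately show ?thesis by (simp only: set_lebesgue_integral_def real_scaleR_def)
qed

text \<open>The weights are lengths of position sets: a jump at a position in \<open>{0..t}\<close>
  enters both terms of the increment and sees the difference of the kernels, one in
  \<open>{t<..t + \<epsilon>}\<close> sees only the new kernel, whose integral is already evaluated
  here.\<close>

definition increment_exponent :: "(real \<Rightarrow> real) \<Rightarrow> real \<Rightarrow> real \<Rightarrow> real \<Rightarrow> real" where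
  "increment_exponent \<alpha> t \<epsilon> \<theta> =
    t * (LINT x:{0<..}|lborel. 1 - cos (\<theta> *
      (stable_const (\<alpha> (t + \<epsilon>)) powr (1 / \<alpha> (t + \<epsilon>)) * x powr (- 1 / \<alpha> (t + \<epsilon>)) -
       stable_const (\<alpha> t) powr (1 / \<alpha> t) * x powr (- 1 / \<alpha> t))))
    + \<epsilon> * \<theta> powr \<alpha> (t + \<epsilon>)"

lemma increment_exponent_measurable [measurable]:
  "increment_exponent \<alpha> t \<epsilon> \<in> borel_measurable borel"
  unfolding increment_exponent_def[abs_def] set_lebesgue_integral_def by measurable

lemma increment_exponent_asymptotics:
  fixes \<alpha> :: "real \<Rightarrow> real"
  assumes \<alpha>: "(\<alpha> has_real_derivative D) (at t)" and t: "1 < \<alpha> t" "\<alpha> t < 2" "0 < t"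
    and \<eta>: "0 < \<eta>" "\<eta> < \<alpha> t"
  shows "((\<lambda>\<epsilon>. (LINT u:{0<..}|lborel. (1 - exp (- increment_exponent \<alpha> t \<epsilon> u)) * u powr (- \<eta> - 1))
            / \<epsilon> powr (\<eta> / \<alpha> t)) \<longlongrightarrow> Gamma (1 - \<eta> / \<alpha> t) / \<eta>) (at_right 0)"
proof -
  define a where "a = \<alpha> t"
  note [simp] = a_def[symmetric]
  have a: "1 < a" "a < 2" "\<eta> < a" using t \<eta> by simp_all
  \<comment> \<open>The midpoint: \<open>p > \<eta>\<close> makes the majorant integrable against
    \<open>w powr (- \<eta> - 1)\<close> at 0, \<open>p < a\<close> makes the kernel bound
    integrable.\<close>
  define p where "p = (\<eta> + a) / 2"
  have p: "\<eta> < p" "p < a" "0 < p" "p < 2" using \<eta> a by (auto simp: p_def)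
  \<comment> \<open>Small enough that \<open>p * (1 / a + 2 * k) < 1\<close> and
    \<open>2 * (1 / a - 2 * k) > 1\<close> survive the widening of the exponents.\<close>
  define k where "k = min (1 / p - 1 / a) (1 / a - 1 / 2) / 4"
  have pa: "1 / a < 1 / p" "1 / 2 < 1 / a" using p a by (auto simp: field_simps)
  have "0 < min (1 / p - 1 / a) (1 / a - 1 / 2)" using pa by simp
  then have k0: "0 < k" by (simp add: k_def)
  have "4 * k \<le> 1 / p - 1 / a" "4 * k \<le> 1 / a - 1 / 2" by (simp_all add: k_def)
  then have "1 / a + 2 * k < 1 / p" and k2: "1 < 2 * (1 / a - 2 * k)"
    using k0 pa unfolding right_diff_distrib by linarith+
  then have k1: "p * (1 / a + 2 * k) < 1" using p by (simp add: field_simps)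
  define A where "A s = stable_const (\<alpha> s) powr (1 / \<alpha> s)" for s
  define Dk where "Dk \<epsilon> x = A (t + \<epsilon>) * x powr (- 1 / \<alpha> (t + \<epsilon>)) - A t * x powr (- 1 / a)" for \<epsilon> x
  have [measurable]: "Dk \<epsilon> \<in> borel_measurable borel" for \<epsilon> unfolding Dk_def[abs_def] by measurable
  obtain K where K: "0 < K" and KD: "\<forall>\<^sub>F \<epsilon> in at_right 0. \<forall>x>0.
    \<bar>Dk \<epsilon> x\<bar> \<le> K * \<epsilon> * powr_env (- (1 / a + 2 * k)) (- (1 / a - 2 * k)) x"
    using stable_kernel_Lipschitz[OF \<alpha> t(1,2) k0] unfolding Dk_def A_def a_def by blast
  define B where "B = 2 * (LINT x:{0<..}|lborel. powr_env (- p * (1 / a + 2 * k)) (- 2 * (1 / a - 2 * k)) x)"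
  have B: "0 \<le> B"
    unfolding B_def set_lebesgue_integral_def
    by (intro mult_nonneg_nonneg integral_nonneg_AE) (auto simp: powr_env_nonneg)
  define J where "J \<epsilon> \<theta> = (LINT x:{0<..}|lborel. 1 - cos (\<theta> * Dk \<epsilon> x))" for \<epsilon> \<theta>
  define \<psi> where "\<psi> \<epsilon> w = increment_exponent \<alpha> t \<epsilon> (\<epsilon> powr (- 1 / a) * w)" for \<epsilon> w
  define h where "h \<epsilon> = \<epsilon> powr (1 - \<alpha> (t + \<epsilon>) / a)" for \<epsilon>
  have h: "(h \<longlongrightarrow> 1) (at_right 0)"
    using powr_perturb_tendsto_1[OF \<alpha>] t unfolding h_def[abs_def] by simp
  have \<alpha>lim: "((\<lambda>\<epsilon>. \<alpha> (t + \<epsilon>)) \<longlongrightarrow> a) (at_right 0)"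
  proof -
    have "(\<alpha> \<longlongrightarrow> a) (at t)" using DERIV_isCont[OF \<alpha>] by (simp add: isCont_def)
    then have "((\<lambda>\<epsilon>. \<alpha> (t + \<epsilon>)) \<longlongrightarrow> a) (at 0)" by (simp add: LIM_offset_zero_iff)
    then show ?thesis by (rule tendsto_mono[OF at_le[OF subset_UNIV]])
  qed
  \<comment> \<open>The rescaling turns \<open>\<epsilon> * u powr \<alpha> (t + \<epsilon>)\<close>
    into \<open>h \<epsilon> * w powr \<alpha> (t + \<epsilon>)\<close>; the factor
    \<open>h \<epsilon>\<close> differs from 1 only through the moving index.\<close>
  have \<psi>_eq: "\<psi> \<epsilon> w = t * J \<epsilon> (\<epsilon> powr (- 1 / a) * w) + h \<epsilon> * w powr \<alpha> (t + \<epsilon>)" if "0 < \<epsilon>" "0 < w" for \<epsilon> w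
    using that a unfolding \<psi>_def increment_exponent_def J_def Dk_def A_def h_def
    by (simp add: powr_mult powr_powr powr_diff powr_minus_divide powr_divide)
  have J_bound: "\<forall>\<^sub>F \<epsilon> in at_right 0. \<forall>w>0. 0 \<le> J \<epsilon> (\<epsilon> powr (- 1 / a) * w) \<and>
      J \<epsilon> (\<epsilon> powr (- 1 / a) * w) \<le> B * ((K * \<epsilon> powr (1 - 1 / a) * w) powr p + (K * \<epsilon> powr (1 - 1 / a) * w)\<^sup>2)"
    using KD eventually_at_right_less
  proof eventually_elim
    case (elim \<epsilon>)
    show ?case
    proof (intro allI impI)
      fix w :: real assume w: "0 < w"
      have *: "\<bar>\<epsilon> powr (- 1 / a) * w * Dk \<epsilon> x\<bar> \<le> (K * \<epsilon> powr (1 - 1 / a) * w) * powr_env (- (1 / a + 2 * k)) (- (1 / a - 2 * k)) x"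
        if x: "0 < x" for x
      proof -
        have "\<bar>\<epsilon> powr (- 1 / a) * w * Dk \<epsilon> x\<bar> = (\<epsilon> powr (- 1 / a) * w) * \<bar>Dk \<epsilon> x\<bar>"
          using w by (simp add: abs_mult)
        also have "\<dots> \<le> (\<epsilon> powr (- 1 / a) * w) * (K * \<epsilon> * powr_env (- (1 / a + 2 * k)) (- (1 / a - 2 * k)) x)"
          using elim x w by (intro mult_left_mono) auto
        also have "\<dots> = (K * \<epsilon> powr (1 - 1 / a) * w) * powr_env (- (1 / a + 2 * k)) (- (1 / a - 2 * k)) x"
          using elim by (simp add: powr_diff powr_minus_divide)
        finally show ?thesis .
      qed
      have **: "0 < K * \<epsilon> powr (1 - 1 / a) * w" using K w elim by simp
      show "0 \<le> J \<epsilon> (\<epsilon> powr (- 1 / a) * w) \<and>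
      J \<epsilon> (\<epsilon> powr (- 1 / a) * w) \<le> B * ((K * \<epsilon> powr (1 - 1 / a) * w) powr p + (K * \<epsilon> powr (1 - 1 / a) * w)\<^sup>2)"
        unfolding J_def B_def
        using LINT_one_minus_cos_bound[OF _ * _ _ k1 k2 **] p by auto
    qed
  qed
  have \<psi>_lim: "((\<lambda>\<epsilon>. \<psi> \<epsilon> w) \<longlongrightarrow> w powr a) (at_right 0)" if w: "0 < w" for w
  proof -
    have z: "((\<lambda>\<epsilon>. K * \<epsilon> powr (1 - 1 / a) * w) \<longlongrightarrow> K * 0 * w) (at_right 0)"
    proof (intro tendsto_intros)
      show "((\<lambda>\<epsilon>. \<epsilon> powr (1 - 1 / a)) \<longlongrightarrow> 0) (at_right 0)"
        by (rule tendsto_eq_rhs[OF tendsto_powr'[OF tendsto_ident_at tendsto_const]])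
           (use a in \<open>auto simp: eventually_at_right_less less_imp_le eventually_mono[OF eventually_at_right_less]\<close>)
    qed
    have "((\<lambda>\<epsilon>. B * ((K * \<epsilon> powr (1 - 1 / a) * w) powr p + (K * \<epsilon> powr (1 - 1 / a) * w)\<^sup>2)) \<longlongrightarrow> B * (0 powr p + 0\<^sup>2)) (at_right 0)"
      using z p K w by (intro tendsto_intros tendsto_powr') (auto intro!: always_eventually)
    then have "((\<lambda>\<epsilon>. B * ((K * \<epsilon> powr (1 - 1 / a) * w) powr p + (K * \<epsilon> powr (1 - 1 / a) * w)\<^sup>2)) \<longlongrightarrow> 0) (at_right 0)"
      by simp
    then have "((\<lambda>\<epsilon>. J \<epsilon> (\<epsilon> powr (- 1 / a) * w)) \<longlongrightarrow> 0) (at_right 0)"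
      by (rule Lim_null_comparison[rotated]) (use J_bound w in \<open>auto elim!: eventually_mono\<close>)
    then have "((\<lambda>\<epsilon>. t * J \<epsilon> (\<epsilon> powr (- 1 / a) * w) + h \<epsilon> * w powr \<alpha> (t + \<epsilon>)) \<longlongrightarrow> t * 0 + 1 * w powr a) (at_right 0)"
      using w by (intro tendsto_intros h \<alpha>lim) auto
    then have "((\<lambda>\<epsilon>. t * J \<epsilon> (\<epsilon> powr (- 1 / a) * w) + h \<epsilon> * w powr \<alpha> (t + \<epsilon>)) \<longlongrightarrow> w powr a) (at_right 0)" by simp
    then show ?thesis
      by (rule Lim_transform_eventually) (use \<psi>_eq w in \<open>auto intro!: eventually_mono[OF eventually_at_right_less]\<close>)
  qed
  \<comment> \<open>The first part comes from the bound for \<open>J\<close> with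
    \<open>\<epsilon> \<le> 1\<close>, the 2 from \<open>h \<epsilon> < 2\<close>. The 2 also makes
    \<open>C\<close> dominate \<open>1 - exp (- \<psi> \<epsilon> w)\<close> for large
    \<open>w\<close>.\<close>
  define C where "C = t * B * (K powr p + K\<^sup>2) + 2"
  have C: "2 \<le> C" using t B K by (simp add: C_def)
  have \<psi>_bound: "\<forall>\<^sub>F \<epsilon> in at_right 0. \<forall>w>0. 0 \<le> \<psi> \<epsilon> w \<and> (w \<le> 1 \<longrightarrow> \<psi> \<epsilon> w \<le> C * w powr p)"
  proof -
    have "\<forall>\<^sub>F \<epsilon> in at_right 0. h \<epsilon> < 2" by (rule order_tendstoD(2)[OF h]) simp
    moreover have "\<forall>\<^sub>F \<epsilon> in at_right 0. p < \<alpha> (t + \<epsilon>)" by (rule order_tendstoD(1)[OF \<alpha>lim p(2)])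
    moreover have "\<forall>\<^sub>F \<epsilon> in at_right (0::real). \<epsilon> < 1" by (rule eventually_at_right_real[THEN eventually_mono, of 0 1]) auto
    ultimately show ?thesis using J_bound eventually_at_right_less
    proof eventually_elim
      case (elim \<epsilon>)
      show ?case
      proof (intro allI impI conjI)
        fix w :: real assume w: "0 < w"
        show "0 \<le> \<psi> \<epsilon> w" using \<psi>_eq[of \<epsilon> w] elim w t by (simp add: h_def)
        assume w1: "w \<le> 1"
        have "\<epsilon> powr (1 - 1 / a) \<le> 1" using elim a by (intro powr_le1) auto
        then have "K * \<epsilon> powr (1 - 1 / a) * w \<le> K * 1 * w" using K w by (intro mult_mono) auto
        then have le: "K * \<epsilon> powr (1 - 1 / a) * w \<le> K * w" by simp
        have "(K * \<epsilon> powr (1 - 1 / a) * w) powr p \<le> (K * w) powr p"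
          using le K w p by (intro powr_mono2) auto
        moreover have "(K * \<epsilon> powr (1 - 1 / a) * w)\<^sup>2 \<le> (K * w)\<^sup>2"
          using le K w by (intro power_mono) auto
        moreover have "w\<^sup>2 \<le> w powr p"
          using powr_mono'[of p 2 w] w w1 p by simp
        then have "(K * w)\<^sup>2 \<le> K\<^sup>2 * w powr p" by (simp add: power_mult_distrib mult_left_mono)
        moreover have "(K * w) powr p = K powr p * w powr p" using K w by (simp add: powr_mult)
        ultimately have "(K * \<epsilon> powr (1 - 1 / a) * w) powr p + (K * \<epsilon> powr (1 - 1 / a) * w)\<^sup>2
             \<le> (K powr p + K\<^sup>2) * w powr p"
          unfolding distrib_right by linarith
        then have "J \<epsilon> (\<epsilon> powr (- 1 / a) * w) \<le> B * ((K powr p + K\<^sup>2) * w powr p)"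
          using elim w B by (meson mult_left_mono order.trans)
        then have 1: "t * J \<epsilon> (\<epsilon> powr (- 1 / a) * w) \<le> t * (B * ((K powr p + K\<^sup>2) * w powr p))"
          using t by (intro mult_left_mono) auto
        have 2: "h \<epsilon> * w powr \<alpha> (t + \<epsilon>) \<le> 2 * w powr p"
          using elim w w1 by (intro mult_mono powr_mono') (auto simp: h_def)
        show "\<psi> \<epsilon> w \<le> C * w powr p"
          using 1 2 \<psi>_eq[of \<epsilon> w] elim w by (simp add: C_def algebra_simps)
      qed
    qed
  qed
  \<comment> \<open>The limit at 0 from the right is transported to infinity by
    \<open>inverse\<close>, where dominated convergence for a continuous parameter is
    available.\<close>
  have main: "((\<lambda>\<epsilon>. LINT w:{0<..}|lborel. (1 - exp (- \<psi> \<epsilon> w)) * w powr (- \<eta> - 1))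
      \<longlongrightarrow> (LINT w:{0<..}|lborel. (1 - exp (- (w powr a))) * w powr (- \<eta> - 1))) (at_right 0)"
    unfolding filterlim_at_right_to_top set_lebesgue_integral_def
  proof (rule integral_dominated_convergence_at_top[where w="\<lambda>w. indicator {0<..} w * (C * powr_env (p - \<eta> - 1) (- \<eta> - 1) w)"])
    show "integrable lborel (\<lambda>w. indicator {0<..} w * (C * powr_env (p - \<eta> - 1) (- \<eta> - 1) w))"
      using set_integrable_powr_env[of "p - \<eta> - 1" "- \<eta> - 1"] p \<eta>
      by (simp add: set_integrable_def mult.left_commute)
    show "\<forall>\<^sub>F \<epsilon> in at_top. AE w in lborel. norm (indicator {0<..} w *\<^sub>R ((1 - exp (- \<psi> (inverse \<epsilon>) w)) * w powr (- \<eta> - 1)))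
       \<le> indicator {0<..} w * (C * powr_env (p - \<eta> - 1) (- \<eta> - 1) w)"
    proof -
      have "\<forall>\<^sub>F \<epsilon> in at_right 0. AE w in lborel. norm (indicator {0<..} w *\<^sub>R ((1 - exp (- \<psi> \<epsilon> w)) * w powr (- \<eta> - 1)))
       \<le> indicator {0<..} w * (C * powr_env (p - \<eta> - 1) (- \<eta> - 1) w)"
        using \<psi>_bound
      proof eventually_elim
        case (elim \<epsilon>)
        show ?case
        proof (intro AE_I2)
          fix w :: real
          \<comment> \<open>For \<open>w \<le> 1\<close> this is
            \<open>1 - exp (- y) \<le> y\<close> with the bound on \<psi>; for \<open>w > 1\<close>
            only \<open>1 - exp (- y) \<le> 1\<close> is used.\<close>
          have "\<bar>1 - exp (- \<psi> \<epsilon> w)\<bar> \<le> C * powr_env p 0 w" if w: "0 < w"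
          proof -
            have "1 - exp (- \<psi> \<epsilon> w) \<le> \<psi> \<epsilon> w" using exp_ge_add_one_self[of "- \<psi> \<epsilon> w"] by linarith
            moreover have "exp (- \<psi> \<epsilon> w) \<le> 1" "0 < exp (- \<psi> \<epsilon> w)" using elim w by auto
            moreover have "1 - exp (- \<psi> \<epsilon> w) \<le> C" using C by (smt (verit) exp_gt_zero)
            ultimately show ?thesis using elim w
              by (auto simp: powr_env_def intro: order.trans)
          qed
          then show "norm (indicator {0<..} w *\<^sub>R ((1 - exp (- \<psi> \<epsilon> w)) * w powr (- \<eta> - 1)))
       \<le> indicator {0<..} w * (C * powr_env (p - \<eta> - 1) (- \<eta> - 1) w)"
            using mult_right_mono[of "\<bar>1 - exp (- \<psi> \<epsilon> w)\<bar>" "C * powr_env p 0 w" "w powr (- \<eta> - 1)"]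
              powr_env_mult_powr[of p 0 w "- \<eta> - 1"] add_diff_eq[of p "- \<eta>" 1]
            by (auto simp: abs_mult indicator_def mult.assoc)
        qed
      qed
      then show ?thesis by (simp add: eventually_at_right_to_top)
    qed
    show "AE w in lborel. ((\<lambda>\<epsilon>. indicator {0<..} w *\<^sub>R ((1 - exp (- \<psi> (inverse \<epsilon>) w)) * w powr (- \<eta> - 1)))
        \<longlongrightarrow> indicator {0<..} w *\<^sub>R ((1 - exp (- (w powr a))) * w powr (- \<eta> - 1))) at_top"
    proof (intro AE_I2)
      fix w :: real
      show "((\<lambda>\<epsilon>. indicator {0<..} w *\<^sub>R ((1 - exp (- \<psi> (inverse \<epsilon>) w)) * w powr (- \<eta> - 1)))
        \<longlongrightarrow> indicator {0<..} w *\<^sub>R ((1 - exp (- (w powr a))) * w powr (- \<eta> - 1))) at_top"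
      proof (cases "0 < w")
        case True
        have "((\<lambda>\<epsilon>. \<psi> (inverse \<epsilon>) w) \<longlongrightarrow> w powr a) at_top"
          using \<psi>_lim[OF True] by (simp add: filterlim_at_right_to_top)
        then show ?thesis by (intro tendsto_intros)
      qed simp
    qed
  qed (auto simp: \<psi>_def)
  have "((\<lambda>\<epsilon>. LINT w:{0<..}|lborel. (1 - exp (- \<psi> \<epsilon> w)) * w powr (- \<eta> - 1)) \<longlongrightarrow> Gamma (1 - \<eta> / a) / \<eta>) (at_right 0)"
    using main LINT_one_minus_exp[OF \<eta>(1) a(3)] by simp
  moreover have "\<forall>\<^sub>F \<epsilon> in at_right 0. (LINT w:{0<..}|lborel. (1 - exp (- \<psi> \<epsilon> w)) * w powr (- \<eta> - 1)) =
     (LINT u:{0<..}|lborel. (1 - exp (- increment_exponent \<alpha> t \<epsilon> u)) * u powr (- \<eta> - 1)) / \<epsilon> powr (\<eta> / \<alpha> t)"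
    using eventually_at_right_less
  proof eventually_elim
    case (elim \<epsilon>)
    have "(LINT u:{0<..}|lborel. (1 - exp (- increment_exponent \<alpha> t \<epsilon> u)) * u powr (- \<eta> - 1))
      = (\<epsilon> powr (- 1 / a)) powr (- \<eta>) * (LINT w:{0<..}|lborel. (1 - exp (- \<psi> \<epsilon> w)) * w powr (- \<eta> - 1))"
      unfolding \<psi>_def using elim by (intro LINT_powr_scale) auto
    then show ?case using elim by (simp add: powr_powr)
  qed
  ultimately show ?thesis by (simp add: tendsto_cong)
qed

subsection \<open>Conditioning on the arrival times\<close>

text \<open>Tonelli for the joint law, which is a product. The second law is pulled back to the same
  space, so \<omega>' plays the part of an independent copy.\<close>

lemma (in prob_space) indep_var_nn_integral:
  assumes ind: "indep_var N1 X N2 Y" and h [measurable]: "h \<in> borel_measurable (N1 \<Otimes>\<^sub>M N2)"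
  shows "(\<integral>\<^sup>+\<omega>. h (X \<omega>, Y \<omega>) \<partial>M) = (\<integral>\<^sup>+\<omega>. \<integral>\<^sup>+\<omega>'. h (X \<omega>, Y \<omega>') \<partial>M \<partial>M)"
proof -
  have [measurable]: "X \<in> measurable M N1" "Y \<in> measurable M N2"
    and eq: "distr M N1 X \<Otimes>\<^sub>M distr M N2 Y = distr M (N1 \<Otimes>\<^sub>M N2) (\<lambda>x. (X x, Y x))"
    using ind by (auto simp: indep_var_distribution_eq)
  interpret Y: prob_space "distr M N2 Y" by (rule prob_space_distr) simp
  have "(\<integral>\<^sup>+\<omega>. h (X \<omega>, Y \<omega>) \<partial>M) = (\<integral>\<^sup>+z. h z \<partial>(distr M N1 X \<Otimes>\<^sub>M distr M N2 Y))"
    unfolding eq by (simp add: nn_integral_distr)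
  also have "\<dots> = (\<integral>\<^sup>+x. \<integral>\<^sup>+y. h (x, y) \<partial>distr M N2 Y \<partial>distr M N1 X)"
    by (rule Y.nn_integral_fst[symmetric]) simp
  also have "\<dots> = (\<integral>\<^sup>+\<omega>. \<integral>\<^sup>+y. h (X \<omega>, y) \<partial>distr M N2 Y \<partial>M)"
    by (rule nn_integral_distr) auto
  also have "\<dots> = (\<integral>\<^sup>+\<omega>. \<integral>\<^sup>+\<omega>'. h (X \<omega>, Y \<omega>') \<partial>M \<partial>M)"
    using measurable_space[of X M N1]
    by (intro nn_integral_cong nn_integral_distr measurable_compose[OF measurable_Pair1' h]) auto
  finally show ?thesis .
qed

lemma (in prob_space) indep_var_integral:
  fixes h :: "_ \<Rightarrow> real"
  assumes ind: "indep_var N1 X N2 Y" and h [measurable]: "h \<in> borel_measurable (N1 \<Otimes>\<^sub>M N2)"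
    and bound: "\<And>z. \<bar>h z\<bar> \<le> B"
  shows "(\<integral>\<omega>. h (X \<omega>, Y \<omega>) \<partial>M) = (\<integral>\<omega>. \<integral>\<omega>'. h (X \<omega>, Y \<omega>') \<partial>M \<partial>M)"
proof -
  have [measurable]: "X \<in> measurable M N1" "Y \<in> measurable M N2"
    and eq: "distr M N1 X \<Otimes>\<^sub>M distr M N2 Y = distr M (N1 \<Otimes>\<^sub>M N2) (\<lambda>x. (X x, Y x))"
    using ind by (auto simp: indep_var_distribution_eq)
  interpret X: prob_space "distr M N1 X" by (rule prob_space_distr) simp
  interpret Y: prob_space "distr M N2 Y" by (rule prob_space_distr) simp
  interpret XY: pair_prob_space "distr M N1 X" "distr M N2 Y" ..
  have "integrable (distr M N1 X \<Otimes>\<^sub>M distr M N2 Y) h"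
    by (rule XY.integrable_const_bound[where B=B]) (use bound in auto)
  note fst = XY.integral_fst'[OF this]
  have "(\<integral>\<omega>. h (X \<omega>, Y \<omega>) \<partial>M) = (\<integral>z. h z \<partial>(distr M N1 X \<Otimes>\<^sub>M distr M N2 Y))"
    unfolding eq by (simp add: integral_distr)
  also have "\<dots> = (\<integral>x. \<integral>y. h (x, y) \<partial>distr M N2 Y \<partial>distr M N1 X)"
    by (rule fst[symmetric])
  also have "\<dots> = (\<integral>\<omega>. \<integral>\<omega>'. h (X \<omega>, Y \<omega>') \<partial>M \<partial>M)"
  proof -
    have "(\<integral>x. \<integral>y. h (x, y) \<partial>distr M N2 Y \<partial>distr M N1 X) = (\<integral>\<omega>. \<integral>y. h (X \<omega>, y) \<partial>distr M N2 Y \<partial>M)"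
      by (rule integral_distr) auto
    also have "\<dots> = (\<integral>\<omega>. \<integral>\<omega>'. h (X \<omega>, Y \<omega>') \<partial>M \<partial>M)"
      using measurable_space[of X M N1]
      by (intro Bochner_Integration.integral_cong integral_distr measurable_compose[OF measurable_Pair1' h]) auto
    finally show ?thesis .
  qed
  finally show ?thesis .
qed

text \<open>Borel-Cantelli in exponential form: the sum of the \<open>exp (X n \<omega>)\<close> has
  finite expectation, so its terms tend to 0 almost surely and are eventually below 1.\<close>

lemma (in prob_space) AE_eventually_nonpos_of_exp_summable:
  fixes X :: "nat \<Rightarrow> 'a \<Rightarrow> real"
  assumes [measurable]: "\<And>n. X n \<in> borel_measurable M"
    and le: "\<And>n. (\<integral>\<^sup>+\<omega>. ennreal (exp (X n \<omega>)) \<partial>M) \<le> ennreal (c n)"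
    and c: "summable c" "\<And>n. 0 \<le> c n"
  shows "AE \<omega> in M. \<forall>\<^sub>F n in sequentially. X n \<omega> \<le> 0"
proof -
  have "(\<integral>\<^sup>+\<omega>. (\<Sum>n. ennreal (exp (X n \<omega>))) \<partial>M) = (\<Sum>n. \<integral>\<^sup>+\<omega>. ennreal (exp (X n \<omega>)) \<partial>M)"
    by (intro nn_integral_suminf) auto
  also have "\<dots> \<le> (\<Sum>n. ennreal (c n))" by (intro suminf_le le) auto
  also have "\<dots> = ennreal (\<Sum>n. c n)" using c by (intro suminf_ennreal2) auto
  also have "\<dots> < \<infinity>" by simp
  finally have "(\<integral>\<^sup>+\<omega>. (\<Sum>n. ennreal (exp (X n \<omega>))) \<partial>M) \<noteq> \<infinity>" by simp
  then have "AE \<omega> in M. (\<Sum>n. ennreal (exp (X n \<omega>))) \<noteq> \<infinity>"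
    by (intro nn_integral_noteq_infinite) auto
  then show ?thesis
  proof eventually_elim
    case (elim \<omega>)
    then have "summable (\<lambda>n. exp (X n \<omega>))" by (intro summable_suminf_not_top) auto
    then have "(\<lambda>n. exp (X n \<omega>)) \<longlonglongrightarrow> 0" by (rule summable_LIMSEQ_zero)
    then have "\<forall>\<^sub>F n in sequentially. exp (X n \<omega>) < 1" by (rule order_tendstoD) simp
    then show ?case by eventually_elim simp
  qed
qed

text \<open>Only the random ingredients are fixed; the index function, the time and the kernel
  remain free, so that the formulas below hold for general kernels.\<close>

locale lepage_series = prob_space M for M :: "'a measure" +
  fixes \<Gamma> V \<gamma> :: "nat \<Rightarrow> 'a \<Rightarrow> real"
  assumes arrival_times: "poisson_arrival_times M 1 \<Gamma>"
    and indep_V: "indep_vars (\<lambda>_. borel) V UNIV"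
    and distr_V: "\<And>i. distr M borel (V i) = uniform_measure lborel {0..1}"
    and indep_sign: "indep_vars (\<lambda>_. borel) \<gamma> UNIV"
    and prob_sign_1: "\<And>i. prob {\<omega> \<in> space M. \<gamma> i \<omega> = 1} = 1 / 2"
    and prob_sign_minus_1: "\<And>i. prob {\<omega> \<in> space M. \<gamma> i \<omega> = - 1} = 1 / 2"
    and indep_families: "indep_vars (\<lambda>_. PiM UNIV (\<lambda>_. borel)) (\<lambda>k \<omega> i. ([\<Gamma>, V, \<gamma>] ! k) i \<omega>) {..<3}"
begin

lemma \<Gamma>_measurable [measurable]: "\<Gamma> i \<in> borel_measurable M"
  using arrival_times by (simp add: poisson_arrival_times_def)

lemma V_measurable [measurable]: "V i \<in> borel_measurable M"
  using indep_V by (auto simp: indep_vars_def)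

lemma sign_measurable [measurable]: "\<gamma> i \<in> borel_measurable M"
  using indep_sign by (auto simp: indep_vars_def)

lemma indep_var_V_sign:
  "indep_var (PiM UNIV (\<lambda>_. borel)) (\<lambda>\<omega> i. V i \<omega>) (PiM UNIV (\<lambda>_. borel)) (\<lambda>\<omega> i. \<gamma> i \<omega>)"
proof -
  \<comment> \<open>Restricting the triple to a block still yields families over a singleton index;
    evaluation at that index unwraps them.\<close>
  have m: "(\<lambda>f. f k) \<in> measurable (PiM {k} (\<lambda>_. PiM UNIV (\<lambda>_. borel))) (PiM UNIV (\<lambda>_. borel))" for k :: nat
    by (rule measurable_component_singleton) simp
  have "indep_var (PiM {1} (\<lambda>_. PiM UNIV (\<lambda>_. borel))) (\<lambda>\<omega>. restrict (\<lambda>k i. ([\<Gamma>, V, \<gamma>] ! k) i \<omega>) {1})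
     (PiM {2} (\<lambda>_. PiM UNIV (\<lambda>_. borel))) (\<lambda>\<omega>. restrict (\<lambda>k i. ([\<Gamma>, V, \<gamma>] ! k) i \<omega>) {2})"
    by (rule indep_var_restrict[OF indep_families]) auto
  from indep_var_compose[OF this m m] show ?thesis by (simp add: comp_def)
qed

lemma indep_var_\<Gamma>_V:
  "indep_var (PiM UNIV (\<lambda>_. borel)) (\<lambda>\<omega> i. \<Gamma> i \<omega>) (PiM UNIV (\<lambda>_. borel)) (\<lambda>\<omega> i. V i \<omega>)"
proof -
  have m: "(\<lambda>f. f k) \<in> measurable (PiM {k} (\<lambda>_. PiM UNIV (\<lambda>_. borel))) (PiM UNIV (\<lambda>_. borel))" for k :: nat
    by (rule measurable_component_singleton) simp
  have "indep_var (PiM {0} (\<lambda>_. PiM UNIV (\<lambda>_. borel))) (\<lambda>\<omega>. restrict (\<lambda>k i. ([\<Gamma>, V, \<gamma>] ! k) i \<omega>) {0})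
     (PiM {1} (\<lambda>_. PiM UNIV (\<lambda>_. borel))) (\<lambda>\<omega>. restrict (\<lambda>k i. ([\<Gamma>, V, \<gamma>] ! k) i \<omega>) {1})"
    by (rule indep_var_restrict[OF indep_families]) auto
  from indep_var_compose[OF this m m] show ?thesis by (simp add: comp_def)
qed

text \<open>Arrival times and positions form one block, so that the signs can be integrated out
  first with both of the others frozen.\<close>

lemma indep_var_\<Gamma>V_sign:
  "indep_var (PiM {0, 1} (\<lambda>_. PiM UNIV (\<lambda>_. borel))) (\<lambda>\<omega>. restrict (\<lambda>k i. ([\<Gamma>, V, \<gamma>] ! k) i \<omega>) {0, 1})
     (PiM {2} (\<lambda>_. PiM UNIV (\<lambda>_. borel))) (\<lambda>\<omega>. restrict (\<lambda>k i. ([\<Gamma>, V, \<gamma>] ! k) i \<omega>) {2})"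
  by (rule indep_var_restrict[OF indep_families]) auto

lemma AE_sign: "AE \<omega> in M. \<gamma> i \<omega> = 1 \<or> \<gamma> i \<omega> = - 1"
proof -
  have "prob ({\<omega> \<in> space M. \<gamma> i \<omega> = 1} \<union> {\<omega> \<in> space M. \<gamma> i \<omega> = - 1}) = 1"
    using prob_sign_1[of i] prob_sign_minus_1[of i]
    by (subst finite_measure_Union) auto
  then show ?thesis by (auto simp: prob_eq_1 elim!: eventually_mono)
qed

text \<open>Vector-valued in order to cover the complex function \<open>cis\<close> as well as real
  ones.\<close>

lemma has_bochner_integral_sign:
  fixes h :: "real \<Rightarrow> 'b::{banach, second_countable_topology}"
  assumes [measurable]: "h \<in> borel_measurable borel"
  shows "has_bochner_integral M (\<lambda>\<omega>. h (\<gamma> i \<omega>)) ((1 / 2) *\<^sub>R (h 1 + h (- 1)))"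
proof -
  have "has_bochner_integral M (\<lambda>\<omega>. indicator {\<omega> \<in> space M. \<gamma> i \<omega> = 1} \<omega> *\<^sub>R h 1 +
      indicator {\<omega> \<in> space M. \<gamma> i \<omega> = - 1} \<omega> *\<^sub>R h (- 1)) ((1 / 2) *\<^sub>R h 1 + (1 / 2) *\<^sub>R h (- 1))"
  proof (rule has_bochner_integral_add)
    have fin: "emeasure M A < \<infinity>" for A by (simp add: emeasure_eq_measure)
    show "has_bochner_integral M (\<lambda>\<omega>. indicator {\<omega> \<in> space M. \<gamma> i \<omega> = 1} \<omega> *\<^sub>R h 1) ((1 / 2) *\<^sub>R h 1)"
      using has_bochner_integral_indicator[OF _ fin, of "{\<omega> \<in> space M. \<gamma> i \<omega> = 1}" "h 1"] by (simp add: prob_sign_1)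
    show "has_bochner_integral M (\<lambda>\<omega>. indicator {\<omega> \<in> space M. \<gamma> i \<omega> = - 1} \<omega> *\<^sub>R h (- 1)) ((1 / 2) *\<^sub>R h (- 1))"
      using has_bochner_integral_indicator[OF _ fin, of "{\<omega> \<in> space M. \<gamma> i \<omega> = - 1}" "h (- 1)"] by (simp add: prob_sign_minus_1)
  qed
  then have "has_bochner_integral M (\<lambda>\<omega>. indicator {\<omega> \<in> space M. \<gamma> i \<omega> = 1} \<omega> *\<^sub>R h 1 +
      indicator {\<omega> \<in> space M. \<gamma> i \<omega> = - 1} \<omega> *\<^sub>R h (- 1)) ((1 / 2) *\<^sub>R (h 1 + h (- 1)))"
    by (simp add: scaleR_add_right)
  moreover have "AE \<omega> in M. indicator {\<omega> \<in> space M. \<gamma> i \<omega> = 1} \<omega> *\<^sub>R h 1 +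
      indicator {\<omega> \<in> space M. \<gamma> i \<omega> = - 1} \<omega> *\<^sub>R h (- 1) = h (\<gamma> i \<omega>)"
    using AE_sign[of i] AE_space by eventually_elim (auto simp: indicator_def)
  ultimately show ?thesis by (subst (asm) has_bochner_integral_cong_AE) auto
qed

text \<open>The cosine of a sum does not factor, but \<open>cis\<close> does. By symmetry each
  factor has the real expectation \<open>cos (b i)\<close>, and the real part gives the
  claim.\<close>

lemma expectation_cos_sign_sum:
  "(\<integral>\<omega>. cos (\<Sum>i<m. \<gamma> i \<omega> * b i) \<partial>M) = (\<Prod>i<m. cos (b i))" for b :: "nat \<Rightarrow> real"
proof -
  have [measurable]: "(\<lambda>x. cis (x * y)) \<in> borel_measurable borel" for y
    by (intro borel_measurable_continuous_onI continuous_intros)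
  have hb: "has_bochner_integral M (\<lambda>\<omega>. cis (\<gamma> i \<omega> * b i)) (complex_of_real (cos (b i)))" for i
    using has_bochner_integral_sign[of "\<lambda>x. cis (x * b i)" i]
    by (simp add: cis.ctr complex_eq_iff scaleR_conv_of_real Complex_eq)
  have ind: "indep_vars (\<lambda>_. borel) (\<lambda>i \<omega>. cis (\<gamma> i \<omega> * b i)) {..<m}"
    by (rule indep_vars_compose2[OF indep_vars_subset[OF indep_sign]]) auto
  have cisum: "cis (\<Sum>i\<in>A. x i) = (\<Prod>i\<in>A. cis (x i))" if "finite A" for A :: "nat set" and x
    using that by induction (auto simp: cis_mult[symmetric])
  have int: "integrable M (\<lambda>\<omega>. \<Prod>i<m. cis (\<gamma> i \<omega> * b i))"
    using hb by (intro indep_vars_integrable[OF _ ind]) (auto simp: has_bochner_integral_iff)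
  have "(\<integral>\<omega>. (\<Prod>i<m. cis (\<gamma> i \<omega> * b i)) \<partial>M) = (\<Prod>i<m. \<integral>\<omega>. cis (\<gamma> i \<omega> * b i) \<partial>M)"
    using hb by (intro indep_vars_lebesgue_integral[OF _ ind]) (auto simp: has_bochner_integral_iff)
  also have "\<dots> = complex_of_real (\<Prod>i<m. cos (b i))"
    using hb by (simp add: has_bochner_integral_iff)
  finally have "Re (\<integral>\<omega>. (\<Prod>i<m. cis (\<gamma> i \<omega> * b i)) \<partial>M) = (\<Prod>i<m. cos (b i))"
    by (simp only: Re_complex_of_real)
  then show ?thesis
    using integral_Re[OF int] by (simp add: cisum[symmetric])
qed

text \<open>Signs are sub-Gaussian: Hoeffding's lemma on the interval from -1 to 1 bounds the
  hyperbolic cosine of \<open>x\<close> by \<open>exp (x\<^sup>2 / 2)\<close>, and independence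
  multiplies the factors.\<close>

lemma nn_expectation_exp_sign_sum_le:
  fixes b :: "nat \<Rightarrow> real"
  assumes "\<And>i. \<bar>b i\<bar> \<le> r"
  shows "(\<integral>\<^sup>+\<omega>. ennreal (exp (\<Sum>i<m. \<gamma> i \<omega> * b i)) \<partial>M) \<le> ennreal (exp (m * r\<^sup>2 / 2))"
proof -
  have hb: "has_bochner_integral M (\<lambda>\<omega>. exp (\<gamma> i \<omega> * x)) ((exp x + exp (- x)) / 2)" for i x
    using has_bochner_integral_sign[of "\<lambda>y. exp (y * x)" i] by simp
  interpret sgn: interval_bounded_random_variable M "\<gamma> 0" "-1" 1
    by unfold_locales (use AE_sign[of 0] in \<open>auto elim!: eventually_mono\<close>)
  have E0: "expectation (\<gamma> 0) = 0"
    using has_bochner_integral_sign[of "\<lambda>x. x" 0] by (simp add: has_bochner_integral_iff)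
  have nn: "(\<integral>\<^sup>+\<omega>. ennreal (exp (\<gamma> i \<omega> * x)) \<partial>M) = ennreal ((exp x + exp (- x)) / 2)" for i x
    using hb[of i x] by (subst nn_integral_eq_integral) (auto simp: has_bochner_integral_iff)
  \<comment> \<open>Hoeffding's lemma is applied to positive \<open>x\<close>; the hyperbolic cosine
    is even, which covers the rest.\<close>
  have pos: "ennreal ((exp x + exp (- x)) / 2) \<le> ennreal (exp (x\<^sup>2 / 2))" if "0 < x" for x :: real
    using sgn.Hoeffdings_lemma_nn_integral_0[OF that E0] nn[of 0 x] by (simp add: mult.commute)
  have cosh: "(exp x + exp (- x)) / 2 \<le> exp (r\<^sup>2 / 2)" if "\<bar>x\<bar> \<le> r" for x
  proof -
    have "ennreal ((exp x + exp (- x)) / 2) \<le> ennreal (exp (x\<^sup>2 / 2))"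
      using pos[of x] pos[of "- x"] by (cases x "0::real" rule: linorder_cases) (auto simp: add.commute)
    also have "x\<^sup>2 \<le> r\<^sup>2" using that by (metis abs_le_square_iff abs_ge_self order_trans)
    then have "ennreal (exp (x\<^sup>2 / 2)) \<le> ennreal (exp (r\<^sup>2 / 2))" by (intro ennreal_leI) simp
    finally show ?thesis by (simp add: ennreal_le_iff)
  qed
  have ind: "indep_vars (\<lambda>_. borel) (\<lambda>i \<omega>. ennreal (exp (\<gamma> i \<omega> * b i))) {..<m}"
    by (rule indep_vars_compose2[OF indep_vars_subset[OF indep_sign]]) auto
  have "(\<integral>\<^sup>+\<omega>. ennreal (exp (\<Sum>i<m. \<gamma> i \<omega> * b i)) \<partial>M) = (\<integral>\<^sup>+\<omega>. (\<Prod>i<m. ennreal (exp (\<gamma> i \<omega> * b i))) \<partial>M)"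
    by (simp add: exp_sum prod_ennreal)
  also have "\<dots> = (\<Prod>i<m. \<integral>\<^sup>+\<omega>. ennreal (exp (\<gamma> i \<omega> * b i)) \<partial>M)"
    by (rule indep_vars_nn_integral[OF _ ind]) auto
  also have "\<dots> = ennreal (\<Prod>i<m. (exp (b i) + exp (- b i)) / 2)"
    unfolding nn by (intro prod_ennreal) (simp add: add_nonneg_nonneg)
  also have "\<dots> \<le> ennreal (\<Prod>i<m. exp (r\<^sup>2 / 2))"
    by (intro ennreal_leI prod_mono conjI cosh assms) (simp add: add_nonneg_nonneg)
  also have "(\<Prod>i<m. exp (r\<^sup>2 / 2)) = exp (m * r\<^sup>2 / 2)"
    by (simp add: exp_of_nat_mult[symmetric])
  finally show ?thesis .
qed

text \<open>The signs are integrated out first, then the positions; the positions being identically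
  distributed, all factors become one function of the arrival time.\<close>

lemma expectation_cos_partial_sum:
  assumes [measurable]: "case_prod f \<in> borel_measurable (borel \<Otimes>\<^sub>M borel)"
  shows "(\<integral>\<omega>. cos (\<Sum>i<m. \<gamma> i \<omega> * f (\<Gamma> i \<omega>) (V i \<omega>)) \<partial>M) =
     (\<integral>\<omega>. (\<Prod>i<m. \<integral>\<omega>'. cos (f (\<Gamma> i \<omega>) (V 0 \<omega>')) \<partial>M) \<partial>M)"
proof -
  let ?P = "PiM UNIV (\<lambda>_::nat. borel) :: (nat \<Rightarrow> real) measure"
  have "(\<integral>\<omega>. cos (\<Sum>i<m. \<gamma> i \<omega> * f (\<Gamma> i \<omega>) (V i \<omega>)) \<partial>M) =
     (\<integral>\<omega>. \<integral>\<omega>'. cos (\<Sum>i<m. \<gamma> i \<omega>' * f (\<Gamma> i \<omega>) (V i \<omega>)) \<partial>M \<partial>M)"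
  proof -
    let ?Q = "PiM {0, 1} (\<lambda>_::nat. ?P) \<Otimes>\<^sub>M PiM {2::nat} (\<lambda>_. ?P)"
    have c: "(\<lambda>F. F k i) \<in> borel_measurable (PiM K (\<lambda>_. ?P))" if "k \<in> K" for k i and K :: "nat set"
      using measurable_compose[OF measurable_component_singleton[OF that] measurable_component_singleton[OF UNIV_I]] .
    have [measurable]: "(\<lambda>z. fst z 0 i) \<in> borel_measurable ?Q" "(\<lambda>z. fst z 1 i) \<in> borel_measurable ?Q"
      "(\<lambda>z. snd z 2 i) \<in> borel_measurable ?Q" for i
      by (rule measurable_compose[OF measurable_fst c] measurable_compose[OF measurable_snd c], simp)+
    have "(\<lambda>z. cos (\<Sum>i<m. snd z 2 i * f (fst z 0 i) (fst z 1 i))) \<in> borel_measurable ?Q"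
      by measurable
    from indep_var_integral[OF indep_var_\<Gamma>V_sign this, of 1] show ?thesis by simp
  qed
  also have "\<dots> = (\<integral>\<omega>. (\<Prod>i<m. cos (f (\<Gamma> i \<omega>) (V i \<omega>))) \<partial>M)"
    by (simp add: expectation_cos_sign_sum)
  also have "\<dots> = (\<integral>\<omega>. \<integral>\<omega>'. (\<Prod>i<m. cos (f (\<Gamma> i \<omega>) (V i \<omega>'))) \<partial>M \<partial>M)"
    using indep_var_integral[OF indep_var_\<Gamma>_V,
        of "\<lambda>(x, v). (\<Prod>i<m. cos (f (x i) (v i)))" 1]
    by (simp add: case_prod_beta abs_prod prod_le_1)
  also have "\<dots> = (\<integral>\<omega>. (\<Prod>i<m. \<integral>\<omega>'. cos (f (\<Gamma> i \<omega>) (V i \<omega>')) \<partial>M) \<partial>M)"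
  proof (rule Bochner_Integration.integral_cong[OF refl], rule indep_vars_lebesgue_integral)
    fix \<omega>
    show "indep_vars (\<lambda>_. borel) (\<lambda>i \<omega>'. cos (f (\<Gamma> i \<omega>) (V i \<omega>'))) {..<m}"
      by (rule indep_vars_compose2[OF indep_vars_subset[OF indep_V]]) auto
    show "integrable M (\<lambda>\<omega>'. cos (f (\<Gamma> i \<omega>) (V i \<omega>')))" for i
      by (rule integrable_const_bound[where B=1]) auto
  qed simp
  also have "\<dots> = (\<integral>\<omega>. (\<Prod>i<m. \<integral>\<omega>'. cos (f (\<Gamma> i \<omega>) (V 0 \<omega>')) \<partial>M) \<partial>M)"
  proof -
    have eq: "(\<integral>\<omega>'. cos (f x (V i \<omega>')) \<partial>M) = (\<integral>\<omega>'. cos (f x (V 0 \<omega>')) \<partial>M)" for i x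
      using integral_distr[of "V i" M borel "\<lambda>v. cos (f x v)"] integral_distr[of "V 0" M borel "\<lambda>v. cos (f x v)"]
      by (simp add: distr_V)
    show ?thesis
      by (rule Bochner_Integration.integral_cong[OF refl], rule prod.cong[OF refl], rule eq)
  qed
  finally show ?thesis .
qed

end

subsection \<open>Almost sure convergence of the series\<close>

lemma poisson_pgf:
  fixes z :: real
  assumes "0 < r"
  shows "(\<integral>k. z ^ k \<partial>measure_pmf (poisson_pmf r)) = exp (r * (z - 1))"
    and "integrable (measure_pmf (poisson_pmf r)) (\<lambda>k. z ^ k)"
proof -
  have sums: "(\<lambda>k. pmf (poisson_pmf r) k * z ^ k) sums (exp (r * (z - 1)))" for z :: real
  proof -
    have "(\<lambda>k. exp (- r) * ((r * z) ^ k /\<^sub>R fact k)) sums (exp (- r) * exp (r * z))"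
      by (intro sums_mult exp_converges)
    also have "(\<lambda>k. exp (- r) * ((r * z) ^ k /\<^sub>R fact k)) = (\<lambda>k. pmf (poisson_pmf r) k * z ^ k)"
      using assms by (simp add: fun_eq_iff power_mult_distrib divide_inverse mult_ac)
    also have "exp (- r) * exp (r * z) = exp (r * (z - 1))"
      by (simp add: mult_exp_exp algebra_simps)
    finally show ?thesis .
  qed
  \<comment> \<open>Absolute convergence is the same series at \<open>\<bar>z\<bar>\<close>.\<close>
  have "summable (\<lambda>k. norm (pmf (poisson_pmf r) k * z ^ k))"
    using sums_summable[OF sums[of "\<bar>z\<bar>"]] by (simp add: abs_mult power_abs)
  then have int: "integrable (count_space UNIV) (\<lambda>k. pmf (poisson_pmf r) k *\<^sub>R z ^ k)"
    by (simp add: integrable_count_space_nat_iff)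
  then show "integrable (measure_pmf (poisson_pmf r)) (\<lambda>k. z ^ k)"
    unfolding measure_pmf_eq_density by (subst integrable_density) auto
  show "(\<integral>k. z ^ k \<partial>measure_pmf (poisson_pmf r)) = exp (r * (z - 1))"
    unfolding measure_pmf_eq_density
    using integral_count_space_nat[OF int] sums_unique[OF sums[of z]]
    by (subst integral_density) auto
qed

lemma finite_downward_closed_eq_lessThan:
  fixes A :: "nat set"
  assumes "finite A" "\<And>i j. j \<in> A \<Longrightarrow> i \<le> j \<Longrightarrow> i \<in> A"
  shows "A = {..<card A}"
proof (cases "A = {}")
  case False
  have "A = {..Max A}"
    by (intro equalityI subsetI)
       (simp add: Max_ge[OF assms(1)], rule assms(2)[OF Max_in[OF assms(1) False]], simp)
  then have "A = {..<Suc (Max A)}" by (simp add: lessThan_Suc_atMost)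
  moreover then have "card A = Suc (Max A)" by (metis card_lessThan)
  ultimately show ?thesis by simp
qed simp

lemma summation_by_parts:
  fixes S a :: "nat \<Rightarrow> real"
  shows "(\<Sum>k<n. (S (Suc k) - S k) * a k) = S n * a n - S 0 * a 0 + (\<Sum>k<n. S (Suc k) * (a k - a (Suc k)))"
  by (induction n) (simp_all add: algebra_simps)

text \<open>Concavity of the power \<open>s\<close>, taken from Young's inequality at
  \<open>z = y / x\<close>. It is the discrete counterpart of comparing the integral of
  \<open>v powr (s - 1)\<close> over \<open>{y..x}\<close> with the smallest value of the
  integrand.\<close>

lemma powr_telescope_bound:
  fixes x y s :: real
  assumes "0 < y" "y \<le> x" "0 < s" "s < 1"
  shows "x powr (s - 1) * (x - y) \<le> (x powr s - y powr s) / s"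
proof -
  define z where "z = y / x"
  have z: "0 < z" "y = z * x" "0 < x" using assms by (auto simp: z_def)
  have "z powr s * 1 powr (1 - s) \<le> s * z + (1 - s) * 1"
    using assms z by (intro Youngs_inequality_0) auto
  then have "s * (1 - z) \<le> 1 - z powr s" by (simp add: algebra_simps)
  then have "x powr s * (s * (1 - z)) \<le> x powr s * (1 - z powr s)" by (intro mult_left_mono) auto
  then have "s * (x powr s * (1 - z)) \<le> x powr s - y powr s"
    using z by (simp add: powr_mult algebra_simps)
  moreover have "x powr (s - 1) * (x - y) = x powr s * (1 - z)"
    using z by (simp add: powr_diff right_diff_distrib)
  ultimately show ?thesis using assms by (simp only: pos_le_divide_eq mult.commute)
qed

text \<open>Conditional convergence by summation by parts: with \<open>a = G powr (- b)\<close>, the growth bounds give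
  \<open>real (Suc k) powr p \<le> C * a k powr (- p / b)\<close>, so the summed series is dominated by a telescoping one.\<close>

lemma summable_of_partial_sum_growth:
  fixes \<xi> G :: "nat \<Rightarrow> real" and p b :: real
  assumes pb: "0 < p" "p < b"
    and mono: "mono G" and pos: "\<And>i. 0 < G i"
    and G: "\<forall>\<^sub>F n in sequentially. n / 4 \<le> G n"
    and S: "\<forall>\<^sub>F n in sequentially. \<bar>\<Sum>i<n. \<xi> i\<bar> \<le> n powr p"
  shows "summable (\<lambda>i. \<xi> i * G i powr (- b))"
proof -
  define S where "S n = (\<Sum>i<n. \<xi> i)" for n
  define a where "a n = G n powr (- b)" for n
  have a0: "0 < a n" for n using pos[of n] by (simp add: a_def)
  have adec: "a (Suc n) \<le> a n" for n
    unfolding a_def using pos[of n] pb monoD[OF mono, of n "Suc n"] by (intro powr_mono2') auto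
  obtain N where N: "N \<ge> 1" "\<And>n. n \<ge> N \<Longrightarrow> n / 4 \<le> G n" "\<And>n. n \<ge> N \<Longrightarrow> \<bar>S n\<bar> \<le> n powr p"
  proof -
    have "\<forall>\<^sub>F n in sequentially. n / 4 \<le> G n \<and> \<bar>S n\<bar> \<le> n powr p"
      using G S unfolding S_def by eventually_elim auto
    then obtain N where "\<And>n. n \<ge> N \<Longrightarrow> n / 4 \<le> G n \<and> \<bar>S n\<bar> \<le> n powr p"
      by (auto simp: eventually_sequentially)
    then show ?thesis by (intro that[of "max N 1"]) auto
  qed
  have ale: "a n \<le> (n / 4) powr (- b)" if "n \<ge> N" for n
    unfolding a_def using N(1,2) that pb by (intro powr_mono2') auto
  have lim1: "(\<lambda>n. S n * a n) \<longlonglongrightarrow> 0"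
  proof (rule Lim_null_comparison)
    show "\<forall>\<^sub>F n in sequentially. norm (S n * a n) \<le> 4 powr b * real n powr (p - b)"
      using eventually_ge_at_top[of N]
    proof eventually_elim
      case (elim n)
      have "norm (S n * a n) \<le> n powr p * (n / 4) powr (- b)"
        unfolding real_norm_def abs_mult
        using N(3)[OF elim] ale[OF elim] a0[of n] by (intro mult_mono) auto
      also have "\<dots> = 4 powr b * real n powr (p - b)"
        using elim N(1) by (simp add: powr_divide powr_diff powr_minus field_simps)
      finally show ?case .
    qed
    have "(\<lambda>n. real n powr (p - b)) \<longlonglongrightarrow> 0"
      using pb by (intro tendsto_neg_powr filterlim_real_sequentially) auto
    then show "(\<lambda>n. 4 powr b * real n powr (p - b)) \<longlonglongrightarrow> 0"
      using tendsto_mult_right_zero by blast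
  qed
  \<comment> \<open>Chosen so that the growth factor \<open>a k powr (- p / b)\<close> is
    \<open>a k powr (s - 1)\<close>, the form that telescopes.\<close>
  define s where "s = 1 - p / b"
  have s: "0 < s" "s < 1" using pb by (auto simp: s_def field_simps)
  have "a \<longlonglongrightarrow> 0"
  proof (rule Lim_null_comparison)
    show "\<forall>\<^sub>F n in sequentially. norm (a n) \<le> (real n / 4) powr (- b)"
      using eventually_ge_at_top[of N] by eventually_elim (simp add: ale abs_of_pos[OF a0])
    have "filterlim (\<lambda>n. real n * (1 / 4)) at_top sequentially"
      by (rule filterlim_at_top_mult_tendsto_pos[OF tendsto_const _ filterlim_real_sequentially]) simp
    then show "(\<lambda>n. (real n / 4) powr (- b)) \<longlonglongrightarrow> 0"
      using pb by (intro tendsto_neg_powr) auto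
  qed
  then have "(\<lambda>n. a n powr s) \<longlonglongrightarrow> 0 powr s"
    using s a0 less_imp_le by (intro tendsto_powr') (auto intro!: always_eventually)
  then have "summable (\<lambda>n. a n powr s - a (Suc n) powr s)"
    by (intro telescope_summable') auto
  then have tel: "summable (\<lambda>n. 8 powr p / s * (a n powr s - a (Suc n) powr s))"
    by (rule summable_mult)
  have "summable (\<lambda>k. S (Suc k) * (a k - a (Suc k)))"
  proof (rule summable_comparison_test_ev[OF _ tel])
    show "\<forall>\<^sub>F k in sequentially. norm (S (Suc k) * (a k - a (Suc k))) \<le> 8 powr p / s * (a k powr s - a (Suc k) powr s)"
      using eventually_ge_at_top[of N]
    proof eventually_elim
      case (elim k)
      have k1: "1 \<le> k" using N(1) elim by simp
      \<comment> \<open>\<open>Suc k \<le> 2 * k\<close> for \<open>k \<ge> 1\<close>, and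
        \<open>k \<le> 4 * G k\<close>; this is why \<open>N \<ge> 1\<close> was arranged.\<close>
      have "real (Suc k) \<le> 8 * (a k) powr (- 1 / b)"
      proof -
        have "a k powr (- 1 / b) = G k" using pb pos[of k] by (simp add: a_def powr_powr)
        then show ?thesis using N(2)[OF elim] k1 by simp
      qed
      then have "real (Suc k) powr p \<le> (8 * (a k) powr (- 1 / b)) powr p"
        using pb by (intro powr_mono2) auto
      also have "\<dots> = 8 powr p * a k powr (s - 1)"
        by (simp add: powr_mult powr_powr s_def)
      finally have "\<bar>S (Suc k)\<bar> \<le> 8 powr p * a k powr (s - 1)"
        using N(3)[of "Suc k"] elim by linarith
      then have "norm (S (Suc k) * (a k - a (Suc k))) \<le> (8 powr p * a k powr (s - 1)) * (a k - a (Suc k))"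
        unfolding norm_mult using adec[of k] by (simp add: mult_right_mono)
      also have "\<dots> \<le> 8 powr p * ((a k powr s - a (Suc k) powr s) / s)"
        unfolding mult.assoc by (intro mult_left_mono powr_telescope_bound a0 adec s) simp
      finally show ?case by simp
    qed
  qed
  then have "(\<lambda>n. S n * a n - S 0 * a 0 + (\<Sum>k<n. S (Suc k) * (a k - a (Suc k))))
     \<longlonglongrightarrow> 0 - S 0 * a 0 + (\<Sum>k. S (Suc k) * (a k - a (Suc k)))"
    by (intro tendsto_intros lim1 summable_LIMSEQ)
  then have "(\<lambda>n. \<Sum>k<n. (S (Suc k) - S k) * a k) \<longlonglongrightarrow> 0 - S 0 * a 0 + (\<Sum>k. S (Suc k) * (a k - a (Suc k)))"
    unfolding summation_by_parts .
  then show ?thesis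
    by (auto simp: S_def a_def summable_def sums_def)
qed

text \<open>The logarithm is negligible against any positive power, so the terms are eventually
  below the inverse squares.\<close>

lemma summable_exp_minus_powr:
  assumes "0 < q"
  shows "summable (\<lambda>n. exp (- (real n powr q)))"
proof (rule summable_comparison_test_ev)
  have "\<forall>\<^sub>F n in sequentially. ln (real n) / real n powr q < 1 / 2"
    using lim_ln_over_power[OF assms] by (rule order_tendstoD) simp
  then show "\<forall>\<^sub>F n in sequentially. norm (exp (- (real n powr q))) \<le> inverse (real n ^ 2)"
    using eventually_gt_at_top[of 0]
  proof eventually_elim
    case (elim n)
    then have "ln (real n ^ 2) \<le> real n powr q" by (simp add: field_simps ln_realpow)
    then have "exp (ln (real n ^ 2)) \<le> exp (real n powr q)" by (simp only: exp_le_cancel_iff)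
    then have "real n ^ 2 \<le> exp (real n powr q)" using elim by simp
    then show ?case using elim by (simp add: exp_minus le_imp_inverse_le)
  qed
  show "summable (\<lambda>n. inverse (real n ^ 2))" by (intro inverse_power_summable) simp
qed

context lepage_series
begin

section \<open>The counting process and almost sure growth bounds\<close>

definition arrival_count :: "real \<Rightarrow> 'a \<Rightarrow> nat" where
  "arrival_count t \<omega> = card {i. \<Gamma> i \<omega> \<le> t}"

definition regular_arrivals :: "'a \<Rightarrow> bool" where
  "regular_arrivals \<omega> \<longleftrightarrow> 0 < \<Gamma> 0 \<omega> \<and> mono (\<lambda>i. \<Gamma> i \<omega>) \<and> (\<forall>t. finite {i. \<Gamma> i \<omega> \<le> t})"

lemma AE_regular_arrivals: "AE \<omega> in M. regular_arrivals \<omega>"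
  using arrival_times by (simp add: poisson_arrival_times_def regular_arrivals_def)

lemma \<Gamma>_pos: "regular_arrivals \<omega> \<Longrightarrow> 0 < \<Gamma> i \<omega>"
  unfolding regular_arrivals_def by (meson le0 monoD order_less_le_trans)

text \<open>The dictionary between counts and times: by monotonicity the arrivals up to
  \<open>t\<close> occupy an initial segment of the indices. The left inequality is strict because
  numbering starts at 0.\<close>

lemma less_arrival_count_iff:
  assumes "regular_arrivals \<omega>"
  shows "i < arrival_count t \<omega> \<longleftrightarrow> \<Gamma> i \<omega> \<le> t"
proof -
  have "{i. \<Gamma> i \<omega> \<le> t} = {..<arrival_count t \<omega>}"
    unfolding arrival_count_def
    using assms by (intro finite_downward_closed_eq_lessThan)
      (auto simp: regular_arrivals_def intro: order_trans dest: monoD)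
  then show ?thesis by blast
qed

lemma arrival_count_0: "regular_arrivals \<omega> \<Longrightarrow> arrival_count 0 \<omega> = 0"
  using less_arrival_count_iff[of \<omega> 0 0] \<Gamma>_pos[of \<omega> 0] by auto

lemma arrival_count_mono: "regular_arrivals \<omega> \<Longrightarrow> s \<le> t \<Longrightarrow> arrival_count s \<omega> \<le> arrival_count t \<omega>"
  by (meson less_arrival_count_iff linorder_not_less order_trans order_refl)

lemma filterlim_arrival_count:
  assumes "regular_arrivals \<omega>"
  shows "filterlim (\<lambda>n. arrival_count (real n) \<omega>) at_top sequentially"
  unfolding filterlim_at_top
proof
  fix m
  have "\<forall>\<^sub>F n in sequentially. \<Gamma> m \<omega> \<le> real n"
    using filterlim_real_sequentially by (auto simp: filterlim_at_top)
  then show "\<forall>\<^sub>F n in sequentially. m \<le> arrival_count (real n) \<omega>"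
    by eventually_elim (use less_arrival_count_iff[OF assms] less_imp_le in blast)
qed

lemma poisson_arrival_count: "poisson_process M 1 arrival_count"
  using arrival_times unfolding poisson_arrival_times_def arrival_count_def[abs_def] by simp

lemma arrival_count_measurable: "0 \<le> t \<Longrightarrow> arrival_count t \<in> measurable M (count_space UNIV)"
  using poisson_arrival_count by (simp add: poisson_process_def)

lemma expectation_power_increment:
  fixes z :: real
  assumes "0 \<le> s" "s < t"
  shows "(\<integral>\<omega>. z ^ (arrival_count t \<omega> - arrival_count s \<omega>) \<partial>M) = exp ((t - s) * (z - 1))"
    and "integrable M (\<lambda>\<omega>. z ^ (arrival_count t \<omega> - arrival_count s \<omega>))"
proof -
  have d: "distr M (count_space UNIV) (\<lambda>\<omega>. arrival_count t \<omega> - arrival_count s \<omega>) = measure_pmf (poisson_pmf (t - s))"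
    using poisson_arrival_count assms by (simp add: poisson_process_def)
  have [measurable]: "arrival_count t \<in> measurable M (count_space UNIV)" "arrival_count s \<in> measurable M (count_space UNIV)"
    using assms by (auto intro: arrival_count_measurable)
  have [measurable]: "(\<lambda>\<omega>. arrival_count t \<omega> - arrival_count s \<omega>) \<in> measurable M (count_space UNIV)"
    by measurable
  show "(\<integral>\<omega>. z ^ (arrival_count t \<omega> - arrival_count s \<omega>) \<partial>M) = exp ((t - s) * (z - 1))"
    using integral_distr[of "\<lambda>\<omega>. arrival_count t \<omega> - arrival_count s \<omega>" M "count_space UNIV" "\<lambda>k. z ^ k"]
      poisson_pgf(1)[of "t - s" z] assms unfolding d by simp
  show "integrable M (\<lambda>\<omega>. z ^ (arrival_count t \<omega> - arrival_count s \<omega>))"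
    using integrable_distr_eq[of "\<lambda>\<omega>. arrival_count t \<omega> - arrival_count s \<omega>" M "count_space UNIV" "\<lambda>k. z ^ k"]
      poisson_pgf(2)[of "t - s" z] assms unfolding d by simp
qed

text \<open>An exponential Markov bound. With \<open>t = real (Suc n) / 4\<close> the Poisson law
  gives \<open>exp (t * (exp 1 - 1))\<close> for the expectation of \<open>exp\<close> of the count;
  as \<open>exp 1 - 1 \<le> 2\<close>, this is at most \<open>exp (real (Suc n) / 2)\<close>, and
  the slope 1/4 leaves a geometric tail.\<close>

lemma AE_\<Gamma>_growth: "AE \<omega> in M. \<forall>\<^sub>F n in sequentially. real n / 4 \<le> \<Gamma> n \<omega>"
proof -
  \<comment> \<open>\<open>Suc n\<close> instead of \<open>n\<close> keeps the time positive, as the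
    Poisson law of an increment requires; the shift is undone at the end.\<close>
  let ?X = "\<lambda>n \<omega>. real (arrival_count (real (Suc n) / 4) \<omega>) - real (Suc n)"
  have "AE \<omega> in M. \<forall>\<^sub>F n in sequentially. ?X n \<omega> \<le> 0"
  proof (rule AE_eventually_nonpos_of_exp_summable[where c="\<lambda>n. exp (- real (Suc n) / 2)"])
    fix n
    define t where "t = real (Suc n) / 4"
    have t: "0 < t" by (simp add: t_def)
    have [measurable]: "arrival_count t \<in> measurable M (count_space UNIV)"
      using t by (intro arrival_count_measurable) simp
    show "?X n \<in> borel_measurable M"
      unfolding t_def[symmetric] by measurable
    have "(\<integral>\<^sup>+\<omega>. ennreal (exp (?X n \<omega>)) \<partial>M) =
       (\<integral>\<^sup>+\<omega>. ennreal (exp (- real (Suc n))) * ennreal (exp 1 ^ (arrival_count t \<omega> - arrival_count 0 \<omega>)) \<partial>M)"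
      using AE_regular_arrivals
      by (intro nn_integral_cong_AE)
         (auto elim!: eventually_mono simp: arrival_count_0 t_def exp_of_nat_mult[symmetric] ennreal_mult'[symmetric] mult_exp_exp)
    also have "\<dots> = ennreal (exp (- real (Suc n))) * ennreal (exp ((t - 0) * (exp 1 - 1)))"
      using expectation_power_increment[of 0 t "exp 1"] t arrival_count_measurable[of 0]
      by (subst nn_integral_cmult) (auto simp: nn_integral_eq_integral)
    also have "\<dots> = ennreal (exp (t * (exp 1 - 1) - real (Suc n)))"
      by (simp add: ennreal_mult'[symmetric] mult_exp_exp)
    also have "\<dots> \<le> ennreal (exp (- real (Suc n) / 2))"
    proof (intro ennreal_leI)
      have "t * (exp 1 - 1) \<le> t * 2" using exp_le t by (intro mult_left_mono) auto
      then show "exp (t * (exp 1 - 1) - real (Suc n)) \<le> exp (- real (Suc n) / 2)"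
        by (simp add: t_def field_simps)
    qed
    finally show "(\<integral>\<^sup>+\<omega>. ennreal (exp (?X n \<omega>)) \<partial>M) \<le> ennreal (exp (- real (Suc n) / 2))" .
  next
    have "summable (\<lambda>n. exp (- 1 / 2 :: real) ^ n)" by (rule summable_geometric) simp
    then have "summable (\<lambda>n. exp (- 1 / 2 :: real) ^ Suc n)" by (rule summable_ignore_initial_segment[where k=1, simplified])
    moreover have "exp (- 1 / 2 :: real) ^ k = exp (- real k / 2)" for k
      by (simp add: exp_of_nat_mult[symmetric])
    ultimately show "summable (\<lambda>n. exp (- real (Suc n) / 2))" by (simp only:)
  qed simp
  then show ?thesis using AE_regular_arrivals
  proof eventually_elim
    case (elim \<omega>)
    from elim(1) have "\<forall>\<^sub>F n in sequentially. real (Suc n) / 4 \<le> \<Gamma> (Suc n) \<omega>"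
    proof eventually_elim
      case (elim n)
      then have "\<not> Suc n < arrival_count (real (Suc n) / 4) \<omega>" by linarith
      then show ?case using less_arrival_count_iff[OF \<open>regular_arrivals \<omega>\<close>] by (meson linear)
    qed
    then show ?case by (rule eventually_sequentially_Suc[THEN iffD1])
  qed
qed

text \<open>After division by \<open>sqrt (real n)\<close> the exponential moment is at most
  \<open>exp (1 / 2)\<close> for every \<open>n\<close>, so exceeding
  \<open>real n powr (p - 1 / 2)\<close> has summable probability.\<close>

lemma AE_sign_sum_le:
  fixes b :: "real \<Rightarrow> real"
  assumes p: "1 / 2 < p" and [measurable]: "b \<in> borel_measurable borel" and b: "\<And>v. \<bar>b v\<bar> \<le> 1"
  shows "AE \<omega> in M. \<forall>\<^sub>F n in sequentially. (\<Sum>i<n. \<gamma> i \<omega> * b (V i \<omega>)) \<le> real n powr p"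
proof -
  define q where "q = p - 1 / 2"
  have q: "0 < q" using p by (simp add: q_def)
  let ?X = "\<lambda>n \<omega>. (\<Sum>i<n. \<gamma> i \<omega> * (b (V i \<omega>) / sqrt (real n))) - real n powr q"
  have "AE \<omega> in M. \<forall>\<^sub>F n in sequentially. ?X n \<omega> \<le> 0"
  proof (rule AE_eventually_nonpos_of_exp_summable[where c="\<lambda>n. exp (1 / 2) * exp (- (real n powr q))"])
    fix n
    show "?X n \<in> borel_measurable M" by measurable
    have X: "(\<integral>\<^sup>+\<omega>. ennreal (exp (?X n \<omega>)) \<partial>M) =
      ennreal (exp (- (real n powr q))) * (\<integral>\<^sup>+\<omega>. ennreal (exp (\<Sum>i<n. \<gamma> i \<omega> * (b (V i \<omega>) / sqrt (real n)))) \<partial>M)"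
      by (subst nn_integral_cmult[symmetric]) (auto simp: ennreal_mult'[symmetric] mult_exp_exp)
    have "(\<integral>\<^sup>+\<omega>. ennreal (exp (\<Sum>i<n. \<gamma> i \<omega> * (b (V i \<omega>) / sqrt (real n)))) \<partial>M) =
       (\<integral>\<^sup>+\<omega>. \<integral>\<^sup>+\<omega>'. ennreal (exp (\<Sum>i<n. \<gamma> i \<omega>' * (b (V i \<omega>) / sqrt (real n)))) \<partial>M \<partial>M)"
      using indep_var_nn_integral[OF indep_var_V_sign,
        of "\<lambda>z. ennreal (exp (\<Sum>i<n. snd z i * (b (fst z i) / sqrt (real n))))"] by simp
    also have "\<dots> \<le> (\<integral>\<^sup>+\<omega>. ennreal (exp (1 / 2)) \<partial>M)"
    proof (rule nn_integral_mono)
      fix \<omega>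
      have "(\<integral>\<^sup>+\<omega>'. ennreal (exp (\<Sum>i<n. \<gamma> i \<omega>' * (b (V i \<omega>) / sqrt (real n)))) \<partial>M) \<le> ennreal (exp (real n * (1 / sqrt (real n))\<^sup>2 / 2))"
        by (rule nn_expectation_exp_sign_sum_le) (simp add: b divide_right_mono)
      also have "\<dots> \<le> ennreal (exp (1 / 2))" by (intro ennreal_leI) (simp add: power_divide)
      finally show "(\<integral>\<^sup>+\<omega>'. ennreal (exp (\<Sum>i<n. \<gamma> i \<omega>' * (b (V i \<omega>) / sqrt (real n)))) \<partial>M) \<le> ennreal (exp (1 / 2))" .
    qed
    also have "\<dots> = ennreal (exp (1 / 2))" by (simp add: emeasure_space_1)
    finally have "(\<integral>\<^sup>+\<omega>. ennreal (exp (?X n \<omega>)) \<partial>M) \<le> ennreal (exp (- (real n powr q))) * ennreal (exp (1 / 2))"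
      unfolding X by (rule mult_left_mono) simp
    then show "(\<integral>\<^sup>+\<omega>. ennreal (exp (?X n \<omega>)) \<partial>M) \<le> ennreal (exp (1 / 2) * exp (- (real n powr q)))"
      by (simp add: ennreal_mult' mult.commute)
  next
    show "summable (\<lambda>n. exp (1 / 2) * exp (- (real n powr q)))"
      by (intro summable_mult summable_exp_minus_powr q)
  qed simp
  then show ?thesis
  proof eventually_elim
    case (elim \<omega>)
    then show ?case using eventually_gt_at_top[of 0]
    proof eventually_elim
      case (elim n)
      have "(\<Sum>i<n. \<gamma> i \<omega> * b (V i \<omega>)) / sqrt (real n) \<le> real n powr q"
        using elim by (simp add: sum_divide_distrib)
      then have "(\<Sum>i<n. \<gamma> i \<omega> * b (V i \<omega>)) \<le> real n powr q * sqrt (real n)"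
        using elim by (simp add: pos_divide_le_eq)
      also have "\<dots> = real n powr p"
        using elim by (simp add: powr_half_sqrt[symmetric] powr_add[symmetric] q_def)
      finally show ?case .
    qed
  qed
qed

text \<open>Sign sums grow more slowly than \<open>n powr p\<close> for every
  \<open>p > 1 / 2\<close>, so any decay exponent \<open>e > 1 / 2\<close> leaves room for
  \<open>p\<close> between them. The two-sided bound comes from \<open>b\<close> and its
  negative.\<close>

lemma AE_summable_lepage:
  fixes b :: "real \<Rightarrow> real"
  assumes e: "1 / 2 < e" and [measurable]: "b \<in> borel_measurable borel" and b: "\<And>v. \<bar>b v\<bar> \<le> 1"
  shows "AE \<omega> in M. summable (\<lambda>i. \<gamma> i \<omega> * b (V i \<omega>) * \<Gamma> i \<omega> powr (- e))"
proof -
  define p where "p = (1 / 2 + e) / 2"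
  have p: "1 / 2 < p" "p < e" using e by (auto simp: p_def)
  have "AE \<omega> in M. \<forall>\<^sub>F n in sequentially. (\<Sum>i<n. \<gamma> i \<omega> * b (V i \<omega>)) \<le> real n powr p"
    by (rule AE_sign_sum_le) (use p b in auto)
  moreover have "AE \<omega> in M. \<forall>\<^sub>F n in sequentially. (\<Sum>i<n. \<gamma> i \<omega> * (- b (V i \<omega>))) \<le> real n powr p"
    by (rule AE_sign_sum_le) (use p b in auto)
  ultimately show ?thesis using AE_\<Gamma>_growth AE_regular_arrivals
  proof eventually_elim
    case (elim \<omega>)
    have "\<forall>\<^sub>F n in sequentially. \<bar>\<Sum>i<n. \<gamma> i \<omega> * b (V i \<omega>)\<bar> \<le> real n powr p"
      using elim(1,2) by eventually_elim (auto simp: sum_negf)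
    then show ?case
      using p elim \<Gamma>_pos[OF elim(4)]
      by (intro summable_of_partial_sum_growth[where p=p]) (auto simp: regular_arrivals_def)
  qed
qed

end

subsection \<open>The exponential formula for the arrival times\<close>

lemma set_integrable_bounded:
  fixes f :: "real \<Rightarrow> real"
  assumes [measurable]: "f \<in> borel_measurable borel" and "\<And>x. \<bar>f x\<bar> \<le> B"
  shows "set_integrable lborel {a<..b} f"
proof (rule set_integrable_bound[where f="\<lambda>_. B"])
  show "set_integrable lborel {a<..b} (\<lambda>_. B)"
    unfolding set_integrable_def by (cases "a \<le> b") auto
  show "AE x in lborel. x \<in> {a<..b} \<longrightarrow> norm (f x) \<le> norm B"
    using assms(2) by (intro AE_I2) (auto intro: order_trans abs_ge_self)
qed (auto simp: set_borel_measurable_def)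

context lepage_series
begin

text \<open>The exponential formula for a step function on the grid of mesh \<open>T / m\<close> only involves the
  independent increments of the counting process.\<close>

lemma expectation_prod_arrivals_step:
  fixes g :: "real \<Rightarrow> real" and m :: nat and T :: real
  assumes T: "0 < T" and m: "0 < m" and [measurable]: "g \<in> borel_measurable borel" and g: "\<And>x. \<bar>g x\<bar> \<le> 1"
  defines "s \<equiv> \<lambda>x :: real. g (T * \<lceil>m * x / T\<rceil> / m)"
  shows "(\<integral>\<omega>. (\<Prod>i<arrival_count T \<omega>. s (\<Gamma> i \<omega>)) \<partial>M) = exp (- (LINT x:{0<..T}|lborel. 1 - s x))"
proof -
  define \<tau> where "\<tau> k = T * real k / real m" for k
  have \<tau>: "\<tau> k < \<tau> (Suc k)" "0 \<le> \<tau> k" "\<tau> 0 = 0" "\<tau> m = T" "\<tau> (Suc k) - \<tau> k = T / m" for k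
    using T m by (auto simp: \<tau>_def divide_simps algebra_simps)
  have [measurable]: "s \<in> borel_measurable borel" unfolding s_def by measurable
  have s_bound: "\<bar>1 - s x\<bar> \<le> 2" for x using g[of "T * \<lceil>m * x / T\<rceil> / m"] by (auto simp: s_def)
  \<comment> \<open>The ceiling selects the right endpoint, and the cells are open on the left and
    closed on the right, exactly as \<open>\<Gamma> i \<omega> \<le> t\<close> splits the
    arrivals.\<close>
  have step: "s x = g (\<tau> (Suc k))" if "\<tau> k < x" "x \<le> \<tau> (Suc k)" for x k
  proof -
    have "real k < m * x / T" "m * x / T \<le> real (Suc k)"
      using that T m by (auto simp: \<tau>_def field_simps)
    then have "\<lceil>m * x / T\<rceil> = int (Suc k)" by (intro ceiling_unique) auto
    then show ?thesis by (simp add: s_def \<tau>_def)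
  qed
  have integral_step: "(LINT x:{0<..\<tau> k}|lborel. 1 - s x) = (\<Sum>j<k. (T / m) * (1 - g (\<tau> (Suc j))))" for k
  proof (induction k)
    case (Suc k)
    have "{0<..\<tau> (Suc k)} = {0<..\<tau> k} \<union> {\<tau> k<..\<tau> (Suc k)}"
      using \<tau>(1,2)[of k] by auto
    then have "(LINT x:{0<..\<tau> (Suc k)}|lborel. 1 - s x) =
      (LINT x:{0<..\<tau> k}|lborel. 1 - s x) + (LINT x:{\<tau> k<..\<tau> (Suc k)}|lborel. 1 - s x)"
      using s_bound by (simp only:) (intro set_integral_Un set_integrable_bounded[where B=2], auto)
    also have "(LINT x:{\<tau> k<..\<tau> (Suc k)}|lborel. 1 - s x) = (LINT x:{\<tau> k<..\<tau> (Suc k)}|lborel. 1 - g (\<tau> (Suc k)))"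
      by (rule set_lebesgue_integral_cong) (auto simp: step)
    also have "\<dots> = (\<tau> (Suc k) - \<tau> k) * (1 - g (\<tau> (Suc k)))"
      using \<tau>(1)[of k] by (simp add: set_lebesgue_integral_def)
    finally show ?case by (simp add: Suc.IH \<tau>(5))
  qed (simp add: \<tau>(3) set_lebesgue_integral_def)
  have prod_step: "(\<Prod>i<arrival_count (\<tau> k) \<omega>. s (\<Gamma> i \<omega>)) =
      (\<Prod>j<k. g (\<tau> (Suc j)) ^ (arrival_count (\<tau> (Suc j)) \<omega> - arrival_count (\<tau> j) \<omega>))"
    if \<omega>: "regular_arrivals \<omega>" for k \<omega>
  proof (induction k)
    case 0
    then show ?case by (simp add: \<tau>(3) arrival_count_0[OF \<omega>])
  next
    case (Suc k)
    let ?A = "arrival_count (\<tau> k) \<omega>" and ?B = "arrival_count (\<tau> (Suc k)) \<omega>"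
    have "?A \<le> ?B" using \<tau>(1)[of k] by (intro arrival_count_mono[OF \<omega>]) simp
    then have "(\<Prod>i<?B. s (\<Gamma> i \<omega>)) = (\<Prod>i<?A. s (\<Gamma> i \<omega>)) * (\<Prod>i\<in>{?A..<?B}. s (\<Gamma> i \<omega>))"
      unfolding lessThan_atLeast0 by (intro prod.atLeastLessThan_concat[symmetric]) simp_all
    also have "(\<Prod>i\<in>{?A..<?B}. s (\<Gamma> i \<omega>)) = (\<Prod>i\<in>{?A..<?B}. g (\<tau> (Suc k)))"
    proof (rule prod.cong[OF refl])
      fix i assume "i \<in> {?A..<?B}"
      then have "\<not> i < ?A" "i < ?B" by auto
      then show "s (\<Gamma> i \<omega>) = g (\<tau> (Suc k))"
        by (intro step) (auto simp: less_arrival_count_iff[OF \<omega>])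
    qed
    finally show ?case by (simp add: Suc.IH)
  qed
  have ind: "indep_vars (\<lambda>_. count_space UNIV)
      (\<lambda>k \<omega>. arrival_count (\<tau> (Suc k)) \<omega> - arrival_count (\<tau> k) \<omega>) {..<m}"
    using poisson_arrival_count \<tau>(1,2) unfolding poisson_process_def by blast
  have ind': "indep_vars (\<lambda>_. borel)
      (\<lambda>k \<omega>. g (\<tau> (Suc k)) ^ (arrival_count (\<tau> (Suc k)) \<omega> - arrival_count (\<tau> k) \<omega>)) {..<m}"
    by (rule indep_vars_compose2[OF ind]) simp
  have "(\<integral>\<omega>. (\<Prod>i<arrival_count T \<omega>. s (\<Gamma> i \<omega>)) \<partial>M) =
     (\<integral>\<omega>. (\<Prod>j<m. g (\<tau> (Suc j)) ^ (arrival_count (\<tau> (Suc j)) \<omega> - arrival_count (\<tau> j) \<omega>)) \<partial>M)"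
  proof (rule integral_cong_AE)
    have [measurable]: "arrival_count T \<in> measurable M (count_space UNIV)"
      using T by (intro arrival_count_measurable) simp
    show "(\<lambda>\<omega>. \<Prod>i<arrival_count T \<omega>. s (\<Gamma> i \<omega>)) \<in> borel_measurable M"
      by (rule measurable_compose_countable[where f="\<lambda>n \<omega>. \<Prod>i<n. s (\<Gamma> i \<omega>)"]) measurable
    show "(\<lambda>\<omega>. \<Prod>j<m. g (\<tau> (Suc j)) ^ (arrival_count (\<tau> (Suc j)) \<omega> - arrival_count (\<tau> j) \<omega>)) \<in> borel_measurable M"
      using ind' by (intro borel_measurable_prod) (auto simp: indep_vars_def)
    show "AE \<omega> in M. (\<Prod>i<arrival_count T \<omega>. s (\<Gamma> i \<omega>)) =
      (\<Prod>j<m. g (\<tau> (Suc j)) ^ (arrival_count (\<tau> (Suc j)) \<omega> - arrival_count (\<tau> j) \<omega>))"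
      using AE_regular_arrivals by eventually_elim (use prod_step[of _ m] \<tau>(4) in simp)
  qed
  also have "\<dots> = (\<Prod>j<m. exp ((\<tau> (Suc j) - \<tau> j) * (g (\<tau> (Suc j)) - 1)))"
    using expectation_power_increment[OF \<tau>(2,1)]
    by (subst indep_vars_lebesgue_integral[OF _ ind']) auto
  also have "\<dots> = exp (\<Sum>j<m. (T / m) * (g (\<tau> (Suc j)) - 1))"
    by (simp add: exp_sum \<tau>(5))
  also have "(\<Sum>j<m. (T / m) * (g (\<tau> (Suc j)) - 1)) = - (LINT x:{0<..T}|lborel. 1 - s x)"
    using integral_step[of m] by (simp add: \<tau>(4) sum_negf[symmetric] algebra_simps)
  finally show ?thesis .
qed

text \<open>Step functions on ever finer grids converge to \<open>g\<close> by continuity, and both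
  sides pass to the limit by dominated convergence. Continuity is asked only on
  \<open>{0<..}\<close> because the kernels are singular at 0 and arrival times are
  positive.\<close>

lemma expectation_prod_arrivals:
  fixes g :: "real \<Rightarrow> real" and T :: real
  assumes T: "0 < T" and [measurable]: "g \<in> borel_measurable borel" and g: "\<And>x. \<bar>g x\<bar> \<le> 1"
    and cont: "continuous_on {0<..} g"
  shows "(\<integral>\<omega>. (\<Prod>i<arrival_count T \<omega>. g (\<Gamma> i \<omega>)) \<partial>M) = exp (- (LINT x:{0<..T}|lborel. 1 - g x))"
proof -
  define s where "s n x = g (T * \<lceil>Suc n * x / T\<rceil> / Suc n)" for n :: nat and x :: real
  have [measurable]: "s n \<in> borel_measurable borel" for n unfolding s_def[abs_def] by measurable
  have s_bound: "\<bar>s n x\<bar> \<le> 1" for n x by (simp add: s_def g)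
  have s_lim: "(\<lambda>n. s n x) \<longlonglongrightarrow> g x" if x: "0 < x" for x
  proof -
    have "(\<lambda>n. T * \<lceil>Suc n * x / T\<rceil> / Suc n) \<longlonglongrightarrow> x"
    proof (rule tendsto_sandwich[OF _ _ tendsto_const])
      show "\<forall>\<^sub>F n in sequentially. x \<le> T * \<lceil>Suc n * x / T\<rceil> / Suc n"
      proof (intro always_eventually allI)
        fix n
        have "T * (Suc n * x / T) \<le> T * \<lceil>Suc n * x / T\<rceil>"
          using T by (intro mult_left_mono le_of_int_ceiling) simp
        then have "x * Suc n \<le> T * \<lceil>Suc n * x / T\<rceil>" using T by (simp add: mult.commute)
        then show "x \<le> T * \<lceil>Suc n * x / T\<rceil> / Suc n" by (subst pos_le_divide_eq) auto
      qed
      show "\<forall>\<^sub>F n in sequentially. T * \<lceil>Suc n * x / T\<rceil> / Suc n \<le> x + T * inverse (real (Suc n))"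
      proof (intro always_eventually allI)
        fix n
        have "real_of_int \<lceil>Suc n * x / T\<rceil> \<le> Suc n * x / T + 1" by (rule of_int_ceiling_le_add_one)
        then have "T * \<lceil>Suc n * x / T\<rceil> \<le> T * (Suc n * x / T + 1)" using T by (intro mult_left_mono) auto
        then have "T * \<lceil>Suc n * x / T\<rceil> / Suc n \<le> T * (Suc n * x / T + 1) / Suc n" by (intro divide_right_mono) auto
        also have "\<dots> = x + T * inverse (real (Suc n))" using T by (simp add: field_simps del: of_nat_Suc)
        finally show "T * \<lceil>Suc n * x / T\<rceil> / Suc n \<le> x + T * inverse (real (Suc n))" .
      qed
      have "(\<lambda>n. x + T * inverse (real (Suc n))) \<longlonglongrightarrow> x + T * 0"
        by (intro tendsto_intros LIMSEQ_inverse_real_of_nat)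
      then show "(\<lambda>n. x + T * inverse (real (Suc n))) \<longlonglongrightarrow> x" by simp
    qed
    moreover have "isCont g x"
      using cont x by (simp add: continuous_on_eq_continuous_at)
    ultimately show ?thesis unfolding s_def by (intro isCont_tendsto_compose[of x g])
  qed
  have [measurable]: "arrival_count T \<in> measurable M (count_space UNIV)"
    using T by (intro arrival_count_measurable) simp
  have meas: "(\<lambda>\<omega>. \<Prod>i<arrival_count T \<omega>. h (\<Gamma> i \<omega>)) \<in> borel_measurable M"
    if [measurable]: "h \<in> borel_measurable borel" for h :: "real \<Rightarrow> real"
    by (rule measurable_compose_countable[where f="\<lambda>n \<omega>. \<Prod>i<n. h (\<Gamma> i \<omega>)"]) measurable
  have lim: "(\<lambda>n. \<integral>\<omega>. (\<Prod>i<arrival_count T \<omega>. s n (\<Gamma> i \<omega>)) \<partial>M) \<longlonglongrightarrow> (\<integral>\<omega>. (\<Prod>i<arrival_count T \<omega>. g (\<Gamma> i \<omega>)) \<partial>M)"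
  proof (rule integral_dominated_convergence[where w="\<lambda>_. 1"])
    show "AE \<omega> in M. (\<lambda>n. \<Prod>i<arrival_count T \<omega>. s n (\<Gamma> i \<omega>)) \<longlonglongrightarrow> (\<Prod>i<arrival_count T \<omega>. g (\<Gamma> i \<omega>))"
      using AE_regular_arrivals by eventually_elim (intro tendsto_prod s_lim \<Gamma>_pos)
    show "AE \<omega> in M. norm (\<Prod>i<arrival_count T \<omega>. s n (\<Gamma> i \<omega>)) \<le> 1" for n
      using s_bound by (intro AE_I2) (auto simp: abs_prod intro!: prod_le_1)
  qed (auto intro!: meas)
  have eq: "(\<lambda>n. \<integral>\<omega>. (\<Prod>i<arrival_count T \<omega>. s n (\<Gamma> i \<omega>)) \<partial>M) = (\<lambda>n. exp (- (LINT x:{0<..T}|lborel. 1 - s n x)))"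
    unfolding s_def by (intro ext expectation_prod_arrivals_step T g) auto
  have "(\<lambda>n. exp (- (LINT x:{0<..T}|lborel. 1 - s n x))) \<longlonglongrightarrow> exp (- (LINT x:{0<..T}|lborel. 1 - g x))"
    unfolding set_lebesgue_integral_def
  proof (intro tendsto_exp tendsto_minus integral_dominated_convergence[where w="\<lambda>x. indicator {0<..T} x *\<^sub>R 2"])
    show "integrable lborel (\<lambda>x. indicator {0<..T} x *\<^sub>R (2::real))"
      using set_integrable_bounded[of "\<lambda>_. 2" 2 0 T] by (simp add: set_integrable_def)
    show "AE x in lborel. (\<lambda>n. indicator {0<..T} x *\<^sub>R (1 - s n x)) \<longlonglongrightarrow> indicator {0<..T} x *\<^sub>R (1 - g x)"
      by (intro AE_I2) (auto simp: indicator_def intro!: tendsto_intros s_lim)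
    show "AE x in lborel. norm (indicator {0<..T} x *\<^sub>R (1 - s n x)) \<le> indicator {0<..T} x *\<^sub>R 2" for n
    proof (intro AE_I2)
      fix x
      have "\<bar>1 - s n x\<bar> \<le> 2" using s_bound[of n x] by linarith
      then show "norm (indicator {0<..T} x *\<^sub>R (1 - s n x)) \<le> indicator {0<..T} x *\<^sub>R 2"
        by (simp add: indicator_def)
    qed
  qed measurable
  then show ?thesis by (rule LIMSEQ_unique[OF lim[unfolded eq]])
qed

end

subsection \<open>Moments of the increments\<close>

text \<open>Tonelli applied to the cosine formula for the power; it needs no prior information on
  the moment.\<close>

lemma (in prob_space) abs_moment_eq_LINT:
  assumes \<eta>: "0 < \<eta>" "\<eta> < 2" and [measurable]: "Y \<in> borel_measurable M"
  shows "(\<integral>\<omega>. \<bar>Y \<omega>\<bar> powr \<eta> \<partial>M) =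
    (LINT u:{0<..}|lborel. (1 - (\<integral>\<omega>. cos (u * Y \<omega>) \<partial>M)) * u powr (- \<eta> - 1)) / cos_const \<eta>"
proof -
  interpret P: pair_sigma_finite lborel M
    by (intro pair_sigma_finite.intro lborel.sigma_finite_measure_axioms sigma_finite_measure_axioms)
  have int: "integrable M (\<lambda>\<omega>. cos (u * Y \<omega>))" for u
    by (rule integrable_const_bound[where B=1]) auto
  have le1: "(\<integral>\<omega>. cos (u * Y \<omega>) \<partial>M) \<le> 1" for u
    using integral_mono[OF int[of u], of "\<lambda>_. 1"] by (simp add: prob_space)
  have "(\<integral>\<^sup>+\<omega>. ennreal (\<bar>Y \<omega>\<bar> powr \<eta> * cos_const \<eta>) \<partial>M) =
    (\<integral>\<^sup>+\<omega>. \<integral>\<^sup>+u. ennreal (indicator {0<..} u * ((1 - cos (u * Y \<omega>)) * u powr (- \<eta> - 1))) \<partial>lborel \<partial>M)"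
    by (simp add: nn_integral_one_minus_cos[OF \<eta>])
  also have "\<dots> = (\<integral>\<^sup>+u. \<integral>\<^sup>+\<omega>. ennreal (indicator {0<..} u * ((1 - cos (u * Y \<omega>)) * u powr (- \<eta> - 1))) \<partial>M \<partial>lborel)"
    by (rule P.Fubini') measurable
  also have "\<dots> = (\<integral>\<^sup>+u. ennreal (indicator {0<..} u * ((1 - (\<integral>\<omega>. cos (u * Y \<omega>) \<partial>M)) * u powr (- \<eta> - 1))) \<partial>lborel)"
  proof (rule nn_integral_cong)
    fix u :: real
    have i: "integrable M (\<lambda>\<omega>. indicator {0<..} u * ((1 - cos (u * Y \<omega>)) * u powr (- \<eta> - 1)))"
      using int[of u] by simp
    have "(\<integral>\<^sup>+\<omega>. ennreal (indicator {0<..} u * ((1 - cos (u * Y \<omega>)) * u powr (- \<eta> - 1))) \<partial>M) =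
        ennreal (\<integral>\<omega>. indicator {0<..} u * ((1 - cos (u * Y \<omega>)) * u powr (- \<eta> - 1)) \<partial>M)"
      by (rule nn_integral_eq_integral[OF i]) auto
    also have "(\<integral>\<omega>. indicator {0<..} u * ((1 - cos (u * Y \<omega>)) * u powr (- \<eta> - 1)) \<partial>M) =
        indicator {0<..} u * ((1 - (\<integral>\<omega>. cos (u * Y \<omega>) \<partial>M)) * u powr (- \<eta> - 1))"
      using int[of u] by (simp add: prob_space)
    finally show "(\<integral>\<^sup>+\<omega>. ennreal (indicator {0<..} u * ((1 - cos (u * Y \<omega>)) * u powr (- \<eta> - 1))) \<partial>M) =
        ennreal (indicator {0<..} u * ((1 - (\<integral>\<omega>. cos (u * Y \<omega>) \<partial>M)) * u powr (- \<eta> - 1)))" .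
  qed
  finally have eq: "(\<integral>\<^sup>+\<omega>. ennreal (\<bar>Y \<omega>\<bar> powr \<eta> * cos_const \<eta>) \<partial>M) = \<dots>" .
  \<comment> \<open>Should the common nonnegative integral be infinite, both Bochner integrals are 0
    by convention, so the identity persists.\<close>
  have "(\<integral>\<omega>. \<bar>Y \<omega>\<bar> powr \<eta> * cos_const \<eta> \<partial>M) =
    enn2real (\<integral>\<^sup>+\<omega>. ennreal (\<bar>Y \<omega>\<bar> powr \<eta> * cos_const \<eta>) \<partial>M)"
    using cos_const_pos[OF \<eta>] by (intro integral_eq_nn_integral) auto
  also have "\<dots> = (LINT u:{0<..}|lborel. (1 - (\<integral>\<omega>. cos (u * Y \<omega>) \<partial>M)) * u powr (- \<eta> - 1))"
    unfolding eq set_lebesgue_integral_def real_scaleR_def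
    using le1 by (intro integral_eq_nn_integral[symmetric]) auto
  finally have "(\<integral>\<omega>. \<bar>Y \<omega>\<bar> powr \<eta> * cos_const \<eta> \<partial>M) = \<dots>" .
  then show ?thesis using cos_const_pos[OF \<eta>] by (simp add: field_simps)
qed

context lepage_series
begin

text \<open>Truncating the kernel at \<open>T\<close> makes the partial sums eventually constant, so the random number of
  summands is reached as a limit of deterministic ones.\<close>

lemma expectation_cos_upto:
  fixes f :: "real \<Rightarrow> real \<Rightarrow> real"
  assumes [measurable]: "case_prod f \<in> borel_measurable (borel \<Otimes>\<^sub>M borel)" and T: "0 < T"
    and cont: "continuous_on {0<..} (\<lambda>x. \<integral>\<omega>. cos (f x (V 0 \<omega>)) \<partial>M)"
  shows "(\<integral>\<omega>. cos (\<Sum>i<arrival_count T \<omega>. \<gamma> i \<omega> * f (\<Gamma> i \<omega>) (V i \<omega>)) \<partial>M) =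
    exp (- (LINT x:{0<..T}|lborel. 1 - (\<integral>\<omega>. cos (f x (V 0 \<omega>)) \<partial>M)))"
proof -
  define g where "g x = (\<integral>\<omega>. cos (f x (V 0 \<omega>)) \<partial>M)" for x
  have [measurable]: "g \<in> borel_measurable borel" unfolding g_def[abs_def] by measurable
  have g: "\<bar>g x\<bar> \<le> 1" for x
  proof -
    have "\<bar>g x\<bar> \<le> (\<integral>\<omega>. \<bar>cos (f x (V 0 \<omega>))\<bar> \<partial>M)" unfolding g_def by (rule integral_abs_bound)
    also have "\<dots> \<le> (\<integral>\<omega>. 1 \<partial>M)"
      by (intro integral_mono integrable_const_bound[where B=1]) auto
    finally show ?thesis by (simp add: prob_space)
  qed
  define f' where "f' x v = (if x \<le> T then f x v else 0)" for x v
  have [measurable]: "case_prod f' \<in> borel_measurable (borel \<Otimes>\<^sub>M borel)"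
    unfolding f'_def[abs_def] by measurable
  define g' where "g' x = (\<integral>\<omega>. cos (f' x (V 0 \<omega>)) \<partial>M)" for x
  \<comment> \<open>Past \<open>T\<close> a summand is 0 and its factor is 1, so neither the sum nor
    the product changes.\<close>
  have g': "g' x = (if x \<le> T then g x else 1)" for x by (simp add: g'_def f'_def g_def prob_space)
  have [measurable]: "g' \<in> borel_measurable borel" unfolding g'[abs_def] by measurable
  have [measurable]: "arrival_count T \<in> measurable M (count_space UNIV)"
    using T by (intro arrival_count_measurable) simp
  let ?S = "\<lambda>m \<omega>. \<Sum>i<m. \<gamma> i \<omega> * f (\<Gamma> i \<omega>) (V i \<omega>)" and ?S' = "\<lambda>m \<omega>. \<Sum>i<m. \<gamma> i \<omega> * f' (\<Gamma> i \<omega>) (V i \<omega>)"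
  have stab: "?S' m \<omega> = ?S (arrival_count T \<omega>) \<omega>"
      "(\<Prod>i<m. g' (\<Gamma> i \<omega>)) = (\<Prod>i<arrival_count T \<omega>. g (\<Gamma> i \<omega>))"
    if \<omega>: "regular_arrivals \<omega>" and m: "arrival_count T \<omega> \<le> m" for m \<omega>
  proof -
    have out: "\<not> \<Gamma> i \<omega> \<le> T" if "arrival_count T \<omega> \<le> i" for i
      using that less_arrival_count_iff[OF \<omega>, of i T] by simp
    have inn: "\<Gamma> i \<omega> \<le> T" if "i < arrival_count T \<omega>" for i
      using that less_arrival_count_iff[OF \<omega>, of i T] by simp
    have "?S' m \<omega> = ?S' (arrival_count T \<omega>) \<omega>"
      using m by (intro sum.mono_neutral_right) (auto simp: f'_def dest: out)
    also have "\<dots> = ?S (arrival_count T \<omega>) \<omega>"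
      by (intro sum.cong) (auto simp: f'_def dest: inn)
    finally show "?S' m \<omega> = ?S (arrival_count T \<omega>) \<omega>" .
    have "(\<Prod>i<m. g' (\<Gamma> i \<omega>)) = (\<Prod>i<arrival_count T \<omega>. g' (\<Gamma> i \<omega>))"
      using m by (intro prod.mono_neutral_right) (auto simp: g' dest: out)
    also have "\<dots> = (\<Prod>i<arrival_count T \<omega>. g (\<Gamma> i \<omega>))"
      by (intro prod.cong) (auto simp: g' dest: inn)
    finally show "(\<Prod>i<m. g' (\<Gamma> i \<omega>)) = (\<Prod>i<arrival_count T \<omega>. g (\<Gamma> i \<omega>))" .
  qed
  have ev: "\<forall>\<^sub>F m in sequentially. arrival_count T \<omega> \<le> m" for \<omega>
    by (rule eventually_ge_at_top)
  have meas1: "(\<lambda>\<omega>. cos (?S (arrival_count T \<omega>) \<omega>)) \<in> borel_measurable M"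
    by (rule measurable_compose_countable[where f="\<lambda>m \<omega>. cos (?S m \<omega>)"]) measurable
  have meas2: "(\<lambda>\<omega>. \<Prod>i<arrival_count T \<omega>. g (\<Gamma> i \<omega>)) \<in> borel_measurable M"
    by (rule measurable_compose_countable[where f="\<lambda>m \<omega>. \<Prod>i<m. g (\<Gamma> i \<omega>)"]) measurable
  have lim1: "(\<lambda>m. \<integral>\<omega>. cos (?S' m \<omega>) \<partial>M) \<longlonglongrightarrow> (\<integral>\<omega>. cos (?S (arrival_count T \<omega>) \<omega>) \<partial>M)"
  proof (rule integral_dominated_convergence[where w="\<lambda>_. 1"])
    show "AE \<omega> in M. (\<lambda>m. cos (?S' m \<omega>)) \<longlonglongrightarrow> cos (?S (arrival_count T \<omega>) \<omega>)"
      using AE_regular_arrivals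
    proof eventually_elim
      case (elim \<omega>)
      show ?case
        by (rule tendsto_eventually, rule eventually_mono[OF ev[of \<omega>]]) (simp only: stab[OF elim])
    qed
  qed (auto intro: meas1)
  have lim2: "(\<lambda>m. \<integral>\<omega>. (\<Prod>i<m. g' (\<Gamma> i \<omega>)) \<partial>M) \<longlonglongrightarrow> (\<integral>\<omega>. (\<Prod>i<arrival_count T \<omega>. g (\<Gamma> i \<omega>)) \<partial>M)"
  proof (rule integral_dominated_convergence[where w="\<lambda>_. 1"])
    show "AE \<omega> in M. (\<lambda>m. \<Prod>i<m. g' (\<Gamma> i \<omega>)) \<longlonglongrightarrow> (\<Prod>i<arrival_count T \<omega>. g (\<Gamma> i \<omega>))"
      using AE_regular_arrivals
    proof eventually_elim
      case (elim \<omega>)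
      show ?case
        by (rule tendsto_eventually, rule eventually_mono[OF ev[of \<omega>]]) (simp only: stab[OF elim])
    qed
    show "AE \<omega> in M. norm (\<Prod>i<m. g' (\<Gamma> i \<omega>)) \<le> 1" for m
      using g by (intro AE_I2) (auto simp: abs_prod g' intro!: prod_le_1)
  qed (auto intro: meas2)
  have "(\<lambda>m. \<integral>\<omega>. cos (?S' m \<omega>) \<partial>M) = (\<lambda>m. \<integral>\<omega>. (\<Prod>i<m. g' (\<Gamma> i \<omega>)) \<partial>M)"
    unfolding g'_def by (intro ext expectation_cos_partial_sum) simp
  then have "(\<integral>\<omega>. cos (?S (arrival_count T \<omega>) \<omega>) \<partial>M) = (\<integral>\<omega>. (\<Prod>i<arrival_count T \<omega>. g (\<Gamma> i \<omega>)) \<partial>M)"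
    using lim1 lim2 LIMSEQ_unique by auto
  also have "\<dots> = exp (- (LINT x:{0<..T}|lborel. 1 - g x))"
    using cont by (intro expectation_prod_arrivals T g) (auto simp: g_def)
  finally show ?thesis by (simp only: g_def)
qed

text \<open>The horizon tends to infinity. The count then does so too, so the sums of random length
  converge to the series along its own partial sums; conditional convergence is enough.\<close>

lemma expectation_cos_series:
  fixes f :: "real \<Rightarrow> real \<Rightarrow> real"
  assumes [measurable]: "case_prod f \<in> borel_measurable (borel \<Otimes>\<^sub>M borel)"
    and cont: "continuous_on {0<..} (\<lambda>x. \<integral>\<omega>. cos (f x (V 0 \<omega>)) \<partial>M)"
    and int: "set_integrable lborel {0<..} (\<lambda>x. 1 - (\<integral>\<omega>. cos (f x (V 0 \<omega>)) \<partial>M))"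
    and sum: "AE \<omega> in M. summable (\<lambda>i. \<gamma> i \<omega> * f (\<Gamma> i \<omega>) (V i \<omega>))"
  shows "(\<integral>\<omega>. cos (\<Sum>i. \<gamma> i \<omega> * f (\<Gamma> i \<omega>) (V i \<omega>)) \<partial>M) =
    exp (- (LINT x:{0<..}|lborel. 1 - (\<integral>\<omega>. cos (f x (V 0 \<omega>)) \<partial>M)))"
proof -
  define h where "h x = 1 - (\<integral>\<omega>. cos (f x (V 0 \<omega>)) \<partial>M)" for x
  have [measurable]: "h \<in> borel_measurable borel" unfolding h_def[abs_def] by measurable
  let ?S = "\<lambda>m \<omega>. \<Sum>i<m. \<gamma> i \<omega> * f (\<Gamma> i \<omega>) (V i \<omega>)"
  have [measurable]: "arrival_count (real (Suc n)) \<in> measurable M (count_space UNIV)" for n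
    by (intro arrival_count_measurable) simp
  have meas1: "(\<lambda>\<omega>. cos (?S (arrival_count (real (Suc n)) \<omega>) \<omega>)) \<in> borel_measurable M" for n
    by (rule measurable_compose_countable[where f="\<lambda>m \<omega>. cos (?S m \<omega>)"]) measurable
  have lim: "(\<lambda>n. \<integral>\<omega>. cos (?S (arrival_count (real (Suc n)) \<omega>) \<omega>) \<partial>M) \<longlonglongrightarrow>
     (\<integral>\<omega>. cos (\<Sum>i. \<gamma> i \<omega> * f (\<Gamma> i \<omega>) (V i \<omega>)) \<partial>M)"
  proof (rule integral_dominated_convergence[where w="\<lambda>_. 1"])
    show "AE \<omega> in M. (\<lambda>n. cos (?S (arrival_count (real (Suc n)) \<omega>) \<omega>)) \<longlonglongrightarrow> cos (\<Sum>i. \<gamma> i \<omega> * f (\<Gamma> i \<omega>) (V i \<omega>))"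
      using AE_regular_arrivals sum
    proof eventually_elim
      case (elim \<omega>)
      have "filterlim (\<lambda>n. arrival_count (real (Suc n)) \<omega>) sequentially sequentially"
        using filterlim_compose[OF filterlim_arrival_count[OF elim(1)] filterlim_Suc] .
      from filterlim_compose[OF summable_LIMSEQ[OF elim(2)] this] show ?case
        by (intro tendsto_cos)
    qed
  qed ((rule meas1 | simp)+)
  have eq: "(\<lambda>n. \<integral>\<omega>. cos (?S (arrival_count (real (Suc n)) \<omega>) \<omega>) \<partial>M) =
     (\<lambda>n. exp (- (LINT x:{0<..real (Suc n)}|lborel. h x)))"
    unfolding h_def by (intro ext expectation_cos_upto cont) auto
  have "(\<lambda>n. exp (- (LINT x:{0<..real (Suc n)}|lborel. h x))) \<longlonglongrightarrow> exp (- (LINT x:{0<..}|lborel. h x))"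
    unfolding set_lebesgue_integral_def
  proof (intro tendsto_exp tendsto_minus integral_dominated_convergence[where w="\<lambda>x. \<bar>indicator {0<..} x *\<^sub>R h x\<bar>"])
    show "integrable lborel (\<lambda>x. \<bar>indicator {0<..} x *\<^sub>R h x\<bar>)"
      using int unfolding set_integrable_def h_def by (rule integrable_abs)
    show "AE x in lborel. (\<lambda>n. indicator {0<..real (Suc n)} x *\<^sub>R h x) \<longlonglongrightarrow> indicator {0<..} x *\<^sub>R h x"
    proof (intro AE_I2)
      fix x :: real
      have "\<forall>\<^sub>F n in sequentially. x \<le> real n"
        using filterlim_real_sequentially by (auto simp: filterlim_at_top)
      then have "\<forall>\<^sub>F n in sequentially. indicator {0<..real (Suc n)} x *\<^sub>R h x = indicator {0<..} x *\<^sub>R h x"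
        by eventually_elim (auto simp: indicator_def)
      then show "(\<lambda>n. indicator {0<..real (Suc n)} x *\<^sub>R h x) \<longlonglongrightarrow> indicator {0<..} x *\<^sub>R h x"
        by (rule tendsto_eventually)
    qed
    show "AE x in lborel. norm (indicator {0<..real (Suc n)} x *\<^sub>R h x) \<le> \<bar>indicator {0<..} x *\<^sub>R h x\<bar>" for n
      by (intro AE_I2) (auto simp: indicator_def)
  qed measurable
  then show ?thesis
    unfolding h_def[symmetric] by (rule LIMSEQ_unique[OF lim[unfolded eq]])
qed

lemma expectation_indicator_V:
  assumes "0 \<le> s" "s \<le> 1"
  shows "(\<integral>\<omega>. indicator {0..s} (V 0 \<omega>) \<partial>M) = (s :: real)"
proof -
  have "(\<integral>\<omega>. indicator {0..s} (V 0 \<omega>) \<partial>M) = (\<integral>v. indicator {0..s} v \<partial>distr M borel (V 0) :: real)"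
    by (rule integral_distr[symmetric]) auto
  also have "\<dots> = measure (uniform_measure lborel {0..1}) {0..s}"
    by (simp add: distr_V)
  also have "\<dots> = s"
    using assms by (subst measure_uniform_measure) (auto simp: Int_atLeastAtMost min_def)
  finally show ?thesis .
qed

lemma expectation_cos_increment:
  fixes \<alpha> :: "real \<Rightarrow> real"
  assumes t: "0 < t" "0 < \<epsilon>" "t + \<epsilon> \<le> 1" and \<alpha>: "1 < \<alpha> t" "\<alpha> t < 2" "1 < \<alpha> (t + \<epsilon>)" "\<alpha> (t + \<epsilon>) < 2"
    and u: "0 < u"
  shows "(\<integral>\<omega>. cos (u * (multistable_levy_motion \<alpha> \<Gamma> V \<gamma> (t + \<epsilon>) \<omega> - multistable_levy_motion \<alpha> \<Gamma> V \<gamma> t \<omega>)) \<partial>M)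
    = exp (- increment_exponent \<alpha> t \<epsilon> u)"
proof -
  define a where "a = \<alpha> t"
  define a' where "a' = \<alpha> (t + \<epsilon>)"
  define A where "A = stable_const a powr (1 / a)"
  define A' where "A' = stable_const a' powr (1 / a')"
  have a: "1 < a" "a < 2" "1 < a'" "a' < 2" using \<alpha> by (simp_all add: a_def a'_def)
  have A: "0 \<le> A" "0 \<le> A'" by (simp_all add: A_def A'_def)
  define F where "F x v = A' * x powr (- 1 / a') * indicator {0..t + \<epsilon>} v - A * x powr (- 1 / a) * indicator {0..t} v"
    for x v :: real
  define D where "D x = A' * x powr (- 1 / a') - A * x powr (- 1 / a)" for x :: real
  define E where "E x = A' * x powr (- 1 / a')" for x :: real
  have [measurable]: "D \<in> borel_measurable borel" unfolding D_def[abs_def] by measurable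
  have F_meas: "(\<lambda>(x, v). u * F x v) \<in> borel_measurable (borel \<Otimes>\<^sub>M borel)"
    unfolding F_def by measurable
  \<comment> \<open>The three cases for the position (in both intervals, only in the longer one, in
    neither) written with nested indicators, so that only the probabilities of \<open>{0..t}\<close>
    and \<open>{0..t + \<epsilon>}\<close> occur.\<close>
  have cosF: "cos (u * F x v) = 1 + indicator {0..t + \<epsilon>} v * (cos (u * E x) - 1) + indicator {0..t} v * (cos (u * D x) - cos (u * E x))" for x v
    using t by (auto simp: F_def D_def E_def indicator_def)
  have g: "(\<integral>\<omega>. cos (u * F x (V 0 \<omega>)) \<partial>M) = 1 + (t + \<epsilon>) * (cos (u * E x) - 1) + t * (cos (u * D x) - cos (u * E x))" for x
  proof -
    have i: "integrable M (\<lambda>\<omega>. indicator {0..s} (V 0 \<omega>) :: real)" for s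
      by (rule integrable_const_bound[where B=1]) auto
    show ?thesis
      unfolding cosF using t i[of t] i[of "t + \<epsilon>"]
      by (simp add: expectation_indicator_V prob_space)
  qed
  have g': "1 - (\<integral>\<omega>. cos (u * F x (V 0 \<omega>)) \<partial>M) = t * (1 - cos (u * D x)) + \<epsilon> * (1 - cos (u * E x))" for x
    unfolding g by (simp add: algebra_simps)
  have cont: "continuous_on {0<..} (\<lambda>x. \<integral>\<omega>. cos (u * F x (V 0 \<omega>)) \<partial>M)"
    unfolding g D_def E_def by (intro continuous_intros) auto
  have intE: "set_integrable lborel {0<..} (\<lambda>x. 1 - cos (u * E x))"
    using set_integrable_one_minus_cos_powr[of a' "u * A'"] a by (simp add: E_def mult.assoc)
  have intD: "set_integrable lborel {0<..} (\<lambda>x. 1 - cos (u * D x))"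
  \<comment> \<open>Exponent 1 suffices near 0 because both indices exceed 1, and the square at
    infinity because both are below 2. The added 1 keeps \<open>r\<close> positive without knowing
    the sign of the scales strictly.\<close>
  proof (rule LINT_one_minus_cos_bound(3)[where p=1 and r="u * (A + A' + 1)"])
    let ?m = "max (1 / a) (1 / a')" and ?l = "min (1 / a) (1 / a')"
    show "\<bar>u * D x\<bar> \<le> u * (A + A' + 1) * powr_env (- ?m) (- ?l) x" if x: "0 < x" for x
    proof -
      have "x powr (- 1 / a) \<le> powr_env (- ?m) (- ?l) x" "x powr (- 1 / a') \<le> powr_env (- ?m) (- ?l) x"
        using x by (auto intro!: powr_le_powr_env simp: le_max_iff_disj min_le_iff_disj)
      then have "A * x powr (- 1 / a) \<le> A * powr_env (- ?m) (- ?l) x" "A' * x powr (- 1 / a') \<le> A' * powr_env (- ?m) (- ?l) x"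
        using A by (auto intro: mult_left_mono)
      moreover have "0 \<le> A * x powr (- 1 / a)" "0 \<le> A' * x powr (- 1 / a')" using A by auto
      ultimately have "\<bar>D x\<bar> \<le> (A + A' + 1) * powr_env (- ?m) (- ?l) x"
        unfolding D_def distrib_right using powr_env_nonneg[of "- ?m" "- ?l" x] by linarith
      then show ?thesis using u by (simp add: abs_mult mult.assoc)
    qed
    show "1 < 2 * ?l" using a by (auto simp: min_def field_simps)
    show "1 * ?m < 1" using a by (auto simp: max_def field_simps)
    show "0 < u * (A + A' + 1)" using u A by (intro mult_pos_pos) auto
  qed auto
  have inc: "(LINT x:{0<..}|lborel. 1 - (\<integral>\<omega>. cos (u * F x (V 0 \<omega>)) \<partial>M)) = increment_exponent \<alpha> t \<epsilon> u"
  proof -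
    have "(LINT x:{0<..}|lborel. 1 - (\<integral>\<omega>. cos (u * F x (V 0 \<omega>)) \<partial>M)) =
      t * (LINT x:{0<..}|lborel. 1 - cos (u * D x)) + \<epsilon> * (LINT x:{0<..}|lborel. 1 - cos (u * E x))"
      unfolding g' using intD intE by (subst set_integral_add) auto
    also have "(LINT x:{0<..}|lborel. 1 - cos (u * E x)) = u powr a'"
      using LINT_one_minus_cos_stable[of a' u] a u by (simp add: E_def A'_def)
    finally show ?thesis
      by (simp add: increment_exponent_def D_def A_def A'_def a_def a'_def)
  qed
  \<comment> \<open>Both series converge almost surely because the reciprocal indices exceed 1/2;
    only then is the difference of the two limits the sum of one series with kernel
    \<open>F\<close>.\<close>
  have "AE \<omega> in M. summable (\<lambda>i. \<gamma> i \<omega> * indicator {0..t} (V i \<omega>) * \<Gamma> i \<omega> powr (- (1 / a)))"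
    "AE \<omega> in M. summable (\<lambda>i. \<gamma> i \<omega> * indicator {0..t + \<epsilon>} (V i \<omega>) * \<Gamma> i \<omega> powr (- (1 / a')))"
    using a by (intro AE_summable_lepage; simp add: field_simps indicator_def)+
  then have sums: "AE \<omega> in M. (\<lambda>i. \<gamma> i \<omega> * (u * F (\<Gamma> i \<omega>) (V i \<omega>))) sums
     (u * (multistable_levy_motion \<alpha> \<Gamma> V \<gamma> (t + \<epsilon>) \<omega> - multistable_levy_motion \<alpha> \<Gamma> V \<gamma> t \<omega>))"
  proof eventually_elim
    case (elim \<omega>)
    have 1: "(\<lambda>i. \<gamma> i \<omega> * \<Gamma> i \<omega> powr (- 1 / a) * indicator {0..t} (V i \<omega>)) sums
        (\<Sum>i. \<gamma> i \<omega> * \<Gamma> i \<omega> powr (- 1 / a) * indicator {0..t} (V i \<omega>))"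
      using elim(1) by (intro summable_sums) (simp add: mult_ac)
    have 2: "(\<lambda>i. \<gamma> i \<omega> * \<Gamma> i \<omega> powr (- 1 / a') * indicator {0..t + \<epsilon>} (V i \<omega>)) sums
        (\<Sum>i. \<gamma> i \<omega> * \<Gamma> i \<omega> powr (- 1 / a') * indicator {0..t + \<epsilon>} (V i \<omega>))"
      using elim(2) by (intro summable_sums) (simp add: mult_ac)
    from sums_mult[OF sums_diff[OF sums_mult[OF 2, of A'] sums_mult[OF 1, of A]], of u]
    show ?case
      by (simp add: multistable_levy_motion_def multistable_field_def F_def A_def A'_def a_def a'_def algebra_simps)
  qed
  have "(\<integral>\<omega>. cos (u * (multistable_levy_motion \<alpha> \<Gamma> V \<gamma> (t + \<epsilon>) \<omega> - multistable_levy_motion \<alpha> \<Gamma> V \<gamma> t \<omega>)) \<partial>M)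
    = (\<integral>\<omega>. cos (\<Sum>i. \<gamma> i \<omega> * (u * F (\<Gamma> i \<omega>) (V i \<omega>))) \<partial>M)"
  proof (rule integral_cong_AE)
    show "(\<lambda>\<omega>. cos (u * (multistable_levy_motion \<alpha> \<Gamma> V \<gamma> (t + \<epsilon>) \<omega> - multistable_levy_motion \<alpha> \<Gamma> V \<gamma> t \<omega>))) \<in> borel_measurable M"
      unfolding multistable_levy_motion_def multistable_field_def by measurable
    show "(\<lambda>\<omega>. cos (\<Sum>i. \<gamma> i \<omega> * (u * F (\<Gamma> i \<omega>) (V i \<omega>)))) \<in> borel_measurable M"
      unfolding F_def by measurable
    show "AE \<omega> in M. cos (u * (multistable_levy_motion \<alpha> \<Gamma> V \<gamma> (t + \<epsilon>) \<omega> - multistable_levy_motion \<alpha> \<Gamma> V \<gamma> t \<omega>)) =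
       cos (\<Sum>i. \<gamma> i \<omega> * (u * F (\<Gamma> i \<omega>) (V i \<omega>)))"
      using sums by eventually_elim (rule arg_cong[where f=cos], rule sums_unique)
  qed
  also have "\<dots> = exp (- (LINT x:{0<..}|lborel. 1 - (\<integral>\<omega>. cos (u * F x (V 0 \<omega>)) \<partial>M)))"
  proof (rule expectation_cos_series[OF F_meas cont])
    show "set_integrable lborel {0<..} (\<lambda>x. 1 - (\<integral>\<omega>. cos (u * F x (V 0 \<omega>)) \<partial>M))"
      unfolding g' using intD intE by (intro set_integral_add) auto
    show "AE \<omega> in M. summable (\<lambda>i. \<gamma> i \<omega> * (u * F (\<Gamma> i \<omega>) (V i \<omega>)))"
      using sums by eventually_elim (rule sums_summable)
  qed
  finally show ?thesis by (simp only: inc)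
qed

end

theorem theorem5:
  fixes M :: "'a measure"
    and \<alpha> :: "real \<Rightarrow> real" and c d t \<eta> :: real
    and \<Gamma> V \<gamma> :: "nat \<Rightarrow> 'a \<Rightarrow> real"
  assumes "prob_space M"
    and "1 < c" and "d < 2" and "\<alpha> ` {0..1} \<subseteq> {c..d}" and "C1_on {0..1} \<alpha>"
    and "poisson_arrival_times M 1 \<Gamma>"
    and "prob_space.indep_vars M (\<lambda>_. borel) V UNIV"
    and "\<And>i. distr M borel (V i) = uniform_measure lborel {0..1}"
    and "prob_space.indep_vars M (\<lambda>_. borel) \<gamma> UNIV"
    and "\<And>i. measure M {\<omega> \<in> space M. \<gamma> i \<omega> = 1} = 1 / 2"
    and "\<And>i. measure M {\<omega> \<in> space M. \<gamma> i \<omega> = - 1} = 1 / 2"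
    and "prob_space.indep_vars M (\<lambda>_. PiM UNIV (\<lambda>_. borel))
           (\<lambda>k \<omega> i. ([\<Gamma>, V, \<gamma>] ! k) i \<omega>) {..<3}"
    and "0 < t" and "t < 1" and "0 < \<eta>" and "\<eta> < c"
  shows "(\<lambda>\<epsilon>. \<integral>\<omega>. \<bar>multistable_levy_motion \<alpha> \<Gamma> V \<gamma> (t + \<epsilon>) \<omega>
                   - multistable_levy_motion \<alpha> \<Gamma> V \<gamma> t \<omega>\<bar> powr \<eta> \<partial>M)
         \<sim>[at_right 0]
         (\<lambda>\<epsilon>. 2 powr (\<eta> - 1) * Gamma (1 - \<eta> / \<alpha> t)
               / (\<eta> * integral {0..} (\<lambda>u. u powr (- \<eta> - 1) * (sin u)\<^sup>2))
               * \<epsilon> powr (\<eta> / \<alpha> t))"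
proof -
  interpret lepage_series M \<Gamma> V \<gamma>
    using assms by (intro lepage_series.intro lepage_series_axioms.intro) auto
  have \<alpha>_range: "1 < \<alpha> s" "\<alpha> s < 2" "\<eta> < \<alpha> s" if "s \<in> {0..1}" for s
  proof -
    have "c \<le> \<alpha> s" "\<alpha> s \<le> d" using assms(4) that by (auto simp: image_subset_iff)
    then show "1 < \<alpha> s" "\<alpha> s < 2" "\<eta> < \<alpha> s" using assms(2,3,16) by linarith+
  qed
  have t01: "t \<in> {0..1}" using assms(13,14) by simp
  have \<eta>: "0 < \<eta>" "\<eta> < 2" using \<alpha>_range[OF t01] assms(15) by auto
  obtain D where "(\<alpha> has_real_derivative D) (at t within {0..1})"
    using assms(5) t01 unfolding C1_on_def by blast
  \<comment> \<open>Since \<open>t\<close> is interior, the derivative relative to the interval is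
    an ordinary one.\<close>
  moreover have "at t within {0..1} = at t" using assms(13,14) by (intro at_within_interior) auto
  ultimately have D: "(\<alpha> has_real_derivative D) (at t)" by simp
  let ?Y = "\<lambda>\<epsilon> \<omega>. multistable_levy_motion \<alpha> \<Gamma> V \<gamma> (t + \<epsilon>) \<omega> - multistable_levy_motion \<alpha> \<Gamma> V \<gamma> t \<omega>"
  define L where "L = 2 powr (\<eta> - 1) * Gamma (1 - \<eta> / \<alpha> t)
               / (\<eta> * integral {0..} (\<lambda>u. u powr (- \<eta> - 1) * (sin u)\<^sup>2))"
  have K: "0 < cos_const \<eta>" by (rule cos_const_pos[OF \<eta>])
  have L_eq: "L = Gamma (1 - \<eta> / \<alpha> t) / \<eta> / cos_const \<eta>"
    unfolding L_def cos_const_eq[OF \<eta>] by (simp add: powr_diff field_simps)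
  have "0 < Gamma (1 - \<eta> / \<alpha> t)"
    using \<alpha>_range[OF t01] by (intro Gamma_real_pos) simp
  \<comment> \<open>The asymptotic equivalence is proved as a quotient tending to 1, which requires
    dividing by \<open>L\<close>.\<close>
  then have L_pos: "0 < L" using K \<eta> by (simp add: L_eq)
  have "((\<lambda>\<epsilon>. (LINT u:{0<..}|lborel. (1 - exp (- increment_exponent \<alpha> t \<epsilon> u)) * u powr (- \<eta> - 1))
            / \<epsilon> powr (\<eta> / \<alpha> t) / cos_const \<eta> / L) \<longlongrightarrow> Gamma (1 - \<eta> / \<alpha> t) / \<eta> / cos_const \<eta> / L) (at_right 0)"
    using \<alpha>_range[OF t01] assms(13) \<eta> D K L_pos
    by (intro tendsto_divide tendsto_const increment_exponent_asymptotics[of \<alpha> D]) auto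
  also have "Gamma (1 - \<eta> / \<alpha> t) / \<eta> / cos_const \<eta> / L = 1" using L_pos unfolding L_eq[symmetric] by simp
  finally have lim: "((\<lambda>\<epsilon>. (LINT u:{0<..}|lborel. (1 - exp (- increment_exponent \<alpha> t \<epsilon> u)) * u powr (- \<eta> - 1))
            / \<epsilon> powr (\<eta> / \<alpha> t) / cos_const \<eta> / L) \<longlongrightarrow> 1) (at_right 0)" .
  have "\<forall>\<^sub>F \<epsilon> in at_right 0. \<epsilon> \<in> {0<..<1 - t}"
    using assms(14) by (intro eventually_at_right_real) simp
  then have "\<forall>\<^sub>F \<epsilon> in at_right 0.
     (LINT u:{0<..}|lborel. (1 - exp (- increment_exponent \<alpha> t \<epsilon> u)) * u powr (- \<eta> - 1))
            / \<epsilon> powr (\<eta> / \<alpha> t) / cos_const \<eta> / L =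
     (\<integral>\<omega>. \<bar>?Y \<epsilon> \<omega>\<bar> powr \<eta> \<partial>M) / (L * \<epsilon> powr (\<eta> / \<alpha> t))"
  proof eventually_elim
    case (elim \<epsilon>)
    \<comment> \<open>The later time must not leave the unit interval: there the range of \<alpha>
      is controlled and \<open>{0..t + \<epsilon>}\<close> has probability
      \<open>t + \<epsilon>\<close>.\<close>
    then have \<epsilon>: "0 < \<epsilon>" "t + \<epsilon> \<le> 1" "t + \<epsilon> \<in> {0..1}" using assms(13) by auto
    have "?Y \<epsilon> \<in> borel_measurable M"
      unfolding multistable_levy_motion_def multistable_field_def by measurable
    from abs_moment_eq_LINT[OF \<eta> this]
    have "(\<integral>\<omega>. \<bar>?Y \<epsilon> \<omega>\<bar> powr \<eta> \<partial>M) =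
      (LINT u:{0<..}|lborel. (1 - (\<integral>\<omega>. cos (u * ?Y \<epsilon> \<omega>) \<partial>M)) * u powr (- \<eta> - 1)) / cos_const \<eta>" .
    also have "(LINT u:{0<..}|lborel. (1 - (\<integral>\<omega>. cos (u * ?Y \<epsilon> \<omega>) \<partial>M)) * u powr (- \<eta> - 1)) =
       (LINT u:{0<..}|lborel. (1 - exp (- increment_exponent \<alpha> t \<epsilon> u)) * u powr (- \<eta> - 1))"
      using expectation_cos_increment[of t \<epsilon> \<alpha>] \<alpha>_range[OF t01] \<alpha>_range[OF \<epsilon>(3)] \<epsilon> assms(13)
      by (intro set_lebesgue_integral_cong) auto
    finally show ?case by (simp add: mult.commute)
  qed
  from Lim_transform_eventually[OF lim this]
  show ?thesis unfolding L_def[symmetric] by (rule asymp_equivI')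
qed

end
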